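(* Let $0<\rho<1$ and let $N>1$ be an integer. Then $\mu_{\rho,N}$ is a spectral measure if and only if $\rho=\frac1q$ for some integer $q>1$ with $N\mid q$.
   Context: For $0<\rho<1$ and an integer $N>1$, $\mu_{\rho,N}$ denotes the unique Borel probability measure on $\mathbb R$ satisfying $\mu_{\rho,N}(\cdot)=\frac1N\sum_{j=0}^{N-1}\mu_{\rho,N}(\rho^{-1}(\cdot)-j)$. A compactly supported probability measure $\mu$ on $\mathbb R$ is called a spectral measure if there is a countable set $\Lambda\subset\mathbb R$ (a spectrum of $\mu$) such that $\{e^{-2\pi i\lambda x}:\lambda\in\Lambda\}$ is an orthogonal basis of $L^2(\mu)$. *)

theory Defs
  imports "HOL-Probability.Probability"
begin

section \<open>The self-similar measures with consecutive digits\<close>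

definition self_similar :: "real \<Rightarrow> nat \<Rightarrow> real measure \<Rightarrow> bool" where
  "self_similar \<rho> N M \<longleftrightarrow>
     (\<forall>A\<in>sets borel. measure M A =
        (1 / real N) * (\<Sum>j<N. measure M ((\<lambda>x. inverse \<rho> * x - real j) ` A)))"

text \<open>
  The definite description is justified by \<open>self_similar_measure_ex1\<close> below, for
  \<open>0 < \<rho> < 1\<close> and \<open>N > 1\<close>; other parameters are irrelevant.
\<close>

definition mu :: "real \<Rightarrow> nat \<Rightarrow> real measure" where
  "mu \<rho> N = (THE M. prob_space M \<and> sets M = sets borel \<and> self_similar \<rho> N M)"


section \<open>Square-integrable complex functions\<close>

text \<open>
  Members of \<^term>\<open>L2_space M\<close> are functions rather than classes modulo null sets; as
  \<open>L2_norm\<close> is only a seminorm on them, \<open>orthogonal_basis_L2\<close> requires its members to have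
  nonzero norm.
\<close>

definition L2_space :: "'a measure \<Rightarrow> ('a \<Rightarrow> complex) set" where
  "L2_space M = {f \<in> borel_measurable M. integrable M (\<lambda>x. (cmod (f x))\<^sup>2)}"

definition L2_inner :: "'a measure \<Rightarrow> ('a \<Rightarrow> complex) \<Rightarrow> ('a \<Rightarrow> complex) \<Rightarrow> complex" where
  "L2_inner M f g = (\<integral>x. f x * cnj (g x) \<partial>M)"

definition L2_norm :: "'a measure \<Rightarrow> ('a \<Rightarrow> complex) \<Rightarrow> real" where
  "L2_norm M f = sqrt (\<integral>x. (cmod (f x))\<^sup>2 \<partial>M)"

text \<open>
  The family \<open>e\<close> indexed by \<open>I\<close> is an orthogonal basis: nonzero, mutually orthogonal
  elements whose finite linear combinations are dense.
\<close>

definition orthogonal_basis_L2 :: "'a measure \<Rightarrow> 'i set \<Rightarrow> ('i \<Rightarrow> 'a \<Rightarrow> complex) \<Rightarrow> bool" where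
  "orthogonal_basis_L2 M I e \<longleftrightarrow>
     (\<forall>i\<in>I. e i \<in> L2_space M \<and> L2_norm M (e i) \<noteq> 0) \<and>
     (\<forall>i\<in>I. \<forall>j\<in>I. i \<noteq> j \<longrightarrow> L2_inner M (e i) (e j) = 0) \<and>
     (\<forall>f\<in>L2_space M. \<forall>\<epsilon>>0. \<exists>F c. finite F \<and> F \<subseteq> I \<and>
        L2_norm M (\<lambda>x. f x - (\<Sum>i\<in>F. c i * e i x)) < \<epsilon>)"


section \<open>Spectral measures\<close>

definition measure_support :: "'a::topological_space measure \<Rightarrow> 'a set" where
  "measure_support M = {x. \<forall>U. open U \<and> x \<in> U \<longrightarrow> emeasure M U > 0}"

definition is_spectrum :: "real measure \<Rightarrow> real set \<Rightarrow> bool" where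
  "is_spectrum M \<Lambda> \<longleftrightarrow> countable \<Lambda> \<and>
     orthogonal_basis_L2 M \<Lambda> (\<lambda>l x. exp (- 2 * complex_of_real pi * \<i> * complex_of_real l * complex_of_real x))"

definition spectral_measure :: "real measure \<Rightarrow> bool" where
  "spectral_measure M \<longleftrightarrow>
     prob_space M \<and> sets M = sets borel \<and> compact (measure_support M) \<and> (\<exists>\<Lambda>. is_spectrum M \<Lambda>)"


section \<open>Existence and uniqueness of the self-similar measure\<close>

lemma digit_image_eq:
  assumes "0 < (\<rho>::real)"
  shows "(\<lambda>x. inverse \<rho> * x - real j) ` A = {x. \<rho> * (x + real j) \<in> A}"
proof (intro set_eqI iffI)
  fix x assume "x \<in> {x. \<rho> * (x + real j) \<in> A}"
  then show "x \<in> (\<lambda>x. inverse \<rho> * x - real j) ` A"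
    using assms by (intro image_eqI[of _ _ "\<rho> * (x + real j)"]) (auto simp: mult.assoc[symmetric])
qed (use assms in \<open>auto simp: field_simps\<close>)

abbreviation digits :: "nat \<Rightarrow> nat measure" where
  "digits N \<equiv> measure_pmf (pmf_of_set {..<N})"

lemma self_similar_distr:
  assumes \<rho>: "0 < \<rho>" and N: "1 < N" and M: "prob_space M" "sets M = sets borel"
    and ss: "self_similar \<rho> N M"
  shows "M = distr (digits N \<Otimes>\<^sub>M M) borel (\<lambda>(j, x). \<rho> * (x + real j))"
proof (rule measure_eqI)
  interpret M: prob_space M by fact
  note M(2)[measurable_cong]
  fix A assume "A \<in> sets M"
  then have A[measurable]: "A \<in> sets borel" using M by simp
  have "emeasure (distr (digits N \<Otimes>\<^sub>M M) borel (\<lambda>(j, x). \<rho> * (x + real j))) A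
      = (\<integral>\<^sup>+j. emeasure M {x. \<rho> * (x + real j) \<in> A} \<partial>digits N)"
  proof -
    have sp: "space M = UNIV" using sets_eq_imp_space_eq[OF M(2)] by simp
    have "(\<lambda>(j, x). \<rho> * (x + real j)) -` A \<inter> space (digits N \<Otimes>\<^sub>M M) \<in> sets (digits N \<Otimes>\<^sub>M M)"
      by measurable
    then show ?thesis
      by (subst emeasure_distr) (auto simp: M.emeasure_pair_measure_alt space_pair_measure sp vimage_def)
  qed
  also have "\<dots> = (\<Sum>j<N. ennreal (measure M {x. \<rho> * (x + real j) \<in> A})) / of_nat N"
    using N by (subst nn_integral_pmf_of_set) (auto simp: M.emeasure_eq_measure)
  also have "\<dots> = ennreal (1 / real N * (\<Sum>j<N. measure M {x. \<rho> * (x + real j) \<in> A}))"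
    using N by (subst sum_ennreal) (auto simp: ennreal_of_nat_eq_real_of_nat divide_ennreal sum_nonneg)
  also have "\<dots> = ennreal (measure M A)"
    using ss A unfolding self_similar_def digit_image_eq[OF \<rho>] by simp
  finally show "emeasure M A
      = emeasure (distr (digits N \<Otimes>\<^sub>M M) borel (\<lambda>(j, x). \<rho> * (x + real j))) A"
    by (simp add: M.emeasure_eq_measure)
qed (simp add: M)

lemma self_similar_char:
  assumes \<rho>: "0 < \<rho>" and N: "1 < N" and M: "prob_space M" "sets M = sets borel"
    and ss: "self_similar \<rho> N M"
  shows "char M t = (\<Sum>j<N. iexp (t * \<rho> * real j)) / of_nat N * char M (t * \<rho>)"
proof -
  interpret M: prob_space M by fact
  interpret P: pair_prob_space "digits N" M ..
  note M(2)[measurable_cong]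
  have "char M t = (\<integral>p. iexp (t * (\<rho> * (snd p + real (fst p)))) \<partial>(digits N \<Otimes>\<^sub>M M))"
    unfolding char_def
    by (subst self_similar_distr[OF assms], subst integral_distr) (auto simp: case_prod_beta)
  also have "\<dots> = (\<integral>j. \<integral>x. iexp (t * (\<rho> * (x + real j))) \<partial>M \<partial>digits N)"
    by (subst P.integral_fst'[symmetric])
       (auto intro!: P.integrable_const_bound[of _ 1])
  also have "\<dots> = (\<integral>j. iexp (t * \<rho> * real j) * char M (t * \<rho>) \<partial>digits N)"
  proof (rule Bochner_Integration.integral_cong[OF refl])
    fix j
    have "iexp (t * (\<rho> * (x + real j))) = iexp (t * \<rho> * real j) * iexp (t * \<rho> * x)" for x
      by (simp add: exp_add[symmetric] algebra_simps)
    then show "(\<integral>x. iexp (t * (\<rho> * (x + real j))) \<partial>M) = iexp (t * \<rho> * real j) * char M (t * \<rho>)"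
      unfolding char_def by simp
  qed
  also have "\<dots> = (\<Sum>j<N. iexp (t * \<rho> * real j)) / of_nat N * char M (t * \<rho>)"
    using N by (subst integral_measure_pmf[of "{..<N}"])
      (auto simp: sum_distrib_right sum_divide_distrib scaleR_conv_of_real lessThan_empty_iff)
  finally show ?thesis .
qed

lemma self_similar_unique:
  assumes \<rho>: "0 < \<rho>" "\<rho> < 1" and N: "1 < N"
    and M: "prob_space M" "sets M = sets borel" "self_similar \<rho> N M"
    and M': "prob_space M'" "sets M' = sets borel" "self_similar \<rho> N M'"
  shows "M = M'"
proof (rule Levy_uniqueness)
  show rM: "real_distribution M" and rM': "real_distribution M'"
    using M M' sets_eq_imp_space_eq[OF M(2)] sets_eq_imp_space_eq[OF M'(2)]
    by (auto simp: real_distribution_def real_distribution_axioms_def)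
  define d where "d t = char M t - char M' t" for t
  have step: "norm (d t) \<le> norm (d (t * \<rho>))" for t
  proof -
    have "norm (\<Sum>j<N. iexp (t * \<rho> * real j)) \<le> (\<Sum>j<N. 1)"
      by (rule order_trans[OF norm_sum]) auto
    then have le: "norm ((\<Sum>j<N. iexp (t * \<rho> * real j)) / of_nat N) \<le> 1"
      using N by (simp add: norm_divide)
    have "d t = (\<Sum>j<N. iexp (t * \<rho> * real j)) / of_nat N * d (t * \<rho>)"
      unfolding d_def self_similar_char[OF \<rho>(1) N M, of t] self_similar_char[OF \<rho>(1) N M', of t]
      by (simp add: right_diff_distrib)
    then show ?thesis
      using mult_right_mono[OF le, of "norm (d (t * \<rho>))"] by (simp only: norm_mult mult_1_left norm_ge_zero)
  qed
  have "d t = 0" for t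
  proof -
    have le: "norm (d t) \<le> norm (d (t * \<rho> ^ n))" for n
      by (induction n) (use step order_trans in \<open>fastforce simp: mult_ac\<close>)+
    have "(\<lambda>n. t * \<rho> ^ n) \<longlonglongrightarrow> t * 0"
      using \<rho> by (intro tendsto_intros LIMSEQ_power_zero) auto
    moreover have "isCont d 0"
      unfolding d_def using rM rM'
      by (intro continuous_intros real_distribution.isCont_char)
    moreover have "d 0 = 0"
      using rM rM' by (simp add: d_def real_distribution.char_zero)
    ultimately have "(\<lambda>n. norm (d (t * \<rho> ^ n))) \<longlonglongrightarrow> 0"
      using isCont_tendsto_compose[of 0 d "\<lambda>n. t * \<rho> ^ n"] tendsto_norm_zero by fastforce
    then have "norm (d t) \<le> 0"
      using le by (intro LIMSEQ_le_const) auto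
    then show ?thesis by simp
  qed
  then show "char M = char M'"
    by (auto simp: d_def fun_eq_iff)
qed

lemma self_similar_exists:
  assumes \<rho>: "0 < \<rho>" "\<rho> < 1" and N: "1 < N"
  shows "\<exists>M. prob_space M \<and> sets M = sets borel \<and> self_similar \<rho> N M"
proof -
  define S where "S = stream_space (digits N)"
  \<comment> \<open>Reducing the digits modulo \<open>N\<close> makes the series converge on the whole sample space.\<close>
  define X where "X s = (\<Sum>n. \<rho> ^ Suc n * real ((s !! n) mod N))" for s :: "nat stream"
  have spaceS: "space S = UNIV"
    by (simp add: S_def space_stream_space)
  interpret S: prob_space S
    unfolding S_def by (rule prob_space.prob_space_stream_space[OF prob_space_measure_pmf])
  have [measurable]: "X \<in> borel_measurable S"
    unfolding X_def S_def by measurable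
  have summ: "summable (\<lambda>n. \<rho> ^ Suc n * real ((s !! n) mod N))" for s
  proof (rule summable_comparison_test')
    show "summable (\<lambda>n. \<rho> ^ Suc n * real N)"
      using \<rho> by (intro summable_mult2) simp
    show "norm (\<rho> ^ Suc n * real ((s !! n) mod N)) \<le> \<rho> ^ Suc n * real N" for n
      using \<rho> N by (simp add: abs_mult mult_left_mono less_imp_le)
  qed
  have X_Cons: "X (j ## s) = \<rho> * (X s + real j)" if "j < N" for j s
  proof -
    have "X (j ## s) = (\<Sum>n. \<rho> ^ Suc (Suc n) * real ((s !! n) mod N)) + \<rho> * real j"
      unfolding X_def using suminf_split_head[OF summ, of "j ## s"] that by simp
    also have "(\<Sum>n. \<rho> ^ Suc (Suc n) * real ((s !! n) mod N)) = \<rho> * X s"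
      unfolding X_def by (subst suminf_mult[OF summ, symmetric]) (simp add: mult_ac)
    finally show ?thesis by (simp add: algebra_simps)
  qed
  define M where "M = distr S borel X"
  have [simp]: "sets M = sets borel" "space M = UNIV" by (simp_all add: M_def)
  interpret M: prob_space M
    unfolding M_def by (rule S.prob_space_distr) simp
  have "measure M A = 1 / real N * (\<Sum>j<N. measure M {x. \<rho> * (x + real j) \<in> A})"
    if [measurable]: "A \<in> sets borel" for A
  proof -
    have *: "measure M B = measure S {s. X s \<in> B}" if "B \<in> sets borel" for B
      using that unfolding M_def by (simp add: measure_distr spaceS vimage_def)
    have meas: "{x. \<rho> * (x + real j) \<in> A} \<in> sets borel" for j
      by measurable
    have "{s. X s \<in> A} \<in> sets S"
      using measurable_sets[of X S borel A] by (simp add: spaceS vimage_def)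
    then have "emeasure S {s. X s \<in> A} = (\<integral>\<^sup>+j. emeasure S {s. X (j ## s) \<in> A} \<partial>digits N)"
      using prob_space.emeasure_stream_space[OF prob_space_measure_pmf, of "{s. X s \<in> A}" "pmf_of_set {..<N}"] spaceS
      unfolding S_def by simp
    also have "\<dots> = (\<Sum>j<N. emeasure S {s. X (j ## s) \<in> A}) / of_nat N"
      using N by (subst nn_integral_pmf_of_set) auto
    also have "(\<Sum>j<N. emeasure S {s. X (j ## s) \<in> A})
        = (\<Sum>j<N. ennreal (measure M {x. \<rho> * (x + real j) \<in> A}))"
      by (rule sum.cong) (auto simp: X_Cons S.emeasure_eq_measure *[OF meas])
    also have "\<dots> / of_nat N = ennreal (1 / real N * (\<Sum>j<N. measure M {x. \<rho> * (x + real j) \<in> A}))"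
      using N by (subst sum_ennreal) (auto simp: ennreal_of_nat_eq_real_of_nat divide_ennreal sum_nonneg)
    finally show ?thesis
      using * by (simp add: S.emeasure_eq_measure sum_nonneg)
  qed
  then have "self_similar \<rho> N M"
    unfolding self_similar_def digit_image_eq[OF \<rho>(1)] by blast
  then show ?thesis
    using M.prob_space_axioms by (intro exI[of _ M]) simp
qed

theorem self_similar_measure_ex1:
  assumes "0 < \<rho>" "\<rho> < 1" "1 < N"
  shows "\<exists>!M. prob_space M \<and> sets M = sets borel \<and> self_similar \<rho> N M"
  using self_similar_exists[OF assms] self_similar_unique[OF assms] by blast

corollary
  assumes "0 < \<rho>" "\<rho> < 1" "1 < N"
  shows prob_space_mu: "prob_space (mu \<rho> N)"
    and sets_mu: "sets (mu \<rho> N) = sets borel"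
    and self_similar_mu: "self_similar \<rho> N (mu \<rho> N)"
  using theI'[OF self_similar_measure_ex1[OF assms]] unfolding mu_def by blast+

end

theory Submission
  imports Defs "HOL-Library.Ramsey" "HOL-Number_Theory.Cong"
    "HOL-Computational_Algebra.Computational_Algebra"
begin

text \<open>
  The Fourier transform of \<open>\<mu>\<close> is the product of the factors \<open>mask N (\<rho>\<^sup>k x)\<close>, \<open>k \<ge> 1\<close>, so all
  differences of a spectrum \<open>\<Lambda>\<close> have the form \<open>\<theta>\<^sup>k a / N\<close> with \<open>\<theta> = 1 / \<rho>\<close>, \<open>k \<ge> 1\<close> and \<open>a\<close> an integer
  not divisible by \<open>N\<close>. No factor, not even \<open>mask r (A \<rho>\<^sup>k x)\<close> with \<open>A r\<close> dividing \<open>N\<close>, is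
  superfluous for the orthogonality of \<open>\<Lambda>\<close>, since otherwise Bessel's inequality for the remaining
  factors contradicts Parseval's identity.

  By Ramsey's theorem, an infinite part of \<open>\<Lambda>\<close> has all its differences of the form
  \<open>\<theta>\<^sup>k r\<^sup>c b / N\<close> for a fixed prime \<open>r\<close> not dividing \<open>b\<close>, which forces a power of \<open>\<theta>\<close> to be rational.
  The rest of the arithmetic rests on the fact that if two groups cover all differences, then one
  of them does: this yields that \<open>\<theta> = q / p\<close> is rational, that \<open>N p (s - t)\<close> is an integer for all \<open>s\<close>
  and \<open>t\<close> in \<open>\<Lambda>\<close>, and that \<open>N\<close> divides \<open>q\<close>. If \<open>p > 1\<close>, the transform of \<open>\<mu>\<close> decays like a
  power of the logarithm, and too little of Parseval's sum is captured by the frequencies in each shell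
  of a doubly exponential sequence of radii.

  Conversely, if \<open>\<rho> = 1 / q\<close> and \<open>N\<close> divides \<open>q\<close>, the finite sums of \<open>(- q)\<^sup>k (q / N) a\<close> with
  \<open>0 \<le> a < N\<close> form a spectrum: Parseval's identity holds for the finite products, and the tails
  of the transform are bounded below on the normalised frequencies, so it passes to the limit.
\<close>

section \<open>Powers of a real number as differences\<close>

text \<open>Orthogonality only restricts the differences of \<Lambda>; the essential factors supply
  differences of a prescribed kind, and the arithmetic plays the two against each other.

  Orthogonality alone cannot exclude \<open>p > 1\<close>: if \<open>N\<close> divides
  \<open>q\<close>, the finite sums of \<open>q ^ k * a / N\<close> with \<open>k \<ge> 1\<close>
  and \<open>0 \<le> a < N\<close> form an infinite orthogonal set for every \<open>p\<close> prime
  to \<open>q\<close>. That case needs completeness in a quantitative form. The radii grow doubly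
  exponentially because the decay is only a power of the logarithm: along radii \<open>b ^ i\<close>
  the captured fractions would be bounded by a power of \<open>1 / i\<close>, which need not be
  summable, whereas along \<open>exp (\<tau> ^ i)\<close> the bounds form a geometric
  series.\<close>

definition ipoly :: "int poly \<Rightarrow> 'a::{comm_ring_1,ring_char_0} \<Rightarrow> 'a" where
  "ipoly p x = poly (map_poly of_int p) x"

lemma ipoly_0 [simp]: "ipoly 0 x = 0"
  by (simp add: ipoly_def)

lemma ipoly_pCons [simp]: "ipoly (pCons a p) x = of_int a + x * ipoly p x"
  by (simp add: ipoly_def map_poly_pCons)

lemma ipoly_add [simp]: "ipoly (p + q) x = ipoly p x + ipoly q x"
proof -
  have "map_poly of_int (p + q) = (map_poly of_int p + map_poly of_int q :: 'a poly)"
    by (rule poly_eqI) (simp add: coeff_map_poly)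
  then show ?thesis by (simp add: ipoly_def)
qed

lemma ipoly_smult [simp]: "ipoly (smult c p) x = of_int c * ipoly p x"
  by (simp add: ipoly_def map_poly_smult)

lemma ipoly_uminus [simp]: "ipoly (- p) x = - ipoly p x"
  using ipoly_smult[of "-1" p x] by simp

lemma ipoly_diff [simp]: "ipoly (p - q) x = ipoly p x - ipoly q x"
  using ipoly_add[of p "-q" x] by simp

lemma ipoly_mult [simp]: "ipoly (p * q) x = ipoly p x * ipoly q x"
  by (induction p) (auto simp: mult_pCons_left algebra_simps)

lemma ipoly_monom [simp]: "ipoly (monom c n) x = of_int c * x ^ n"
  by (simp add: ipoly_def map_poly_monom poly_monom)

text \<open>A primitive polynomial of least degree works: pseudo-division leaves
  \<open>smult a g = m * q\<close>, and as \<open>m\<close> has content 1, Gauss's lemma makes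
  \<open>a\<close> divide the content of \<open>q\<close>, so that it cancels. Divisibility over the
  integers is what survives reduction modulo a prime.\<close>

lemma min_int_poly_exists:
  fixes x :: real
  assumes "f \<noteq> 0" "ipoly f x = 0"
  obtains m where "Polynomial.content m = 1" "ipoly m x = 0" "\<And>g. ipoly g x = 0 \<Longrightarrow> m dvd g"
proof -
  define P where "P g \<longleftrightarrow> g \<noteq> 0 \<and> ipoly g x = 0" for g
  define m0 where "m0 = (ARG_MIN degree g. P g)"
  have Pf: "P f" using assms by (simp add: P_def)
  have m0: "P m0" unfolding m0_def using Pf by (rule arg_min_natI)
  have least: "degree m0 \<le> degree g" if "P g" for g
    unfolding m0_def using that by (rule arg_min_nat_le)
  define m where "m = primitive_part m0"
  have m0m: "m0 = smult (Polynomial.content m0) m" by (simp add: m_def)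
  have c: "Polynomial.content m = 1" using m0 by (simp add: m_def P_def)
  have nz: "m \<noteq> 0" using c by auto
  have mx: "ipoly m x = 0"
  proof -
    have "of_int (Polynomial.content m0) * ipoly m x = 0"
      using m0 m0m unfolding P_def by (metis ipoly_smult)
    then show ?thesis using m0 by (auto simp: P_def)
  qed
  have "m dvd g" if g: "ipoly g x = 0" for g
  proof -
    obtain a q where a: "a \<noteq> 0" "smult a g = m * q + pseudo_mod g m"
      and d: "pseudo_mod g m = 0 \<or> degree (pseudo_mod g m) < degree m"
      using pseudo_mod[OF nz, of g] by auto
    have "ipoly (pseudo_mod g m) x = 0"
      using arg_cong[OF a(2), of "\<lambda>p. ipoly p x"] g mx by simp
    then have r0: "pseudo_mod g m = 0"
      using d least[of "pseudo_mod g m"] by (force simp: P_def m_def)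
    then have eq: "smult a g = m * q" using a by simp
    then have "normalize a * Polynomial.content g = Polynomial.content q"
      using c by (metis content_mult content_smult mult_1)
    then have "[:a:] dvd q"
      unfolding const_poly_dvd_iff_dvd_content by (metis dvd_triv_left normalize_dvd_iff)
    then obtain q' where "q = smult a q'" by (auto elim!: dvdE)
    then have "smult a g = smult a (m * q')" using eq by simp
    then have "smult a (g - m * q') = 0" by (simp add: smult_diff_right)
    then show ?thesis using a(1) by simp
  qed
  with c mx show ?thesis by (rule that)
qed

text \<open>Modulo \<open>r\<close> the product is a monomial, hence so is \<open>m\<close>.\<close>

lemma monomial_mod_prime_factor:
  fixes m w h :: "int poly"
  assumes r: "prime r" and l: "\<not> r dvd lead_coeff m" and c: "\<not> r dvd coeff m 0"
    and b: "\<not> r dvd b" and eq: "m * w = monom b k - smult r h"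
  shows "degree m = 0"
proof -
  have pr: "r dvd x * y \<longleftrightarrow> r dvd x \<or> r dvd y" for x y
    using r by (rule prime_dvd_mult_iff)
  have cf: "r dvd coeff (m * w) i \<longleftrightarrow> i \<noteq> k" for i
    using b unfolding eq by (auto simp: dvd_diff_right_iff dvd_diff_left_iff)
  define J where "J = {j. \<not> r dvd coeff w j}"
  have fin: "finite J"
    by (rule finite_subset[of _ "{..degree w}"]) (auto simp: J_def intro: le_degree)
  have "J \<noteq> {}"
  proof
    assume "J = {}"
    then have "r dvd coeff (m * w) k" unfolding coeff_mult J_def by (auto intro!: dvd_sum)
    then show False using cf by blast
  qed
  \<comment> \<open>The extreme exponents of \<open>w\<close> modulo \<open>r\<close>. Both end
    coefficients of \<open>m\<close> are units modulo \<open>r\<close>, so the product keeps its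
    terms of degree \<open>i0\<close> and \<open>degree m + i1\<close>, while only degree
    \<open>k\<close> is left.\<close>
  define i0 i1 where "i0 = Min J" and "i1 = Max J"
  have i: "i0 \<in> J" "i1 \<in> J" "i0 \<le> i1"
    using fin \<open>J \<noteq> {}\<close> by (auto simp: i0_def i1_def)
  have lo: "r dvd coeff w j" if "j < i0" for j
    using that Min_le[OF fin, of j] by (auto simp: J_def i0_def not_less[symmetric])
  have hi: "r dvd coeff w j" if "j > i1" for j
    using that Max_ge[OF fin, of j] by (auto simp: J_def i1_def not_less[symmetric])
  have "i0 = k"
  proof (rule ccontr)
    assume "i0 \<noteq> k"
    then have "r dvd (\<Sum>j\<le>i0. coeff m j * coeff w (i0 - j))"
      using cf by (simp add: coeff_mult)
    also have "(\<Sum>j\<le>i0. coeff m j * coeff w (i0 - j))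
        = coeff m 0 * coeff w i0 + (\<Sum>j\<in>{..i0} - {0}. coeff m j * coeff w (i0 - j))"
      by (subst sum.remove[of _ 0]) auto
    finally have "r dvd coeff m 0 * coeff w i0"
      by (subst (asm) dvd_add_left_iff) (auto intro!: dvd_sum dvd_mult lo)
    then show False using c i(1) by (auto simp: pr J_def)
  qed
  moreover have "degree m + i1 = k"
  proof (rule ccontr)
    let ?n = "degree m + i1"
    assume "?n \<noteq> k"
    then have "r dvd (\<Sum>j\<le>?n. coeff m j * coeff w (?n - j))"
      using cf by (simp add: coeff_mult)
    also have "(\<Sum>j\<le>?n. coeff m j * coeff w (?n - j))
        = lead_coeff m * coeff w i1 + (\<Sum>j\<in>{..?n} - {degree m}. coeff m j * coeff w (?n - j))"
      by (subst sum.remove[of _ "degree m"]) auto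
    finally have "r dvd lead_coeff m * coeff w i1"
    proof (subst (asm) dvd_add_left_iff)
      show "r dvd (\<Sum>j\<in>{..?n} - {degree m}. coeff m j * coeff w (?n - j))"
      proof (intro dvd_sum)
        fix j assume "j \<in> {..?n} - {degree m}"
        then consider "j < degree m" | "j > degree m" by force
        then show "r dvd coeff m j * coeff w (?n - j)"
          by cases (auto intro!: dvd_mult hi simp: coeff_eq_0)
      qed
    qed
    then show False using l i(2) by (auto simp: pr J_def)
  qed
  ultimately show ?thesis using i(3) by simp
qed

lemma finite_polys_bounded:
  assumes "finite A"
  shows "finite {p. (\<forall>i\<ge>D. coeff p i = 0) \<and> (\<forall>i. coeff p i \<in> A)}"
proof (rule finite_subset)
  show "finite (Poly ` {xs. set xs \<subseteq> A \<and> length xs = D})"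
    using finite_lists_length_eq[OF assms] by blast
  show "{p. (\<forall>i\<ge>D. coeff p i = 0) \<and> (\<forall>i. coeff p i \<in> A)} \<subseteq> Poly ` {xs. set xs \<subseteq> A \<and> length xs = D}"
  proof
    fix p assume p: "p \<in> {p. (\<forall>i\<ge>D. coeff p i = 0) \<and> (\<forall>i. coeff p i \<in> A)}"
    have "p = Poly (map (coeff p) [0..<D])"
      using p by (intro poly_eqI) (auto simp: coeff_Poly_eq nth_default_def)
    then show "p \<in> Poly ` {xs. set xs \<subseteq> A \<and> length xs = D}"
      using p by (intro image_eqI[of _ _ "map (coeff p) [0..<D]"]) auto
  qed
qed

text \<open>Pigeonhole principle: \<open>\<int>[\<theta>] / r\<close> is finite.\<close>

lemma congruent_values_exist:
  fixes \<theta> :: real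
  assumes r: "prime r" and l: "\<not> r dvd lead_coeff f" and f: "ipoly f \<theta> = 0"
    and X: "infinite X" "X \<subseteq> range (\<lambda>g. ipoly g \<theta>)"
  obtains x y h where "x \<in> X" "y \<in> X" "x \<noteq> y" "x - y = of_int r * ipoly h \<theta>"
proof -
  define D where "D = degree f"
  define S where "S = {p. (\<forall>i\<ge>D. coeff p i = 0) \<and> (\<forall>i. coeff p i \<in> {0..<r})}"
  have r0: "r > 0" using r by (simp add: prime_gt_0_int)
  obtain u where u: "[lead_coeff f * u = 1] (mod r)"
    using l r by (metis cong_solve_coprime_int coprime_commute prime_imp_coprime)
  have red: "\<exists>c\<in>S. \<exists>h. ipoly g \<theta> = ipoly c \<theta> + of_int r * ipoly h \<theta>" for g
  proof (induction g)
    case 0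
    have "0 \<in> S" using r0 by (simp add: S_def)
    then show ?case by (intro bexI[of _ 0] exI[of _ 0]) auto
  next
    case (pCons a g)
    then obtain c h where c: "c \<in> S" and h: "ipoly g \<theta> = ipoly c \<theta> + of_int r * ipoly h \<theta>" by blast
    \<comment> \<open>Multiples of \<open>f\<close> vanish at \<theta>. As \<open>u\<close> inverts
      the leading coefficient modulo \<open>r\<close>, subtracting this one makes the coefficient of
      degree \<open>D\<close> divisible by \<open>r\<close>; after that all coefficients are reduced
      modulo \<open>r\<close>.\<close>
    define c' where "c' = pCons a c - smult (coeff (pCons a c) D * u) f"
    define c'' where "c'' = map_poly (\<lambda>x. x mod r) c'"
    define h' where "h' = map_poly (\<lambda>x. x div r) c'"
    have split: "c' = c'' + smult r h'"
      by (rule poly_eqI) (simp add: c''_def h'_def coeff_map_poly)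
    have "coeff c'' i = 0" if "i \<ge> D" for i
    proof (cases "i = D")
      case True
      have "r dvd lead_coeff f * u - 1" using u by (simp add: cong_iff_dvd_diff)
      then have "r dvd coeff (pCons a c) D * (lead_coeff f * u - 1)" by (rule dvd_mult)
      then have "r dvd - coeff c' D"
        by (simp add: c'_def D_def algebra_simps)
      then show ?thesis using True by (simp add: c''_def coeff_map_poly)
    next
      case False
      then have i: "i > D" using that by simp
      then have "coeff (pCons a c) i = 0"
        using c by (cases i) (auto simp: S_def)
      then show ?thesis using i by (simp add: c''_def coeff_map_poly c'_def coeff_eq_0 D_def)
    qed
    then have "c'' \<in> S" using r0 by (auto simp: S_def c''_def coeff_map_poly)
    moreover have "ipoly (pCons a g) \<theta> = ipoly c'' \<theta> + of_int r * ipoly (h' + pCons 0 h) \<theta>"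
    proof -
      have "ipoly (pCons a c) \<theta> = ipoly c' \<theta>" by (simp add: c'_def f)
      also have "\<dots> = ipoly c'' \<theta> + of_int r * ipoly h' \<theta>" by (subst split) simp
      finally show ?thesis by (simp add: h algebra_simps)
    qed
    ultimately show ?case by blast
  qed
  have "\<forall>x\<in>X. \<exists>c\<in>S. \<exists>h. x = ipoly c \<theta> + of_int r * ipoly h \<theta>"
    using X(2) red by blast
  then obtain c where c: "\<And>x. x \<in> X \<Longrightarrow> c x \<in> S"
    and ch: "\<And>x. x \<in> X \<Longrightarrow> \<exists>h. x = ipoly (c x) \<theta> + of_int r * ipoly h \<theta>"
    by metis
  have "finite S" unfolding S_def by (rule finite_polys_bounded) simp
  then have "\<not> inj_on c X"
    using X(1) c by (metis finite_imageD finite_subset image_subsetI)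
  then obtain x y where xy: "x \<in> X" "y \<in> X" "x \<noteq> y" "c x = c y" by (auto simp: inj_on_def)
  obtain h h' where "x = ipoly (c x) \<theta> + of_int r * ipoly h \<theta>" "y = ipoly (c x) \<theta> + of_int r * ipoly h' \<theta>"
    using ch[OF xy(1)] ch[OF xy(2)] xy(4) by metis
  then have "x - y = of_int r * ipoly (h - h') \<theta>" by (simp add: algebra_simps)
  then show ?thesis using xy that by blast
qed

lemma power_quotient_Rats:
  fixes \<theta> :: real
  assumes "\<theta> \<noteq> 0" "\<theta> ^ k * of_int a = \<theta> ^ l * of_int b" "b \<noteq> 0" "k \<noteq> l"
  shows "\<exists>s\<ge>1. \<theta> ^ s \<in> \<rat>"
proof (cases "k < l")
  case True
  then have "\<theta> ^ l = \<theta> ^ k * \<theta> ^ (l - k)" by (simp flip: power_add)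
  then have "\<theta> ^ (l - k) = of_int a / of_int b" using assms by (simp add: field_simps)
  then show ?thesis using True by (intro exI[of _ "l - k"]) auto
next
  case False
  then have "l < k" using assms by simp
  then have "\<theta> ^ k = \<theta> ^ l * \<theta> ^ (k - l)" by (simp flip: power_add)
  then have e: "\<theta> ^ (k - l) * of_int a = of_int b" using assms by simp
  then have "a \<noteq> 0" using assms by auto
  then have "\<theta> ^ (k - l) = of_int b / of_int a" using e by (simp add: field_simps)
  then show ?thesis using \<open>l < k\<close> by (intro exI[of _ "k - l"]) auto
qed

text \<open>Dividing by the lowest power turns the outer coefficients into the constant and the
  leading one. That both are prime to \<open>r\<close> is inherited by every divisor of
  \<open>f\<close>, in particular by the minimal polynomial.\<close>

lemma trinomial_ends:
  fixes \<theta> :: real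
  assumes "\<theta> \<noteq> 0" "of_int a * \<theta> ^ i + of_int b * \<theta> ^ j + of_int c * \<theta> ^ k = 0"
    and ij: "i < j" and jk: "j < k" and "\<not> r dvd a" "\<not> r dvd (c::int)"
  shows "\<exists>f. f \<noteq> 0 \<and> ipoly f \<theta> = 0 \<and> \<not> r dvd coeff f 0 \<and> \<not> r dvd lead_coeff f"
proof -
  define f where "f = monom a 0 + monom b (j - i) + monom c (k - i)"
  have "\<theta> ^ i * ipoly f \<theta> = 0"
    using assms(2) ij jk by (simp add: f_def algebra_simps flip: power_add)
  then have 0: "ipoly f \<theta> = 0" using assms(1) by simp
  have c0: "c \<noteq> 0" using assms by auto
  have "degree f = k - i"
    unfolding f_def
  proof (subst degree_add_eq_right)
    show "degree (monom a 0 + monom b (j - i)) < degree (monom c (k - i))"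
      using ij jk c0 by (intro le_less_trans[OF degree_add_le[of _ "j - i"]] )
        (auto simp: degree_monom_eq degree_monom_le order_trans[OF degree_monom_le])
  qed (use c0 in \<open>simp add: degree_monom_eq\<close>)
  then have "lead_coeff f = c" "coeff f 0 = a"
    using ij jk by (auto simp: f_def)
  then show ?thesis using 0 assms c0 by (intro exI[of _ f]) force
qed

text \<open>If no positive power of \<open>\<theta>\<close> is rational, then three suitable points of \<open>X\<close> yield a trinomial
  relation for \<open>\<theta>\<close> whose end coefficients are prime to \<open>r\<close>, so \<open>\<theta>\<close> is a unit modulo \<open>r\<close>. But two
  points of \<open>X\<close> are congruent modulo \<open>r \<int>[\<theta>]\<close>.\<close>

lemma power_diff_set_rational_power:
  fixes \<theta> :: real and r :: int
  assumes \<theta>: "\<theta> > 0" and r: "prime r" and inf: "infinite X"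
    and diff: "\<And>x y. x \<in> X \<Longrightarrow> y \<in> X \<Longrightarrow> x \<noteq> y \<Longrightarrow> \<exists>k b. x - y = \<theta> ^ k * of_int b \<and> \<not> r dvd b"
  shows "\<exists>s\<ge>1. \<theta> ^ s \<in> \<rat>"
proof (rule ccontr)
  assume irr: "\<not> ?thesis"
  have r0: "r > 0" using r by (simp add: prime_gt_0_int)
  have nz: "b \<noteq> 0" if "\<not> r dvd b" for b using that by auto
  have uniq: "k = l" if "\<theta> ^ k * of_int a = \<theta> ^ l * of_int b" "b \<noteq> 0" for a b k l
    using irr that power_quotient_Rats[of \<theta> k a l b] \<theta> by auto
  obtain x0 where x0: "x0 \<in> X" using inf by fastforce
  have "\<forall>x\<in>X - {x0}. \<exists>k b. x - x0 = \<theta> ^ k * of_int b \<and> \<not> r dvd b"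
    using diff x0 by auto
  then obtain k b where kb: "\<And>x. x \<in> X - {x0} \<Longrightarrow> x - x0 = \<theta> ^ k x * of_int (b x) \<and> \<not> r dvd b x"
    by metis
  have inf': "infinite (X - {x0})" using inf by simp
  \<comment> \<open>If all exponents agreed, two points would have coefficients congruent modulo
    \<open>r\<close>. The exponent of their difference is unique, as no positive power of \<theta>
    is rational, so its coefficient would be divisible by \<open>r\<close>.\<close>
  have "\<exists>x\<in>X - {x0}. \<exists>y\<in>X - {x0}. k x \<noteq> k y"
  proof (rule ccontr)
    assume same: "\<not> ?thesis"
    have "finite ((\<lambda>x. b x mod r) ` (X - {x0}))"
      by (rule finite_subset[of _ "{0..<r}"]) (use r0 in auto)
    then have "\<not> inj_on (\<lambda>x. b x mod r) (X - {x0})"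
      using inf' finite_imageD by blast
    then obtain x y where xy: "x \<in> X - {x0}" "y \<in> X - {x0}" "x \<noteq> y" "b x mod r = b y mod r"
      by (auto simp: inj_on_def)
    obtain l c where lc: "x - y = \<theta> ^ l * of_int c" "\<not> r dvd c" using diff xy by blast
    have "k x = k y" using same xy by blast
    moreover have "x - y = (x - x0) - (y - x0)" by simp
    ultimately have "x - y = \<theta> ^ k x * of_int (b x - b y)"
      using kb[OF xy(1)] kb[OF xy(2)] by (simp only: of_int_diff right_diff_distrib)
    then have eq: "\<theta> ^ k x * of_int (b x - b y) = \<theta> ^ l * of_int c" using lc(1) by simp
    then have "k x = l" using nz[OF lc(2)] by (rule uniq)
    then have "real_of_int (b x - b y) = of_int c" using eq \<theta> by simp
    then have "b x - b y = c" by (simp only: of_int_eq_iff)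
    then show False using lc(2) xy(4) by (metis mod_eq_dvd_iff)
  qed
  then obtain x y where xy: "x \<in> X - {x0}" "y \<in> X - {x0}" "k x \<noteq> k y" by blast
  then obtain l c where lc: "x - y = \<theta> ^ l * of_int c" "\<not> r dvd c" using diff by blast
  have rel: "of_int (b x) * \<theta> ^ k x + of_int (- b y) * \<theta> ^ k y + of_int (- c) * \<theta> ^ l = 0"
  proof -
    have "(x - x0) - (y - x0) - (x - y) = 0" by simp
    then show ?thesis
      using kb[OF xy(1)] kb[OF xy(2)] lc(1) by (simp add: mult.commute)
  qed
  have cn: "\<not> r dvd b x" "\<not> r dvd - b y" "\<not> r dvd - c"
    using kb[OF xy(1)] kb[OF xy(2)] lc by auto
  have lx: "l \<noteq> k x"
  proof
    assume "l = k x"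
    then have "\<theta> ^ k x * of_int (b x - c) = \<theta> ^ k y * of_int (b y)"
      using rel by (simp add: algebra_simps)
    then show False using uniq nz[of "b y"] cn(2) xy(3) by (metis dvd_minus_iff)
  qed
  have ly: "l \<noteq> k y"
  proof
    assume "l = k y"
    then have "\<theta> ^ k y * of_int (b y + c) = \<theta> ^ k x * of_int (b x)"
      using rel by (simp add: algebra_simps)
    then show False using uniq nz[of "b x"] cn(1) xy(3) by metis
  qed
  obtain f where f: "f \<noteq> 0" "ipoly f \<theta> = 0" "\<not> r dvd coeff f 0" "\<not> r dvd lead_coeff f"
  proof -
    have \<theta>0: "\<theta> \<noteq> 0" using \<theta> by simp
    note tri = trinomial_ends[OF \<theta>0]
    let ?E = "\<exists>f. f \<noteq> 0 \<and> ipoly f \<theta> = 0 \<and> \<not> r dvd coeff f 0 \<and> \<not> r dvd lead_coeff f"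
    from lx ly have "(k x < k y \<and> k y < l) \<or> (k x < l \<and> l < k y) \<or> (k y < k x \<and> k x < l)
      \<or> (k y < l \<and> l < k x) \<or> (l < k x \<and> k x < k y) \<or> (l < k y \<and> k y < k x)"
      using xy(3) by linarith
    then have ?E
      using tri[of "b x" "k x" "- b y" "k y" "- c" l r] tri[of "b x" "k x" "- c" l "- b y" "k y" r]
        tri[of "- b y" "k y" "b x" "k x" "- c" l r] tri[of "- b y" "k y" "- c" l "b x" "k x" r]
        tri[of "- c" l "b x" "k x" "- b y" "k y" r] tri[of "- c" l "- b y" "k y" "b x" "k x" r] rel cn
      by (elim disjE conjE) (simp_all only: add.commute add.left_commute not_False_eq_True)
    then show thesis using that by blast
  qed
  obtain m where m: "Polynomial.content m = 1" "ipoly m \<theta> = 0" "\<And>g. ipoly g \<theta> = 0 \<Longrightarrow> m dvd g"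
    using min_int_poly_exists[OF f(1,2)] by blast
  obtain w where w: "f = m * w" using m(3)[OF f(2)] by (elim dvdE)
  have ml: "\<not> r dvd lead_coeff m" and mc: "\<not> r dvd coeff m 0"
    using f(3,4) by (auto simp: w lead_coeff_mult coeff_mult_0)
  have "infinite ((\<lambda>x. x - x0) ` (X - {x0}))"
    using inf' by (subst finite_image_iff) (auto simp: inj_on_def)
  moreover have "(\<lambda>x. x - x0) ` (X - {x0}) \<subseteq> range (\<lambda>g. ipoly g \<theta>)"
  proof
    fix z assume "z \<in> (\<lambda>x. x - x0) ` (X - {x0})"
    then obtain x where "x \<in> X - {x0}" "z = x - x0" by blast
    then have "z = ipoly (monom (b x) (k x)) \<theta>" using kb by simp
    then show "z \<in> range (\<lambda>g. ipoly g \<theta>)" by blast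
  qed
  ultimately obtain z z' h where z: "z \<in> (\<lambda>x. x - x0) ` (X - {x0})" "z' \<in> (\<lambda>x. x - x0) ` (X - {x0})"
      "z \<noteq> z'" and h: "z - z' = of_int r * ipoly h \<theta>"
    using congruent_values_exist[OF r f(4) f(2), of "(\<lambda>x. x - x0) ` (X - {x0})"] by blast
  obtain x y where "z = x - x0" "z' = y - x0" "x \<in> X" "y \<in> X" using z(1,2) by blast
  then obtain k b where "z - z' = \<theta> ^ k * of_int b" and b: "\<not> r dvd b"
    using diff[of x y] z(3) by auto
  \<comment> \<open>Modulo \<open>r\<close> this relation is a monomial, so the minimal polynomial
    is constant, although it is primitive and vanishes at \<theta>.\<close>
  then have "ipoly (monom b k - smult r h) \<theta> = 0" using h by simp
  then obtain w' where "m * w' = monom b k - smult r h" using m(3) by (metis dvdE)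
  then have "degree m = 0" using monomial_mod_prime_factor[OF r ml mc b] by blast
  then obtain c where "m = [:c:]" by (auto elim: degree_eq_zeroE)
  then show False using m(1,2) by simp
qed

text \<open>All complex conjugates of \<open>\<theta>\<close> have modulus \<open>\<theta>\<close>, so \<open>\<theta>\<close> raised to the degree of its minimal
  polynomial is rational.\<close>

lemma degree_ge_of_minimal_rational_power:
  fixes \<theta> :: real
  assumes \<theta>: "\<theta> > 0" and s: "\<theta> ^ s \<in> \<rat>" "s \<ge> 1" and min: "\<And>t. 1 \<le> t \<Longrightarrow> t < s \<Longrightarrow> \<theta> ^ t \<notin> \<rat>"
    and f: "f \<noteq> 0" "ipoly f \<theta> = 0"
  shows "s \<le> degree f"
proof -
  obtain m where m: "Polynomial.content m = 1" "ipoly m \<theta> = 0" "\<And>g. ipoly g \<theta> = 0 \<Longrightarrow> m dvd g"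
    using min_int_poly_exists[OF f] by blast
  have "m \<noteq> 0" using m by auto
  obtain u v :: int where uv: "v \<noteq> 0" "\<theta> ^ s = of_int u / of_int v"
    by (rule Rats_cases'[OF s(1)]) (rule that, auto)
  have "ipoly (monom v s - [:u:]) \<theta> = 0" using uv by simp
  then obtain w where w: "monom v s - [:u:] = m * w" using m(3) by (metis dvdE)
  define p where "p = (map_poly of_int m :: complex poly)"
  have "p \<noteq> 0" using \<open>m \<noteq> 0\<close> by (simp add: p_def map_poly_eq_0_iff)
  have lead: "lead_coeff p = of_int (lead_coeff m)" and deg: "degree p = degree m"
    by (simp_all add: p_def degree_map_poly coeff_map_poly)
  obtain A where A: "size A = degree p" "p = smult (lead_coeff p) (\<Prod>x\<in>#A. [:-x, 1:])"
    using alg_closed_imp_factorization[OF \<open>p \<noteq> 0\<close>] by blast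
  have root: "cmod z = \<theta>" if "z \<in># A" for z
  proof -
    have "poly p z = 0"
      using that by (subst A(2)) (auto simp: poly_prod_mset)
    then have "ipoly (monom v s - [:u:]) z = 0"
      unfolding w by (simp add: p_def ipoly_def[symmetric])
    then have "of_int v * z ^ s = of_int u" by simp
    then have "z ^ s = of_int u / of_int v" using uv(1) by (simp add: field_simps)
    also have "\<dots> = of_real (\<theta> ^ s)" by (simp add: uv(2))
    finally have "z ^ s = of_real (\<theta> ^ s)" .
    then have "cmod (z ^ s) = cmod (of_real (\<theta> ^ s))" by (rule arg_cong)
    then have "cmod z ^ s = \<theta> ^ s" using \<theta> by (simp add: norm_power del: of_real_power)
    then show ?thesis by (rule power_eq_imp_eq_base) (use \<theta> s(2) in auto)
  qed
  have norm_mset: "cmod (\<Prod>x\<in>#B. x) = (\<Prod>x\<in>#B. cmod x)" for B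
    by (induction B) (simp_all add: norm_mult)
  have "cmod (poly p 0) = cmod (lead_coeff p) * (\<Prod>x\<in>#A. cmod x)"
    by (subst A(2), simp only: poly_smult norm_mult poly_prod_mset)
      (use norm_mset[of "image_mset uminus A"] in \<open>simp add: image_mset.compositionality o_def\<close>)
  also have "(\<Prod>x\<in>#A. cmod x) = (\<Prod>x\<in>#A. \<theta>)"
    using root by (intro arg_cong[of _ _ prod_mset] image_mset_cong) auto
  also have "\<dots> = \<theta> ^ degree m" using A(1) deg by simp
  finally have "\<bar>of_int (coeff m 0)\<bar> = \<bar>of_int (lead_coeff m)\<bar> * \<theta> ^ degree m"
    using lead deg by (simp add: poly_0_coeff_0 p_def coeff_map_poly)
  then have "\<theta> ^ degree m = of_int \<bar>coeff m 0\<bar> / of_int \<bar>lead_coeff m\<bar>"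
    using \<open>m \<noteq> 0\<close> by (simp add: field_simps)
  then have "\<theta> ^ degree m \<in> \<rat>" by simp
  moreover have "degree m \<ge> 1"
  proof (rule ccontr)
    assume "\<not> ?thesis"
    then have "degree m = 0" by simp
    then obtain c where "m = [:c:]" by (rule degree_eq_zeroE)
    then show False using m(1,2) by simp
  qed
  ultimately have "s \<le> degree m" using min by (metis not_less)
  then show ?thesis using dvd_imp_degree_le[OF m(3)[OF f(2)] f(1)] by simp
qed

section \<open>Fourier transforms and spectra\<close>

text \<open>The Fourier transform of the uniform distribution on \<open>{..<n}\<close>, so
  \<open>mask N\<close> is the factor that one digit contributes to the transform of \<mu>.\<close>

definition mask :: "nat \<Rightarrow> real \<Rightarrow> complex" where
  "mask n y = (\<Sum>j<n. cis (2 * pi * real j * y)) / of_nat n"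

lemma cis_2pi_eq_1_iff: "cis (2 * pi * y) = 1 \<longleftrightarrow> y \<in> \<int>"
proof
  assume "cis (2 * pi * y) = 1"
  then have "cos (2 * pi * y) = 1" by (simp add: complex_eq_iff)
  then obtain n :: int where "2 * pi * y = of_int n * 2 * pi" by (auto simp: cos_one_2pi_int)
  then have "y = of_int n" by simp
  then show "y \<in> \<int>" by simp
next
  assume "y \<in> \<int>"
  then show "cis (2 * pi * y) = 1" by (auto elim!: Ints_cases)
qed

lemma mask_of_int [simp]: "n > 0 \<Longrightarrow> mask n (of_int k) = 1"
proof -
  assume n: "n > 0"
  have "cis (2 * pi * real j * of_int k) = 1" for j
    using cis_2pi_eq_1_iff[of "real j * of_int k"] by (simp add: mult.assoc)
  then show ?thesis using n by (simp add: mask_def)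
qed

lemma mask_0 [simp]: "n > 0 \<Longrightarrow> mask n 0 = 1"
  using mask_of_int[of n 0] by simp

lemma mask_add_int: "mask n (y + of_int k) = mask n y"
proof -
  have "cis (2 * pi * real j * (y + of_int k)) = cis (2 * pi * real j * y)" for j
  proof -
    have "cis (2 * pi * (real j * of_int k)) = 1" by (simp add: cis_2pi_eq_1_iff)
    then show ?thesis by (simp add: distrib_left mult.assoc flip: cis_mult)
  qed
  then show ?thesis by (simp add: mask_def)
qed

lemma mask_geometric:
  "(cis (2 * pi * y) - 1) * (\<Sum>j<n. cis (2 * pi * real j * y)) = cis (2 * pi * (real n * y)) - 1"
proof -
  have "cis (2 * pi * real j * y) = cis (2 * pi * y) ^ j" for j
    unfolding Complex.DeMoivre by (rule arg_cong[of _ _ cis]) simp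
  moreover have "cis (2 * pi * (real n * y)) = cis (2 * pi * y) ^ n"
    unfolding Complex.DeMoivre by (rule arg_cong[of _ _ cis]) simp
  ultimately show ?thesis by (simp add: power_diff_1_eq)
qed

text \<open>The geometric sum closes up when \<open>n * y\<close> is an integer; the integers
  \<open>y\<close>, where all terms equal 1, are removed by the condition on
  \<open>a\<close>.\<close>

lemma mask_eq_0_iff:
  assumes "n > 0"
  shows "mask n y = 0 \<longleftrightarrow> (\<exists>a::int. real n * y = of_int a \<and> \<not> int n dvd a)"
proof (cases "y \<in> \<int>")
  case True
  then obtain k where k: "y = of_int k" by (auto elim: Ints_cases)
  have "int n dvd a" if "real n * y = of_int a" for a
  proof -
    have "of_int (int n * k) = (of_int a :: real)" using that k by simp
    then show ?thesis by (metis dvd_triv_left of_int_eq_iff)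
  qed
  then show ?thesis using assms by (auto simp: k)
next
  case False
  then have "cis (2 * pi * y) - 1 \<noteq> 0" using cis_2pi_eq_1_iff by auto
  then have "mask n y = 0 \<longleftrightarrow> real n * y \<in> \<int>"
    using mask_geometric[of y n] assms
    by (auto simp: mask_def cis_2pi_eq_1_iff[of "real n * y", symmetric])
  also have "\<dots> \<longleftrightarrow> (\<exists>a::int. real n * y = of_int a \<and> \<not> int n dvd a)"
  proof
    assume "real n * y \<in> \<int>"
    then obtain a where a: "real n * y = of_int a" by (auto elim: Ints_cases)
    have "\<not> int n dvd a"
    proof
      assume "int n dvd a"
      then obtain k where "a = int n * k" by blast
      then have "y = of_int k" using a assms by simp
      then show False using False by simp
    qed
    with a show "\<exists>a::int. real n * y = of_int a \<and> \<not> int n dvd a" by blast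
  qed auto
  finally show ?thesis .
qed

text \<open>Each digit below \<open>a * b\<close> is uniquely \<open>j + i * a\<close>. For
  composite \<open>N\<close> this gives finer factors than \<open>mask N\<close>, so that the primes
  of \<open>N\<close> can be treated one at a time.\<close>

lemma mask_mult:
  assumes "a > 0" "b > 0"
  shows "mask (a * b) y = mask a y * mask b (real a * y)"
proof -
  let ?f = "\<lambda>j. cis (2 * pi * real j * y)"
  have sh: "sum ?f {i * a..<i * a + a} = (\<Sum>j<a. ?f (j + i * a))" for i
    using sum.shift_bounds_nat_ivl[of ?f 0 "i * a" a] by (simp add: atLeast0LessThan add.commute)
  have fm: "?f (j + i * a) = ?f j * cis (2 * pi * real i * (real a * y))" for i j
    by (simp add: cis_mult algebra_simps)
  have "sum ?f {..<a * b} = (\<Sum>i<b. \<Sum>j<a. ?f (j + i * a))"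
    using sum.nat_group[of ?f a b] by (simp only: sh mult.commute[of a b])
  also have "\<dots> = (\<Sum>j<a. ?f j) * (\<Sum>i<b. cis (2 * pi * real i * (real a * y)))"
    unfolding fm by (subst sum.swap) (simp only: sum_product)
  finally show ?thesis by (simp add: mask_def)
qed

lemma norm_mask_le_1: "norm (mask n y) \<le> 1"
proof -
  have "norm (\<Sum>j<n. cis (2 * pi * real j * y)) \<le> (\<Sum>j<n. 1)"
    by (rule order_trans[OF norm_sum]) auto
  then show ?thesis by (cases "n = 0") (simp_all add: mask_def norm_divide)
qed

text \<open>Only the digits 0 and 1 are combined, \<open>1 + cis (2 * pi * y)\<close> having modulus
  \<open>2 * \<bar>cos (pi * y)\<bar>\<close>; the other terms count 1 each. This crude bound is
  below 1 off the integers, which suffices for the decay.\<close>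

lemma norm_mask_le:
  assumes "n \<ge> 2"
  shows "norm (mask n y) \<le> (real n - 2 + 2 * \<bar>cos (pi * y)\<bar>) / real n"
proof -
  have "(\<Sum>j<n. cis (2 * pi * real j * y))
      = (1 + cis (2 * pi * y)) + (\<Sum>j\<in>{2..<n}. cis (2 * pi * real j * y))"
  proof -
    have "{..<n} = {0, 1} \<union> {2..<n}" using assms by auto
    then show ?thesis by (simp add: sum.union_disjoint add.assoc)
  qed
  also have "norm \<dots> \<le> norm (1 + cis (2 * pi * y)) + norm (\<Sum>j\<in>{2..<n}. cis (2 * pi * real j * y))"
    by (rule norm_triangle_ineq)
  also have "norm (\<Sum>j\<in>{2..<n}. cis (2 * pi * real j * y)) \<le> (\<Sum>j\<in>{2..<n}. 1)"
    by (rule order_trans[OF norm_sum]) auto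
  also have "1 + cis (2 * pi * y) = cis (pi * y) * of_real (2 * cos (pi * y))"
  proof -
    have "complex_of_real (2 * cos (pi * y)) = cis (pi * y) + cis (- (pi * y))"
      by (rule complex_eqI) simp_all
    then show ?thesis by (simp add: distrib_left cis_mult mult.assoc)
  qed
  finally have "norm (\<Sum>j<n. cis (2 * pi * real j * y)) \<le> 2 * \<bar>cos (pi * y)\<bar> + (real n - 2)"
    using assms by (simp add: norm_mult of_nat_diff)
  then show ?thesis using assms by (simp add: mask_def norm_divide divide_right_mono)
qed

text \<open>Parseval's identity on the cyclic group of order \<open>n\<close>: in the expanded
  squares, summation over the shifts leaves the diagonal. The sign \<open>e\<close> serves the
  alternating weights of the frequencies constructed at the end.\<close>

lemma sum_norm_mask_sq:
  assumes n: "n > 0" and e: "e = 1 \<or> e = (-1::real)"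
  shows "(\<Sum>a<n. (norm (mask n (y + e * real a / real n)))\<^sup>2) = 1"
proof -
  have orth: "(\<Sum>a<n. cis (2 * pi * (real i - real j) * (e * real a / real n))) = (if i = j then of_nat n else 0)"
    if "i < n" "j < n" for i j
  proof (cases "i = j")
    case False
    define d where "d = (if e = 1 then int i - int j else int j - int i)"
    have de: "of_int d = e * (real i - real j)" using e by (auto simp: d_def)
    have "d \<noteq> 0" "\<bar>d\<bar> < int n" using False that by (auto simp: d_def)
    then have "\<not> int n dvd d" using dvd_imp_le_int[of d "int n"] by auto
    then have "mask n (of_int d / real n) = 0"
      using n by (subst mask_eq_0_iff) auto
    then show ?thesis using n False by (simp add: mask_def de mult_ac)
  qed auto
  have "complex_of_real ((norm (mask n (y + e * real a / real n)))\<^sup>2)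
      = (\<Sum>i<n. \<Sum>j<n. cis (2 * pi * (real i - real j) * y)
          * cis (2 * pi * (real i - real j) * (e * real a / real n))) / (of_nat n)\<^sup>2" for a
    unfolding complex_norm_square mask_def
    by (simp add: sum_product cis_cnj cis_mult power2_eq_square algebra_simps)
  then have "complex_of_real (\<Sum>a<n. (norm (mask n (y + e * real a / real n)))\<^sup>2)
      = (\<Sum>a<n. \<Sum>i<n. \<Sum>j<n. cis (2 * pi * (real i - real j) * y)
          * cis (2 * pi * (real i - real j) * (e * real a / real n))) / (of_nat n)\<^sup>2"
    by (simp add: sum_divide_distrib)
  also have "(\<Sum>a<n. \<Sum>i<n. \<Sum>j<n. cis (2 * pi * (real i - real j) * y)
          * cis (2 * pi * (real i - real j) * (e * real a / real n)))
      = (\<Sum>i<n. \<Sum>j<n. cis (2 * pi * (real i - real j) * y)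
          * (\<Sum>a<n. cis (2 * pi * (real i - real j) * (e * real a / real n))))"
    by (subst sum.swap, rule sum.cong[OF refl], subst sum.swap) (simp only: sum_distrib_left)
  also have "\<dots> = (\<Sum>i<n. \<Sum>j<n. if i = j then of_nat n else 0)"
  proof (intro sum.cong refl)
    fix i j assume "i \<in> {..<n}" "j \<in> {..<n}"
    then show "cis (2 * pi * (real i - real j) * y)
          * (\<Sum>a<n. cis (2 * pi * (real i - real j) * (e * real a / real n))) = (if i = j then of_nat n else 0)"
      by (subst orth) auto
  qed
  also have "\<dots> = (of_nat n)\<^sup>2" by (simp add: power2_eq_square)
  finally have "complex_of_real (\<Sum>a<n. (norm (mask n (y + e * real a / real n)))\<^sup>2) = 1"
    using n by simp
  then show ?thesis by (simp only: of_real_eq_1_iff)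
qed

text \<open>The sign in the exponent is opposite to that in \<open>is_spectrum\<close>, which is why
  sets of frequencies are negated in the proofs about spectra.\<close>

definition ft :: "real measure \<Rightarrow> real \<Rightarrow> complex" where
  "ft M x = char M (2 * pi * x)"

lemma real_distributionI:
  assumes "prob_space M" "sets M = sets borel"
  shows "real_distribution M"
  using assms sets_eq_imp_space_eq[OF assms(2)]
  by (simp add: real_distribution_def real_distribution_axioms_def)

lemma measurable_cis [measurable (raw)]:
  "f \<in> borel_measurable M \<Longrightarrow> (\<lambda>x. cis (f x)) \<in> borel_measurable M"
  unfolding cis_conv_exp by measurable

context real_distribution
begin

lemma integrable_cis [simp, intro]: "integrable M (\<lambda>t. cis (a * t))"
  by (intro integrable_const_bound[of _ 1]) auto

lemma ft_eq: "ft M x = (\<integral>t. cis (2 * pi * x * t) \<partial>M)"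
  by (simp add: ft_def char_def cis_conv_exp)

lemma ft_0 [simp]: "ft M 0 = 1"
  by (simp add: ft_def char_zero)

lemma norm_ft_le_1: "norm (ft M x) \<le> 1"
  by (simp add: ft_def cmod_char_le_1)

lemma ft_minus: "ft M (- x) = cnj (ft M x)"
proof -
  have "cis (2 * pi * (- x) * t) = cnj (cis (2 * pi * x * t))" for t by (simp add: cis_cnj)
  then show ?thesis unfolding ft_eq by (simp only: Bochner_Integration.integral_cnj)
qed

lemma isCont_ft: "isCont (ft M) x"
  unfolding ft_def[abs_def] by (rule continuous_within_compose3[OF isCont_char]) (intro continuous_intros)

text \<open>Completing the square: the best coefficients are \<open>ft M (x - s)\<close>. The one
  identity yields Bessel's inequality, the lower bound behind Parseval's identity, and the
  approximation of exponentials in the converse direction.\<close>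

lemma integral_norm_diff_sq:
  assumes S: "finite S" and orth: "\<And>s t. s \<in> S \<Longrightarrow> t \<in> S \<Longrightarrow> s \<noteq> t \<Longrightarrow> ft M (s - t) = 0"
  shows "(\<integral>t. (norm (cis (2 * pi * x * t) - (\<Sum>s\<in>S. c s * cis (2 * pi * s * t))))\<^sup>2 \<partial>M)
    = 1 - (\<Sum>s\<in>S. (norm (ft M (x - s)))\<^sup>2) + (\<Sum>s\<in>S. (norm (c s - ft M (x - s)))\<^sup>2)"
proof -
  let ?g = "\<lambda>t. cis (2 * pi * x * t) - (\<Sum>s\<in>S. c s * cis (2 * pi * s * t))"
  have prod: "(norm (?g t))\<^sup>2 = (1
      - (\<Sum>s\<in>S. cnj (c s) * cis (2 * pi * (x - s) * t))
      - (\<Sum>s\<in>S. c s * cis (2 * pi * (s - x) * t))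
      + (\<Sum>s\<in>S. \<Sum>u\<in>S. c s * cnj (c u) * cis (2 * pi * (s - u) * t)))" (is "_ = ?h t") for t
  proof -
    have cc: "cis (2 * pi * a * t) * cnj (cis (2 * pi * b * t)) = cis (2 * pi * (a - b) * t)" for a b
      by (simp add: cis_cnj cis_mult algebra_simps)
    let ?A = "cis (2 * pi * x * t)" and ?B = "\<Sum>s\<in>S. c s * cis (2 * pi * s * t)"
    have cB: "cnj ?B = (\<Sum>s\<in>S. cnj (c s) * cnj (cis (2 * pi * s * t)))" by simp
    have "complex_of_real ((norm (?g t))\<^sup>2) = ?g t * cnj (?g t)" by (rule complex_norm_square)
    also have "\<dots> = ?A * cnj ?A - ?A * cnj ?B - ?B * cnj ?A + ?B * cnj ?B"
      unfolding complex_cnj_diff by (simp add: algebra_simps del: cis_cnj cnj_sum)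
    also have "\<dots> = cis (2 * pi * x * t) * cnj (cis (2 * pi * x * t))
       - (\<Sum>s\<in>S. cnj (c s) * (cis (2 * pi * x * t) * cnj (cis (2 * pi * s * t))))
       - (\<Sum>s\<in>S. c s * (cis (2 * pi * s * t) * cnj (cis (2 * pi * x * t))))
       + (\<Sum>s\<in>S. \<Sum>u\<in>S. c s * cnj (c u) * (cis (2 * pi * s * t) * cnj (cis (2 * pi * u * t))))"
      unfolding cB sum_product by (simp only: sum_distrib_left sum_distrib_right mult_ac)
    finally show ?thesis unfolding cc by simp
  qed
  have "complex_of_real (\<integral>t. (norm (?g t))\<^sup>2 \<partial>M) = (\<integral>t. ?h t \<partial>M)"
    unfolding prod[symmetric] by (rule integral_complex_of_real[symmetric])
  also have "\<dots> = 1 - (\<Sum>s\<in>S. cnj (c s) * ft M (x - s)) - (\<Sum>s\<in>S. c s * ft M (s - x))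
      + (\<Sum>s\<in>S. \<Sum>u\<in>S. c s * cnj (c u) * ft M (s - u))"
    unfolding ft_eq by (simp add: Bochner_Integration.integral_sum Bochner_Integration.integral_diff
        Bochner_Integration.integral_add prob_space del: space_eq_univ)
  also have "(\<Sum>s\<in>S. \<Sum>u\<in>S. c s * cnj (c u) * ft M (s - u)) = (\<Sum>s\<in>S. c s * cnj (c s))"
  proof (rule sum.cong[OF refl])
    fix s assume s: "s \<in> S"
    have "(\<Sum>u\<in>S. c s * cnj (c u) * ft M (s - u)) = (\<Sum>u\<in>S. if u = s then c s * cnj (c s) else 0)"
      using orth s by (intro sum.cong) auto
    then show "(\<Sum>u\<in>S. c s * cnj (c u) * ft M (s - u)) = c s * cnj (c s)"
      using S s by simp
  qed
  also have "1 - (\<Sum>s\<in>S. cnj (c s) * ft M (x - s)) - (\<Sum>s\<in>S. c s * ft M (s - x)) + (\<Sum>s\<in>S. c s * cnj (c s))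
     = 1 - (\<Sum>s\<in>S. ft M (x - s) * cnj (ft M (x - s)))
       + (\<Sum>s\<in>S. (c s - ft M (x - s)) * cnj (c s - ft M (x - s)))"
  proof -
    have "ft M (s - x) = cnj (ft M (x - s))" for s using ft_minus[of "x - s"] by simp
    then show ?thesis by (simp add: algebra_simps sum.distrib sum_subtractf)
  qed
  also have "\<dots> = complex_of_real (1 - (\<Sum>s\<in>S. (norm (ft M (x - s)))\<^sup>2) + (\<Sum>s\<in>S. (norm (c s - ft M (x - s)))\<^sup>2))"
    by (simp only: complex_norm_square[symmetric] of_real_add of_real_diff of_real_sum of_real_1)
  finally show ?thesis by (simp only: of_real_eq_iff)
qed

lemma bessel_ft:
  assumes "finite S" "\<And>s t. s \<in> S \<Longrightarrow> t \<in> S \<Longrightarrow> s \<noteq> t \<Longrightarrow> ft M (s - t) = 0"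
  shows "(\<Sum>s\<in>S. (norm (ft M (x + s)))\<^sup>2) \<le> 1"
proof -
  have "0 \<le> (\<integral>t. (norm (cis (2 * pi * (- x) * t)
      - (\<Sum>s\<in>S. ft M (- x - s) * cis (2 * pi * s * t))))\<^sup>2 \<partial>M)"
    by (rule Bochner_Integration.integral_nonneg) simp
  also have "\<dots> = 1 - (\<Sum>s\<in>S. (norm (ft M (- x - s)))\<^sup>2)"
    by (subst integral_norm_diff_sq[OF assms]) auto
  also have "(\<Sum>s\<in>S. (norm (ft M (- x - s)))\<^sup>2) = (\<Sum>s\<in>S. (norm (ft M (x + s)))\<^sup>2)"
  proof (rule sum.cong[OF refl])
    fix s
    have "- x - s = - (x + s)" by simp
    then show "(norm (ft M (- x - s)))\<^sup>2 = (norm (ft M (x + s)))\<^sup>2"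
      by (simp only: ft_minus complex_mod_cnj)
  qed
  finally show ?thesis by simp
qed

end

text \<open>A predicate on functions: a factor of \<open>F\<close> is recognised as a transform by
  closure under products and scaling, and Bessel's inequality then applies to it without its measure
  being named.\<close>

definition fourier_transform :: "(real \<Rightarrow> complex) \<Rightarrow> bool" where
  "fourier_transform \<phi> \<longleftrightarrow> (\<exists>M. real_distribution M \<and> \<phi> = ft M)"

lemma fourier_transform_ft: "real_distribution M \<Longrightarrow> fourier_transform (ft M)"
  by (auto simp: fourier_transform_def)

lemma fourier_transform_scale:
  assumes "fourier_transform \<phi>"
  shows "fourier_transform (\<lambda>x. \<phi> (c * x))"
proof -
  obtain M where "real_distribution M" and \<phi>: "\<phi> = ft M" using assms by (auto simp: fourier_transform_def)
  interpret real_distribution M by fact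
  interpret D: real_distribution "distr M borel (\<lambda>t. c * t)"
    by (rule real_distribution_distr) simp
  have "ft (distr M borel (\<lambda>t. c * t)) x = \<phi> (c * x)" for x
    unfolding \<phi> ft_eq D.ft_eq by (subst integral_distr) (auto simp: mult_ac)
  then show ?thesis
    using D.real_distribution_axioms unfolding fourier_transform_def
    by (intro exI[of _ "distr M borel (\<lambda>t. c * t)"] conjI ext) auto
qed

lemma fourier_transform_mult:
  assumes "fourier_transform \<phi>" "fourier_transform \<psi>"
  shows "fourier_transform (\<lambda>x. \<phi> x * \<psi> x)"
proof -
  obtain M M' where "real_distribution M" "real_distribution M'" and \<phi>: "\<phi> = ft M" "\<psi> = ft M'"
    using assms by (auto simp: fourier_transform_def)
  interpret M: real_distribution M by fact
  interpret M': real_distribution M' by fact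
  interpret P: pair_prob_space M M' ..
  interpret D: real_distribution "distr (M \<Otimes>\<^sub>M M') borel (\<lambda>(s, t). s + t)"
    by (rule P.real_distribution_distr) simp
  have "ft (distr (M \<Otimes>\<^sub>M M') borel (\<lambda>(s, t). s + t)) x = \<phi> x * \<psi> x" for x
  proof -
    have "ft (distr (M \<Otimes>\<^sub>M M') borel (\<lambda>(s, t). s + t)) x
        = (\<integral>p. cis (2 * pi * x * (fst p + snd p)) \<partial>(M \<Otimes>\<^sub>M M'))"
      unfolding D.ft_eq by (subst integral_distr) (auto simp: case_prod_beta)
    also have "\<dots> = (\<integral>s. \<integral>t. cis (2 * pi * x * (s + t)) \<partial>M' \<partial>M)"
      by (subst P.integral_fst'[symmetric])
        (auto intro!: P.integrable_const_bound[of _ 1])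
    also have "\<dots> = (\<integral>s. cis (2 * pi * x * s) * ft M' x \<partial>M)"
      by (simp add: M'.ft_eq distrib_left flip: cis_mult)
    finally show ?thesis by (simp add: \<phi> M.ft_eq)
  qed
  then show ?thesis
    using D.real_distribution_axioms unfolding fourier_transform_def
    by (intro exI[of _ "distr (M \<Otimes>\<^sub>M M') borel (\<lambda>(s, t). s + t)"] conjI ext) auto
qed

lemma fourier_transform_mask:
  assumes "n > 0"
  shows "fourier_transform (mask n)"
proof -
  interpret D: real_distribution "distr (pmf_of_set {..<n}) borel real"
    by (rule prob_space.real_distribution_distr) (auto simp: prob_space_measure_pmf)
  have "ft (distr (pmf_of_set {..<n}) borel real) x = mask n x" for x
  proof -
    have "ft (distr (pmf_of_set {..<n}) borel real) x = (\<integral>j. cis (2 * pi * x * real j) \<partial>pmf_of_set {..<n})"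
      unfolding D.ft_eq by (subst integral_distr) auto
    also have "\<dots> = mask n x"
      using assms by (subst integral_measure_pmf[of "{..<n}"])
        (auto simp: mask_def sum_divide_distrib scaleR_conv_of_real lessThan_empty_iff mult_ac)
    finally show ?thesis .
  qed
  then show ?thesis
    using D.real_distribution_axioms unfolding fourier_transform_def
    by (intro exI[of _ "distr (pmf_of_set {..<n}) borel real"] conjI ext) auto
qed

lemma fourier_transform_1: "fourier_transform (\<lambda>x. 1)"
proof -
  have "(\<lambda>x. mask 1 x) = (\<lambda>x. 1)" by (simp add: mask_def)
  then show ?thesis using fourier_transform_mask[of 1] by simp
qed

lemma fourier_transform_prod:
  assumes "finite I" "\<And>i. i \<in> I \<Longrightarrow> fourier_transform (\<phi> i)"
  shows "fourier_transform (\<lambda>x. \<Prod>i\<in>I. \<phi> i x)"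
  using assms by (induction I) (auto intro: fourier_transform_1 fourier_transform_mult)

lemma bessel:
  assumes "fourier_transform \<phi>" "finite S"
    and "\<And>s t. s \<in> S \<Longrightarrow> t \<in> S \<Longrightarrow> s \<noteq> t \<Longrightarrow> \<phi> (s - t) = 0"
  shows "(\<Sum>s\<in>S. (norm (\<phi> (x + s)))\<^sup>2) \<le> 1"
  using assms real_distribution.bessel_ft by (auto simp: fourier_transform_def)

section \<open>Orthogonality and Parseval's identity for spectra\<close>

lemma (in real_distribution) is_spectrum_iff:
  "is_spectrum M \<Lambda> \<longleftrightarrow> countable \<Lambda> \<and> orthogonal_basis_L2 M \<Lambda> (\<lambda>l x. cis (2 * pi * (- l) * x))"
proof -
  have "exp (- 2 * complex_of_real pi * \<i> * complex_of_real l * complex_of_real x) = cis (2 * pi * (- l) * x)" for l x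
    unfolding cis_conv_exp by (rule arg_cong[of _ _ exp]) simp
  then show ?thesis by (simp only: is_spectrum_def)
qed

lemma (in real_distribution) spectrum_orthogonal:
  assumes "is_spectrum M \<Lambda>" "s \<in> \<Lambda>" "t \<in> \<Lambda>" "s \<noteq> t"
  shows "ft M (s - t) = 0"
proof -
  have "L2_inner M (\<lambda>x. cis (2 * pi * (- t) * x)) (\<lambda>x. cis (2 * pi * (- s) * x)) = 0"
    using assms(2-4) assms(1)[unfolded is_spectrum_iff orthogonal_basis_L2_def, THEN conjunct2, THEN conjunct2, THEN conjunct1]
    by simp
  moreover have "cis (2 * pi * (- t) * x) * cnj (cis (2 * pi * (- s) * x)) = cis (2 * pi * (s - t) * x)" for x
    by (simp add: cis_cnj cis_mult algebra_simps)
  ultimately show ?thesis by (simp add: L2_inner_def ft_eq)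
qed

text \<open>Whatever the coefficients, the squared error in approximating the exponential of
  frequency \<open>x\<close> is at least the defect in Bessel's inequality.\<close>

lemma (in real_distribution) spectrum_parseval:
  assumes sp: "is_spectrum M \<Lambda>" and e: "\<epsilon> > 0"
  obtains S where "finite S" "S \<subseteq> \<Lambda>" "(\<Sum>s\<in>S. (norm (ft M (x + s)))\<^sup>2) > 1 - \<epsilon>"
proof -
  have "(\<lambda>t. cis (2 * pi * x * t)) \<in> L2_space M"
    by (simp add: L2_space_def)
  moreover have "sqrt \<epsilon> > 0" using e by simp
  ultimately obtain F c where F: "finite F" "F \<subseteq> \<Lambda>"
    and L: "L2_norm M (\<lambda>t. cis (2 * pi * x * t) - (\<Sum>s\<in>F. c s * cis (2 * pi * (- s) * t))) < sqrt \<epsilon>"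
    using sp[unfolded is_spectrum_iff orthogonal_basis_L2_def, THEN conjunct2, THEN conjunct2, THEN conjunct2]
    by meson
  define S where "S = uminus ` F"
  have orth: "ft M (s - t) = 0" if "s \<in> S" "t \<in> S" "s \<noteq> t" for s t
  proof -
    obtain a b where "s = - a" "t = - b" "a \<in> F" "b \<in> F" using \<open>s \<in> S\<close> \<open>t \<in> S\<close> by (auto simp: S_def)
    then show ?thesis using spectrum_orthogonal[OF sp, of b a] F \<open>s \<noteq> t\<close> by (auto simp: subset_eq)
  qed
  have eq: "(\<Sum>s\<in>F. c s * cis (2 * pi * (- s) * t)) = (\<Sum>s\<in>S. c (- s) * cis (2 * pi * s * t))" for t
    unfolding S_def by (subst sum.reindex) auto
  have "1 - (\<Sum>s\<in>S. (norm (ft M (x - s)))\<^sup>2) \<le>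
     (\<integral>t. (norm (cis (2 * pi * x * t) - (\<Sum>s\<in>S. c (- s) * cis (2 * pi * s * t))))\<^sup>2 \<partial>M)"
    using F orth by (subst integral_norm_diff_sq) (auto simp: S_def intro!: sum_nonneg)
  also have "\<dots> < \<epsilon>"
    using L unfolding L2_norm_def eq by simp
  also have "(\<Sum>s\<in>S. (norm (ft M (x - s)))\<^sup>2) = (\<Sum>s\<in>F. (norm (ft M (x + s)))\<^sup>2)"
    unfolding S_def by (subst sum.reindex) auto
  finally show ?thesis using F that[of F] by simp
qed

text \<open>Otherwise Bessel's inequality for the remaining factor \<open>\<phi>\<close> would be violated.\<close>

lemma spectrum_factor_essential:
  assumes M: "real_distribution M" and sp: "is_spectrum M \<Lambda>" and fac: "\<And>x. ft M x = g x * \<phi> x"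
    and \<phi>: "fourier_transform \<phi>" and g: "\<And>x. norm (g x) \<le> 1" and x: "norm (g x) < 1" "\<phi> x \<noteq> 0"
  obtains (essential) s t where "s \<in> \<Lambda>" "t \<in> \<Lambda>" "s \<noteq> t" "\<phi> (s - t) \<noteq> 0"
proof (rule ccontr)
  interpret real_distribution M by fact
  assume nt: "\<not> thesis"
  have orth: "\<phi> (s - t) = 0" if "s \<in> \<Lambda>" "t \<in> \<Lambda>" "s \<noteq> t" for s t
    by (rule ccontr) (use nt essential[OF that] in simp)
  obtain S0 where "S0 \<subseteq> \<Lambda>" "(\<Sum>s\<in>S0. (norm (ft M (0 + s)))\<^sup>2) > 1 - 1"
    by (rule spectrum_parseval[OF sp, of 1 0]) auto
  then obtain l where l: "l \<in> \<Lambda>" by fastforce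
  \<comment> \<open>The gap between the squared moduli of \<phi> and of the transform at
    \<open>x\<close>. The translation by \<open>l\<close> puts the frequency \<open>l\<close> at the
    point \<open>x\<close>, so this single term pushes Bessel's sum for \<phi> above 1.\<close>
  define \<delta> where "\<delta> = (1 - (norm (g x))\<^sup>2) * (norm (\<phi> x))\<^sup>2"
  have "(norm (g x))\<^sup>2 < 1" using x(1) by (simp add: power_less_one_iff abs_square_less_1)
  then have \<delta>: "\<delta> > 0" using x(2) by (simp add: \<delta>_def)
  then obtain S where S: "finite S" "S \<subseteq> \<Lambda>" and big: "(\<Sum>s\<in>S. (norm (ft M ((x - l) + s)))\<^sup>2) > 1 - \<delta>"
    by (rule spectrum_parseval[OF sp])
  define T where "T = insert l S"
  have T: "finite T" "T \<subseteq> \<Lambda>" "l \<in> T" using S l by (auto simp: T_def)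
  have le: "(norm (ft M y))\<^sup>2 \<le> (norm (\<phi> y))\<^sup>2" for y
  proof -
    have "norm (ft M y) \<le> 1 * norm (\<phi> y)"
      unfolding fac norm_mult by (rule mult_right_mono[OF g]) simp
    then show ?thesis by (simp add: power_mono)
  qed
  have "1 - \<delta> < (\<Sum>s\<in>T. (norm (ft M ((x - l) + s)))\<^sup>2)"
    using big S by (elim less_le_trans) (auto simp: T_def intro!: sum_mono2)
  also have "\<dots> = (norm (ft M x))\<^sup>2 + (\<Sum>s\<in>T - {l}. (norm (ft M ((x - l) + s)))\<^sup>2)"
    using T by (subst sum.remove[of _ l]) auto
  also have "\<dots> \<le> ((norm (\<phi> x))\<^sup>2 - \<delta>) + (\<Sum>s\<in>T - {l}. (norm (\<phi> ((x - l) + s)))\<^sup>2)"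
    by (intro add_mono sum_mono le) (simp add: \<delta>_def fac norm_mult power_mult_distrib algebra_simps)
  also have "\<dots> = (\<Sum>s\<in>T. (norm (\<phi> ((x - l) + s)))\<^sup>2) - \<delta>"
    using T by (subst (2) sum.remove[of _ l]) auto
  also have "(\<Sum>s\<in>T. (norm (\<phi> ((x - l) + s)))\<^sup>2) \<le> 1"
    by (rule bessel[OF \<phi>]) (use T orth in auto)
  finally show False by simp
qed

section \<open>The differences of a spectrum\<close>

locale bernoulli =
  fixes \<rho> :: real and N :: nat
  assumes rho: "0 < \<rho>" "\<rho> < 1" and N: "1 < N"
begin

sublocale real_distribution "mu \<rho> N"
  by (rule real_distributionI) (use prob_space_mu sets_mu rho N in auto)

abbreviation F :: "real \<Rightarrow> complex" where
  "F \<equiv> ft (mu \<rho> N)"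

definition P :: "nat \<Rightarrow> real \<Rightarrow> complex" where
  "P n x = (\<Prod>j=1..n. mask N (\<rho> ^ j * x))"

lemma P_0 [simp]: "P 0 x = 1"
  by (simp add: P_def)

lemma P_Suc: "P (Suc n) x = P n x * mask N (\<rho> ^ Suc n * x)"
  by (simp add: P_def)

lemma F_step: "F x = mask N (\<rho> * x) * F (\<rho> * x)"
proof -
  have "(\<Sum>j<N. iexp (2 * pi * x * \<rho> * real j)) = (\<Sum>j<N. cis (2 * pi * real j * (\<rho> * x)))"
    unfolding cis_conv_exp by (intro sum.cong refl arg_cong[of _ _ exp]) simp
  then show ?thesis
    using self_similar_char[OF rho(1) N prob_space_mu[OF rho N] sets_mu[OF rho N] self_similar_mu[OF rho N], of "2 * pi * x"]
    by (simp only: mask_def ft_def mult_ac)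
qed

lemma F_eq_P: "F x = P n x * F (\<rho> ^ n * x)"
proof (induction n)
  case (Suc n)
  then show ?case using F_step[of "\<rho> ^ n * x"] by (simp add: P_Suc mult_ac)
qed simp

lemma F_tendsto_1: "(\<lambda>n. F (\<rho> ^ n * x)) \<longlonglongrightarrow> 1"
proof -
  have "(\<lambda>n. \<rho> ^ n * x) \<longlonglongrightarrow> 0 * x"
    using rho by (intro tendsto_intros LIMSEQ_power_zero) auto
  then show ?thesis using isCont_tendsto_compose[OF isCont_ft[of 0]] by simp
qed

text \<open>The tails \<open>F (\<rho> ^ n * x)\<close> tend to 1, so every zero of \<open>F\<close>
  is already a zero of a finite product.\<close>

lemma F_eq_0_iff: "F x = 0 \<longleftrightarrow> (\<exists>k\<ge>1. mask N (\<rho> ^ k * x) = 0)"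
proof
  assume 0: "F x = 0"
  have "eventually (\<lambda>n. F (\<rho> ^ n * x) \<noteq> 0) sequentially"
    using tendsto_imp_eventually_ne[OF F_tendsto_1] by simp
  then obtain n where "F (\<rho> ^ n * x) \<noteq> 0" by (auto simp: eventually_sequentially)
  then have "P n x = 0" using 0 F_eq_P[of x n] by simp
  then show "\<exists>k\<ge>1. mask N (\<rho> ^ k * x) = 0" by (auto simp: P_def)
next
  assume "\<exists>k\<ge>1. mask N (\<rho> ^ k * x) = 0"
  then obtain k where "k \<ge> 1" "mask N (\<rho> ^ k * x) = 0" by blast
  then have "P k x = 0" by (auto simp: P_def)
  then show "F x = 0" using F_eq_P[of x k] by simp
qed

lemma fourier_transform_P: "fourier_transform (P n)"
  unfolding P_def[abs_def] using N
  by (intro fourier_transform_prod fourier_transform_scale[OF fourier_transform_mask]) auto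

lemma norm_P_le_1: "norm (P n x) \<le> 1"
  unfolding P_def by (simp add: prod_norm[symmetric] prod_le_1 norm_mask_le_1)

end

locale bernoulli_spectrum = bernoulli +
  fixes \<Lambda> :: "real set"
  assumes spectrum: "is_spectrum (mu \<rho> N) \<Lambda>"
begin

lemma difference_level:
  assumes "s \<in> \<Lambda>" "t \<in> \<Lambda>" "s \<noteq> t"
  obtains k and a :: int where "k \<ge> 1" "real N * \<rho> ^ k * (s - t) = of_int a" "\<not> int N dvd a"
proof -
  obtain k where "k \<ge> 1" "mask N (\<rho> ^ k * (s - t)) = 0"
    using spectrum_orthogonal[OF spectrum assms] F_eq_0_iff by blast
  then show ?thesis using that N mask_eq_0_iff[of N] by (auto simp: mult.assoc)
qed

text \<open>The part of \<open>mask N (\<rho> ^ k * x)\<close> that belongs to \<open>r\<close> is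
  split off as \<open>g\<close>. As the remaining factor \<phi> contains \<open>P (k - 1)\<close>, a
  difference on which \<phi> does not vanish has no zero at any level below
  \<open>k\<close>.\<close>

lemma essential_level:
  assumes k: "k \<ge> 1" and fac: "N = A * r * B" and r: "r \<ge> 2"
  obtains s t where "s \<in> \<Lambda>" "t \<in> \<Lambda>" "s \<noteq> t" "mask r (real A * \<rho> ^ k * (s - t)) = 0"
    "\<And>j. 1 \<le> j \<Longrightarrow> j < k \<Longrightarrow> mask N (\<rho> ^ j * (s - t)) \<noteq> 0"
proof -
  have pos: "A > 0" "B > 0" "r > 0" using fac N r by (auto intro!: Nat.gr0I)
  define g where "g x = mask r (real A * \<rho> ^ k * x)" for x
  define \<phi> where "\<phi> x = P (k - 1) x * mask A (\<rho> ^ k * x) * mask B (real A * real r * \<rho> ^ k * x) * F (\<rho> ^ k * x)" for x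
  have mN: "mask N y = mask A y * mask r (real A * y) * mask B (real A * real r * y)" for y
    using mask_mult[of "A * r" B y] mask_mult[of A r y] pos fac by (simp only: of_nat_mult nat_0_less_mult_iff simp_thms)
  have FP: "F x = P (k - 1) x * mask N (\<rho> ^ k * x) * F (\<rho> ^ k * x)" for x
  proof -
    have "P k x = P (k - 1) x * mask N (\<rho> ^ k * x)" using P_Suc[of "k - 1" x] k by simp
    then show ?thesis using F_eq_P[of x k] by simp
  qed
  have Fg: "F x = g x * \<phi> x" for x
    by (subst FP) (simp only: \<phi>_def g_def mN mult_ac)
  have "fourier_transform \<phi>"
    unfolding \<phi>_def[abs_def]
    by (rule fourier_transform_mult[OF fourier_transform_mult[OF fourier_transform_mult[OF fourier_transform_P
        fourier_transform_scale[OF fourier_transform_mask[OF pos(1)], of "\<rho> ^ k"]]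
        fourier_transform_scale[OF fourier_transform_mask[OF pos(2)], of "real A * real r * \<rho> ^ k"]]
        fourier_transform_scale[OF fourier_transform_ft[OF real_distribution_axioms], of "\<rho> ^ k"]])
  moreover have "norm (g x) \<le> 1" for x by (simp add: g_def norm_mask_le_1)
  \<comment> \<open>A high power of \<rho> will do: the argument of \<open>mask r\<close> then lies
    strictly between 0 and 1, where its modulus is below 1, and \<open>F\<close> does not vanish
    there, hence neither does \<phi>.\<close>
  moreover obtain x where "norm (g x) < 1" "\<phi> x \<noteq> 0"
  proof -
    have "eventually (\<lambda>n. F (\<rho> ^ n * 1) \<noteq> 0) sequentially"
      using tendsto_imp_eventually_ne[OF F_tendsto_1[of 1], of 0] by simp
    moreover have "(\<lambda>n. real A * \<rho> ^ k * \<rho> ^ n) \<longlonglongrightarrow> real A * \<rho> ^ k * 0"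
      using rho by (intro tendsto_intros LIMSEQ_power_zero) auto
    then have "eventually (\<lambda>n. real A * \<rho> ^ k * \<rho> ^ n < 1) sequentially"
      by (rule order_tendstoD) simp
    ultimately have "eventually (\<lambda>n. F (\<rho> ^ n * 1) \<noteq> 0 \<and> real A * \<rho> ^ k * \<rho> ^ n < 1) sequentially"
      by (rule eventually_conj)
    then obtain n where n: "F (\<rho> ^ n) \<noteq> 0" "real A * \<rho> ^ k * \<rho> ^ n < 1"
      by (auto simp: eventually_sequentially)
    define y where "y = real A * \<rho> ^ k * \<rho> ^ n"
    have y: "0 < y" "y < 1" using n pos rho by (auto simp: y_def)
    have "\<bar>cos (pi * y)\<bar> < 1"
    proof -
      have "sin (pi * y) > 0" using y by (intro sin_gt_zero) auto
      then have "(sin (pi * y))\<^sup>2 > 0" by simp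
      then have "(cos (pi * y))\<^sup>2 < 1" using sin_cos_squared_add[of "pi * y"] by linarith
      then show ?thesis by (simp add: abs_square_less_1)
    qed
    then have "(real r - 2 + 2 * \<bar>cos (pi * y)\<bar>) / real r < 1"
      using r by (simp add: divide_simps)
    then have "norm (g (\<rho> ^ n)) < 1"
      using norm_mask_le[OF r, of y] by (simp add: g_def y_def)
    moreover have "\<phi> (\<rho> ^ n) \<noteq> 0" using n(1) Fg[of "\<rho> ^ n"] by auto
    ultimately show ?thesis using that by blast
  qed
  ultimately obtain s t where st: "s \<in> \<Lambda>" "t \<in> \<Lambda>" "s \<noteq> t" "\<phi> (s - t) \<noteq> 0"
    by (rule spectrum_factor_essential[OF real_distribution_axioms spectrum Fg])
  have "F (s - t) = 0" by (rule spectrum_orthogonal[OF spectrum]) (use st in auto)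
  then have "g (s - t) = 0" using Fg[of "s - t"] st by simp
  moreover have "mask N (\<rho> ^ j * (s - t)) \<noteq> 0" if "1 \<le> j" "j < k" for j
    using st(4) that by (auto simp: \<phi>_def P_def)
  ultimately show ?thesis using that st by (simp add: g_def)
qed

text \<open>Each level \<open>k\<close> occurs because its factor is essential, but a difference on
  which it vanishes has modulus at least \<open>(1 / \<rho>) ^ k / N\<close>, which is
  unbounded.\<close>

lemma infinite_spectrum: "infinite \<Lambda>"
proof
  assume fin: "finite \<Lambda>"
  define C where "C = Max ((\<lambda>(s, t). \<bar>s - t\<bar>) ` (\<Lambda> \<times> \<Lambda>))"
  have C: "\<bar>s - t\<bar> \<le> C" if "s \<in> \<Lambda>" "t \<in> \<Lambda>" for s t
    unfolding C_def by (rule Max_ge) (use fin that in auto)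
  have "(\<lambda>k. real N * \<rho> ^ k * C) \<longlonglongrightarrow> real N * 0 * C"
    using rho by (intro tendsto_intros LIMSEQ_power_zero) auto
  then have "eventually (\<lambda>k. real N * \<rho> ^ k * C < 1) sequentially"
    by (rule order_tendstoD) simp
  then obtain k where k: "real N * \<rho> ^ k * C < 1" "k \<ge> 1"
    unfolding eventually_sequentially by (metis le_add1 le_add2)
  obtain s t where st: "s \<in> \<Lambda>" "t \<in> \<Lambda>" "mask N (real 1 * \<rho> ^ k * (s - t)) = 0"
    by (rule essential_level[OF k(2), of 1 N 1]) (use N in auto)
  then obtain a :: int where a: "real N * (\<rho> ^ k * (s - t)) = of_int a" "\<not> int N dvd a"
    using N mask_eq_0_iff[of N] by auto
  have "a \<noteq> 0" using a by auto
  then have "1 \<le> \<bar>of_int a :: real\<bar>" by linarith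
  also have "\<dots> = real N * \<rho> ^ k * \<bar>s - t\<bar>" using rho by (simp add: a(1)[symmetric] abs_mult)
  also have "\<dots> \<le> real N * \<rho> ^ k * C" using rho C[OF st(1,2)] by (intro mult_left_mono) auto
  finally show False using k by simp
qed

end

section \<open>Rationality of the inverse ratio\<close>

lemma not_dvd_prime_power:
  fixes n a :: int
  assumes "n > 0" "\<not> n dvd a"
  obtains p c b where "prime p" "p ^ Suc c dvd n" "a = p ^ c * b" "\<not> p dvd b"
proof -
  have "a \<noteq> 0" using assms by auto
  have "\<exists>p. prime p \<and> \<not> multiplicity p n \<le> multiplicity p a"
  proof (rule ccontr)
    assume "\<not> ?thesis"
    then have "multiplicity p n \<le> multiplicity p a" if "prime p" for p using that by blast
    then have "n dvd a" using assms(1) by (intro multiplicity_le_imp_dvd) simp_all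
    then show False using assms(2) by simp
  qed
  then obtain p where p: "prime p" "\<not> multiplicity p n \<le> multiplicity p a" by blast
  obtain b where b: "a = p ^ multiplicity p a * b" "\<not> p dvd b"
    by (rule multiplicity_decompose'[OF \<open>a \<noteq> 0\<close>]) (use p(1) not_prime_unit in auto)
  have "p ^ Suc (multiplicity p a) dvd n"
    using p by (intro multiplicity_dvd') simp
  then show ?thesis using that p(1) b by blast
qed

text \<open>The argument that a group is not the union of two proper subgroups.\<close>

lemma differences_in_subgroup:
  fixes H G \<Lambda> :: "real set"
  assumes H: "\<And>x y. x \<in> H \<Longrightarrow> y \<in> H \<Longrightarrow> x - y \<in> H" and G: "\<And>x y. x \<in> G \<Longrightarrow> y \<in> G \<Longrightarrow> x - y \<in> G"
    and zero: "0 \<in> H" "0 \<in> G"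
    and cover: "\<And>s t. s \<in> \<Lambda> \<Longrightarrow> t \<in> \<Lambda> \<Longrightarrow> s \<noteq> t \<Longrightarrow> s - t \<in> H \<or> s - t \<in> G"
  shows "(\<forall>s\<in>\<Lambda>. \<forall>t\<in>\<Lambda>. s - t \<in> H) \<or> (\<forall>s\<in>\<Lambda>. \<forall>t\<in>\<Lambda>. s - t \<in> G)"
proof (rule disjCI)
  assume "\<not> (\<forall>s\<in>\<Lambda>. \<forall>t\<in>\<Lambda>. s - t \<in> G)"
  then obtain a b where ab: "a \<in> \<Lambda>" "b \<in> \<Lambda>" "a - b \<notin> G" by blast
  have cover': "s - t \<in> H \<or> s - t \<in> G" if "s \<in> \<Lambda>" "t \<in> \<Lambda>" for s t
    using cover[OF that] zero by (cases "s = t") auto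
  have abH: "a - b \<in> H" using cover'[OF ab(1,2)] ab(3) by blast
  have "u - b \<in> H" if u: "u \<in> \<Lambda>" for u
  proof (cases "u - b \<in> H")
    case False
    then have "u - b \<in> G" using cover'[OF u ab(2)] by blast
    then have "u - a \<notin> G" using G[of "u - b" "u - a"] ab(3) by auto
    then have "u - a \<in> H" using cover'[OF u ab(1)] by blast
    then have "(u - a) - (0 - (a - b)) \<in> H" using H abH zero(1) by blast
    then show ?thesis by simp
  qed
  then show "\<forall>s\<in>\<Lambda>. \<forall>t\<in>\<Lambda>. s - t \<in> H"
    using H[of "s - b" "t - b" for s t] by simp
qed

context bernoulli_spectrum
begin

lemma theta_power_level:
  assumes "real N * \<rho> ^ k * d = of_int a"
  shows "real N * d = (1 / \<rho>) ^ k * of_int a"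
  using assms rho by (simp add: field_simps power_divide)

lemma exists_rational_power: "\<exists>s\<ge>1. (1 / \<rho>) ^ s \<in> \<rat>"
proof -
  define Q where "Q p c s t \<longleftrightarrow> prime p \<and>
      (\<exists>k b. real N * (s - t) = (1 / \<rho>) ^ k * of_int (int p ^ c * b) \<and> \<not> int p dvd b)" for p c s t
  have Qsym: "Q p c t s" if "Q p c s t" for p c s t
  proof -
    obtain k b where "prime p" "real N * (s - t) = (1 / \<rho>) ^ k * of_int (int p ^ c * b)" "\<not> int p dvd b"
      using \<open>Q p c s t\<close> unfolding Q_def by blast
    then show ?thesis unfolding Q_def
      by (intro conjI exI[of _ k] exI[of _ "- b"]) (auto simp: algebra_simps)
  qed
  \<comment> \<open>A colour encodes a prime \<open>p\<close> and an exponent \<open>c\<close> as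
    \<open>p * Suc N + c\<close>; both are at most \<open>N\<close> because \<open>p ^ Suc c\<close>
    divides \<open>N\<close>. Colours belong to unordered pairs, which is legitimate as
    \<open>Q\<close> is symmetric.\<close>
  define M where "M = Suc N * Suc N"
  define col where "col X = (SOME n. n < M \<and> (\<exists>s t. X = {s, t} \<and> Q (n div Suc N) (n mod Suc N) s t))" for X
  have col: "col {s, t} < M \<and> Q (col {s, t} div Suc N) (col {s, t} mod Suc N) s t"
    if st: "s \<in> \<Lambda>" "t \<in> \<Lambda>" "s \<noteq> t" for s t
  proof -
    obtain k and a :: int where a: "real N * \<rho> ^ k * (s - t) = of_int a" "\<not> int N dvd a"
      using difference_level[OF st] by blast
    obtain p c b where p: "prime p" "p ^ Suc c dvd int N" "a = p ^ c * b" "\<not> p dvd b"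
      by (rule not_dvd_prime_power[OF _ a(2)]) (use N in simp)
    have p2: "p \<ge> 2" using p(1) by (rule prime_ge_2_int)
    define p' where "p' = nat p"
    have p': "p = int p'" "p' \<ge> 2" using p2 by (auto simp: p'_def)
    have "p' ^ Suc c dvd N" using p(2) unfolding p' by (metis of_nat_dvd_iff of_nat_power)
    then have le: "p' ^ Suc c \<le> N" using N by (intro dvd_imp_le) auto
    have "p' \<le> p' ^ Suc c" using p' by (intro self_le_power) auto
    moreover have "Suc c < p' ^ Suc c"
      using less_exp[of "Suc c"] power_mono[of 2 p' "Suc c"] p' by linarith
    ultimately have b1: "p' < Suc N" "c < Suc N" using le by linarith+
    have "p' * Suc N + c < M"
    proof -
      have "p' * Suc N + c < p' * Suc N + Suc N" using b1 by simp
      also have "\<dots> = Suc p' * Suc N" by simp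
      also have "\<dots> \<le> M" unfolding M_def using b1 by (intro mult_right_mono) auto
      finally show ?thesis .
    qed
    moreover have "(p' * Suc N + c) div Suc N = p'" "(p' * Suc N + c) mod Suc N = c"
      using b1 by (simp_all only: div_mult_self3 mod_mult_self3) simp_all
    moreover have "Q p' c s t"
      unfolding Q_def using theta_power_level[OF a(1)] p p' by auto
    ultimately have "\<exists>n<M. \<exists>s' t'. {s, t} = {s', t'} \<and> Q (n div Suc N) (n mod Suc N) s' t'"
      by metis
    then have "col {s, t} < M \<and> (\<exists>s' t'. {s, t} = {s', t'} \<and> Q (col {s, t} div Suc N) (col {s, t} mod Suc N) s' t')"
      unfolding col_def by (rule someI_ex)
    then show ?thesis using Qsym by (auto simp: doubleton_eq_iff)
  qed
  obtain Y n where Y: "Y \<subseteq> \<Lambda>" "infinite Y" and n: "\<And>s t. s \<in> Y \<Longrightarrow> t \<in> Y \<Longrightarrow> s \<noteq> t \<Longrightarrow> col {s, t} = n"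
    using Ramsey2[OF infinite_spectrum, of col M] col by blast
  define p c where "p = n div Suc N" and "c = n mod Suc N"
  have Q: "Q p c s t" if "s \<in> Y" "t \<in> Y" "s \<noteq> t" for s t
    using col[of s t] n[OF that] Y(1) that by (auto simp: p_def c_def)
  obtain s where "s \<in> Y" using Y(2) by fastforce
  moreover obtain t where "t \<in> Y" "t \<noteq> s"
    using Y(2) by (metis finite.simps finite_insert subset_singletonD subset_iff singletonI insert_iff finite_subset)
  ultimately have p: "prime p" using Q[of s t] by (auto simp: Q_def)
  have pc: "real p ^ c \<noteq> 0" using p by (auto simp: prime_gt_0_nat)
  \<comment> \<open>The scaling removes the denominator \<open>N\<close> and the common power of
    \<open>p\<close>, leaving coefficients prime to \<open>p\<close>.\<close>
  define f where "f s = real N / real p ^ c * s" for s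
  have "inj_on f Y" using N pc by (auto simp: inj_on_def f_def)
  then have "infinite (f ` Y)" using Y(2) finite_imageD by blast
  moreover have "\<exists>k b. x - y = (1 / \<rho>) ^ k * of_int b \<and> \<not> int p dvd b"
    if xy: "x \<in> f ` Y" "y \<in> f ` Y" "x \<noteq> y" for x y
  proof -
    obtain s t where st: "s \<in> Y" "t \<in> Y" "s \<noteq> t" "x = f s" "y = f t" using xy by auto
    then obtain k b where kb: "real N * (s - t) = (1 / \<rho>) ^ k * of_int (int p ^ c * b)" "\<not> int p dvd b"
      using Q[of s t] by (auto simp: Q_def)
    have "x - y = real N * (s - t) / real p ^ c" using st by (simp add: f_def algebra_simps diff_divide_distrib)
    also have "\<dots> = (1 / \<rho>) ^ k * of_int b" unfolding kb(1) of_int_mult of_int_power of_int_of_nat_eq using pc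
      by (simp del: power_eq_0_iff)
    finally show ?thesis using kb(2) by blast
  qed
  ultimately show ?thesis
    using power_diff_set_rational_power[of "1 / \<rho>" "int p" "f ` Y"] rho p by simp
qed

text \<open>Let \<open>n\<close> be least with \<open>\<theta> ^ n\<close> rational. A difference of
  level \<open>k\<close> is a rational multiple of \<open>\<theta> ^ (k mod n)\<close>, so it lies
  in the line \<open>H\<close> through \<theta> or in the span \<open>G\<close> of the other powers.
  If \<open>n > 1\<close>, level 2 shows that not all differences lie in \<open>H\<close>, and level
  1 that not all lie in \<open>G\<close>, since the powers below \<open>n\<close> are linearly
  independent over the rationals.\<close>

lemma theta_rational: "1 / \<rho> \<in> \<rat>"
proof (rule ccontr)
  define \<theta> where "\<theta> = 1 / \<rho>"
  assume irr: "1 / \<rho> \<notin> \<rat>"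
  have \<theta>: "\<theta> > 0" using rho by (simp add: \<theta>_def)
  define n where "n = (LEAST n. 1 \<le> n \<and> \<theta> ^ n \<in> \<rat>)"
  have n: "1 \<le> n" "\<theta> ^ n \<in> \<rat>"
    using LeastI_ex[of "\<lambda>n. 1 \<le> n \<and> \<theta> ^ n \<in> \<rat>"] exists_rational_power unfolding n_def \<theta>_def by auto
  have nmin: "\<theta> ^ t \<notin> \<rat>" if "1 \<le> t" "t < n" for t
    using not_less_Least[of t "\<lambda>n. 1 \<le> n \<and> \<theta> ^ n \<in> \<rat>"] that unfolding n_def by blast
  have n1: "n > 1" using n irr by (cases "n = 1") (auto simp: \<theta>_def)
  note deg = degree_ge_of_minimal_rational_power[OF \<theta> n(2) n(1) nmin]
  define H where "H = {x. \<exists>r\<in>\<rat>. x = \<theta> * r}"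
  \<comment> \<open>The rational span of the powers of \<theta> with exponent below \<open>n\<close>
    and different from 1; \<open>m\<close> clears denominators so that integer polynomials
    suffice.\<close>
  define G where "G = {x. \<exists>(m::int) f. m \<noteq> 0 \<and> of_int m * x = ipoly f \<theta> \<and> degree f < n \<and> coeff f 1 = 0}"
  have HG: "\<theta> ^ k * of_int a / of_nat N \<in> (if k mod n = 1 then H else G)" for k and a :: int
  proof -
    have "(\<theta> ^ n) ^ (k div n) \<in> \<rat>" using n by simp
    then obtain u v :: int where uv: "v \<noteq> 0" "(\<theta> ^ n) ^ (k div n) = of_int u / of_int v"
      by (rule Rats_cases') (metis less_irrefl)
    have k: "\<theta> ^ k = \<theta> ^ (k mod n) * (of_int u / of_int v)"
      unfolding uv(2)[symmetric] by (simp flip: power_mult power_add)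
    show ?thesis
    proof (cases "k mod n = 1")
      case True
      then have "\<theta> ^ k * of_int a / of_nat N = \<theta> * (of_int u / of_int v * of_int a / of_nat N)"
        using k by simp
      moreover have "(of_int u / of_int v * of_int a / of_nat N :: real) \<in> \<rat>" by simp
      ultimately have "\<theta> ^ k * of_int a / of_nat N \<in> H" unfolding H_def by blast
      then show ?thesis using True by simp
    next
      case False
      have "of_int (v * int N) * (\<theta> ^ k * of_int a / of_nat N) = ipoly (monom (u * a) (k mod n)) \<theta>"
        using k uv(1) N by simp
      moreover have "degree (monom (u * a) (k mod n)) < n"
        using degree_monom_le[of "u * a" "k mod n"] n by (meson le_less_trans mod_less_divisor less_le_trans zero_less_one)
      moreover have "coeff (monom (u * a) (k mod n)) 1 = 0" using False by simp
      moreover have "v * int N \<noteq> 0" using uv N by simp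
      ultimately have "\<theta> ^ k * of_int a / of_nat N \<in> G" unfolding G_def by blast
      then show ?thesis using False by simp
    qed
  qed
  have "(\<forall>s\<in>\<Lambda>. \<forall>t\<in>\<Lambda>. s - t \<in> H) \<or> (\<forall>s\<in>\<Lambda>. \<forall>t\<in>\<Lambda>. s - t \<in> G)"
  proof (rule differences_in_subgroup)
    show "x - y \<in> H" if "x \<in> H" "y \<in> H" for x y
    proof -
      from that(1) obtain r where r: "r \<in> \<rat>" "x = \<theta> * r"
        unfolding H_def mem_Collect_eq by (elim bexE)
      from that(2) obtain r' where r': "r' \<in> \<rat>" "y = \<theta> * r'"
        unfolding H_def mem_Collect_eq by (elim bexE)
      from r r' have "x - y = \<theta> * (r - r')" "r - r' \<in> \<rat>" by (simp_all add: right_diff_distrib)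
      then show ?thesis unfolding H_def by blast
    qed
    show "x - y \<in> G" if "x \<in> G" "y \<in> G" for x y
    proof -
      from that(1) obtain m f where m1: "m \<noteq> 0" "of_int m * x = ipoly f \<theta>" "degree f < n" "coeff f 1 = 0"
        unfolding G_def mem_Collect_eq by (elim exE conjE)
      from that(2) obtain m' f' where m2: "m' \<noteq> 0" "of_int m' * y = ipoly f' \<theta>" "degree f' < n" "coeff f' 1 = 0"
        unfolding G_def mem_Collect_eq by (elim exE conjE)
      note m = m1 m2
      define g where "g = smult m' f - smult m f'"
      have "of_int (m * m') * (x - y) = of_int m' * (of_int m * x) - of_int m * (of_int m' * y)"
        by (simp add: algebra_simps)
      also have "\<dots> = ipoly g \<theta>" unfolding m g_def by simp
      finally have "of_int (m * m') * (x - y) = ipoly g \<theta>" .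
      moreover have "degree g < n" unfolding g_def using m by (intro degree_diff_less) auto
      moreover have "coeff g 1 = 0" "m * m' \<noteq> 0" using m by (auto simp: g_def)
      ultimately show ?thesis unfolding G_def by blast
    qed
    show "0 \<in> H" unfolding H_def by (auto intro!: bexI[of _ 0])
    show "0 \<in> G" unfolding G_def using n by (intro CollectI exI[of _ 1] exI[of _ 0]) auto
    show "s - t \<in> H \<or> s - t \<in> G" if st: "s \<in> \<Lambda>" "t \<in> \<Lambda>" "s \<noteq> t" for s t
    proof -
      obtain k and a :: int where "real N * \<rho> ^ k * (s - t) = of_int a"
        using difference_level[OF st] by blast
      then have "real N * (s - t) = \<theta> ^ k * of_int a" unfolding \<theta>_def by (rule theta_power_level)
      then have "s - t = \<theta> ^ k * of_int a / of_nat N" using N by (simp add: field_simps)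
      then show ?thesis using HG[of k a] by (auto split: if_splits)
    qed
  qed
  moreover have level: "\<exists>s\<in>\<Lambda>. \<exists>t\<in>\<Lambda>. \<exists>a. a \<noteq> 0 \<and> real N * (s - t) = \<theta> ^ k * of_int a" if k: "k \<ge> 1" for k
  proof -
    obtain s t where st: "s \<in> \<Lambda>" "t \<in> \<Lambda>" "mask N (real 1 * \<rho> ^ k * (s - t)) = 0"
      by (rule essential_level[OF k, of 1 N 1]) (use N in auto)
    then obtain a :: int where a: "real N * \<rho> ^ k * (s - t) = of_int a" "\<not> int N dvd a"
      using N mask_eq_0_iff[of N] by (auto simp: mult.assoc)
    then have "a \<noteq> 0" by auto
    then show ?thesis using st theta_power_level[OF a(1)] unfolding \<theta>_def by blast
  qed
  ultimately show False
  proof (elim disjE)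
    assume *: "\<forall>s\<in>\<Lambda>. \<forall>t\<in>\<Lambda>. s - t \<in> H"
    obtain s t a where st: "s \<in> \<Lambda>" "t \<in> \<Lambda>" "a \<noteq> 0" "real N * (s - t) = \<theta> ^ 2 * of_int a"
      using level[of 2] by auto
    obtain r where r: "r \<in> \<rat>" "s - t = \<theta> * r" using * st unfolding H_def by blast
    then have "\<theta> = real N * r / of_int a" using st \<theta> by (simp add: field_simps power2_eq_square)
    then have "\<theta> \<in> \<rat>" using r by simp
    then show False using irr by (simp add: \<theta>_def)
  next
    assume *: "\<forall>s\<in>\<Lambda>. \<forall>t\<in>\<Lambda>. s - t \<in> G"
    obtain s t a where st: "s \<in> \<Lambda>" "t \<in> \<Lambda>" "a \<noteq> 0" "real N * (s - t) = \<theta> ^ 1 * of_int a"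
      using level[of 1] by auto
    obtain m f where f: "m \<noteq> 0" "of_int m * (s - t) = ipoly f \<theta>" "degree f < n" "coeff f 1 = 0"
      using *[rule_format, OF st(1,2)] unfolding G_def mem_Collect_eq by (elim exE conjE)
    define g where "g = smult (int N) f - monom (m * a) 1"
    have "ipoly g \<theta> = real N * (of_int m * (s - t)) - of_int m * (\<theta> * of_int a)" by (simp add: g_def f(2))
    also have "\<dots> = of_int m * (real N * (s - t) - \<theta> * of_int a)" by (simp add: algebra_simps)
    also have "\<dots> = 0" using st by simp
    finally have "ipoly g \<theta> = 0" .
    moreover have "coeff g 1 = - (m * a)" using f by (simp add: g_def)
    then have "g \<noteq> 0" using f(1) st(3) by auto
    ultimately have "n \<le> degree g" by (intro deg)
    moreover have "degree g < n"
      unfolding g_def using f n1 degree_monom_le[of "m * a" 1] by (intro degree_diff_less) auto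
    ultimately show False by simp
  qed
qed

end

section \<open>Arithmetic of a rational inverse ratio\<close>

locale rational_spectrum = bernoulli_spectrum +
  fixes p q :: nat
  assumes pq: "coprime p q" "p > 0" "q > 0" and rho_eq: "\<rho> = real p / real q"
begin

lemma p_less_q: "p < q"
  using rho rho_eq pq by (simp add: divide_simps)

lemma scaled_level:
  assumes "real c * \<rho> ^ k * d = of_int a"
  shows "real c * real p ^ k * d = real q ^ k * of_int a"
  using assms pq by (simp add: rho_eq power_divide field_simps)

lemma rational_level:
  assumes "s \<in> \<Lambda>" "t \<in> \<Lambda>" "s \<noteq> t"
  obtains k and a :: int where "k \<ge> 1" "real N * real p ^ k * (s - t) = real q ^ k * of_int a" "\<not> int N dvd a"
proof -
  obtain k and a :: int where "k \<ge> 1" "real N * \<rho> ^ k * (s - t) = of_int a" "\<not> int N dvd a"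
    using difference_level[OF assms] by blast
  then show ?thesis using that scaled_level by blast
qed

lemma essential_prime_level:
  assumes k: "k \<ge> 1" and fac: "N = A * r * B" and r: "r \<ge> 2"
  obtains s t b where "s \<in> \<Lambda>" "t \<in> \<Lambda>" "s \<noteq> t" "real (A * r) * real p ^ k * (s - t) = real q ^ k * of_int b"
    "\<not> int r dvd b" "\<And>j. 1 \<le> j \<Longrightarrow> j < k \<Longrightarrow> mask N (\<rho> ^ j * (s - t)) \<noteq> 0"
proof -
  obtain s t where st: "s \<in> \<Lambda>" "t \<in> \<Lambda>" "s \<noteq> t" "mask r (real A * \<rho> ^ k * (s - t)) = 0"
    "\<And>j. 1 \<le> j \<Longrightarrow> j < k \<Longrightarrow> mask N (\<rho> ^ j * (s - t)) \<noteq> 0"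
    using essential_level[OF k fac r] by blast
  then obtain b :: int where b: "real r * (real A * \<rho> ^ k * (s - t)) = of_int b" "\<not> int r dvd b"
    using r mask_eq_0_iff[of r] by auto
  have "real (A * r) * \<rho> ^ k * (s - t) = of_int b" using b(1) by (simp add: mult_ac)
  then show ?thesis using that st b(2) scaled_level by blast
qed

text \<open>The condition on \<open>N * x\<close> is divisibility by \<open>q ^ j\<close> in the
  ring of integers with \<open>1 / p\<close> adjoined; the exponent \<open>K\<close> is free because
  levels are unbounded. In \<open>shallow\<close>, by contrast, the denominator of
  \<open>N * x\<close> is bounded by \<open>p ^ j\<close>. Both sets are groups.\<close>

definition deep :: "nat \<Rightarrow> real set" where
  "deep j = {x. \<exists>K (y::int). real N * real p ^ K * x = real q ^ j * of_int y}"

definition shallow :: "nat \<Rightarrow> real set" where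
  "shallow j = {x. \<exists>y::int. real N * real p ^ j * x = of_int y}"

text \<open>Differences of level at most \<open>j\<close> lie in \<open>shallow j\<close>, those of higher level in \<open>deep (Suc j)\<close>.\<close>

lemma shallow_or_deep:
  "(\<forall>s\<in>\<Lambda>. \<forall>t\<in>\<Lambda>. s - t \<in> shallow j) \<or> (\<forall>s\<in>\<Lambda>. \<forall>t\<in>\<Lambda>. s - t \<in> deep (Suc j))"
proof (rule differences_in_subgroup)
  show "x - y \<in> shallow j" if x: "x \<in> shallow j" and y: "y \<in> shallow j" for x y
  proof -
    from x obtain a :: int where a: "real N * real p ^ j * x = of_int a"
      unfolding shallow_def mem_Collect_eq by (elim exE)
    from y obtain b :: int where b: "real N * real p ^ j * y = of_int b"
      unfolding shallow_def mem_Collect_eq by (elim exE)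
    have "real N * real p ^ j * (x - y) = of_int (a - b)" using a b by (simp add: right_diff_distrib)
    then show ?thesis unfolding shallow_def by blast
  qed
  show "x - y \<in> deep (Suc j)" if x: "x \<in> deep (Suc j)" and y: "y \<in> deep (Suc j)" for x y
  proof -
    from x obtain K and a :: int where a: "real N * real p ^ K * x = real q ^ Suc j * of_int a"
      unfolding deep_def mem_Collect_eq by (elim exE)
    from y obtain L and b :: int where b: "real N * real p ^ L * y = real q ^ Suc j * of_int b"
      unfolding deep_def mem_Collect_eq by (elim exE)
    have "real N * real p ^ (K + L) * (x - y)
        = real p ^ L * (real N * real p ^ K * x) - real p ^ K * (real N * real p ^ L * y)"
      by (simp add: power_add algebra_simps)
    also have "\<dots> = real q ^ Suc j * of_int (int p ^ L * a - int p ^ K * b)"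
      unfolding a b by (simp add: algebra_simps)
    finally show ?thesis unfolding deep_def by blast
  qed
  show "0 \<in> shallow j" unfolding shallow_def by (auto intro: exI[of _ 0])
  show "0 \<in> deep (Suc j)" unfolding deep_def by (auto intro: exI[of _ 0])
  show "s - t \<in> shallow j \<or> s - t \<in> deep (Suc j)" if st: "s \<in> \<Lambda>" "t \<in> \<Lambda>" "s \<noteq> t" for s t
  proof -
    obtain k and a :: int where ka: "real N * real p ^ k * (s - t) = real q ^ k * of_int a"
      using rational_level[OF st] by blast
    show ?thesis
    proof (cases "k \<le> j")
      case True
      then have "real p ^ j = real p ^ k * real p ^ (j - k)" by (simp flip: power_add)
      then have "real N * real p ^ j * (s - t) = of_int (int q ^ k * a * int p ^ (j - k))"
        using ka by (simp add: mult_ac)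
      then show ?thesis unfolding shallow_def by blast
    next
      case False
      then have "real q ^ k = real q ^ Suc j * real q ^ (k - Suc j)" by (simp only: flip: power_add) simp
      then have "real N * real p ^ k * (s - t) = real q ^ Suc j * of_int (int q ^ (k - Suc j) * a)"
        using ka by (simp add: mult_ac)
      then show ?thesis unfolding deep_def by blast
    qed
  qed
qed

text \<open>One fixed difference fails to be deep for large \<open>j\<close>, so all differences are
  shallow and have bounded denominators. By the pigeonhole principle some difference is then
  \<open>N\<close> times an integer; if \<open>N\<close> were prime to \<open>q\<close>, its
  numerator \<open>a\<close> would be divisible by \<open>N\<close>.\<close>

lemma not_coprime_N_q: "\<not> coprime N q"
proof
  assume cop: "coprime N q"
  obtain s0 t0 where st: "s0 \<in> \<Lambda>" "t0 \<in> \<Lambda>" "s0 \<noteq> t0"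
  proof -
    obtain s0 where "s0 \<in> \<Lambda>" using infinite_spectrum by fastforce
    moreover have "infinite (\<Lambda> - {s0})" using infinite_spectrum by simp
    then obtain t0 where "t0 \<in> \<Lambda> - {s0}" using infinite_imp_nonempty by blast
    ultimately show ?thesis using that by blast
  qed
  obtain k0 and a0 :: int where k0: "real N * real p ^ k0 * (s0 - t0) = real q ^ k0 * of_int a0" "\<not> int N dvd a0"
    using rational_level[OF st] by blast
  define z where "z = int q ^ k0 * a0"
  have "a0 \<noteq> 0" using k0(2) by auto
  then have z: "z \<noteq> 0" using pq by (simp add: z_def)
  have q2: "q \<ge> 2" using p_less_q pq by simp
  \<comment> \<open>Large enough that \<open>q ^ Suc j\<close> exceeds \<open>\<bar>z\<bar>\<close>
    and thus cannot divide \<open>z\<close>.\<close>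
  define j where "j = nat \<bar>z\<bar>"
  have "s0 - t0 \<notin> deep (Suc j)"
  proof
    assume "s0 - t0 \<in> deep (Suc j)"
    then obtain K and y :: int where y: "real N * real p ^ K * (s0 - t0) = real q ^ Suc j * of_int y"
      unfolding deep_def mem_Collect_eq by (elim exE)
    have "real p ^ K * (real N * real p ^ k0 * (s0 - t0)) = real p ^ k0 * (real N * real p ^ K * (s0 - t0))"
      by (simp add: mult_ac)
    then have "real_of_int (int p ^ K * z) = of_int (int q ^ Suc j * (int p ^ k0 * y))"
      unfolding k0 y z_def by (simp add: mult_ac)
    then have "int p ^ K * z = int q ^ Suc j * (int p ^ k0 * y)" by (simp only: of_int_eq_iff)
    then have "int q ^ Suc j dvd int p ^ K * z" by simp
    moreover have "coprime (int q ^ Suc j) (int p ^ K)"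
      using pq(1) by (simp add: coprime_commute)
    ultimately have "int q ^ Suc j dvd z" by (simp only: coprime_dvd_mult_right_iff)
    then have "\<bar>int q ^ Suc j\<bar> \<le> \<bar>z\<bar>" using z by (rule dvd_imp_le_int[rotated])
    then have "int (q ^ Suc j) \<le> int j" by (simp add: j_def)
    then have "q ^ Suc j \<le> j" by (simp only: of_nat_le_iff)
    moreover have "Suc j < 2 ^ Suc j" by (rule less_exp)
    moreover have "2 ^ Suc j \<le> q ^ Suc j" using q2 by (intro power_mono) auto
    ultimately show False by linarith
  qed
  then have sh: "s - t \<in> shallow j" if "s \<in> \<Lambda>" "t \<in> \<Lambda>" for s t
    using shallow_or_deep[of j] st that by blast
  have "\<exists>y::int. real N * real p ^ j * (s - s0) = of_int y" if "s \<in> \<Lambda>" for s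
    using sh[OF that st(1)] unfolding shallow_def by blast
  then obtain f :: "real \<Rightarrow> int" where f: "\<And>s. s \<in> \<Lambda> \<Longrightarrow> real N * real p ^ j * (s - s0) = of_int (f s)"
    by metis
  \<comment> \<open>One factor \<open>N\<close> and the power of \<open>p\<close> cancel the scaling
    of \<open>f\<close>; the second factor \<open>N\<close> remains in the difference.\<close>
  define m where "m = int N * int N * int p ^ j"
  have m: "m > 0" using N pq by (simp add: m_def)
  have "finite ((\<lambda>s. f s mod m) ` \<Lambda>)"
    by (rule finite_subset[of _ "{0..<m}"]) (use m in auto)
  then have "\<not> inj_on (\<lambda>s. f s mod m) \<Lambda>" using infinite_spectrum finite_imageD by blast
  then obtain s t where st: "s \<in> \<Lambda>" "t \<in> \<Lambda>" "s \<noteq> t" "f s mod m = f t mod m" by (auto simp: inj_on_def)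
  then obtain z where "f s - f t = m * z" by (metis mod_eq_dvd_iff dvdE)
  then have "real N * real p ^ j * (s - t) = of_int (m * z)"
    using f[OF st(1)] f[OF st(2)] by (simp add: algebra_simps flip: of_int_diff)
  then have d: "s - t = real N * of_int z" using N pq by (simp add: m_def)
  obtain k and a :: int where ka: "real N * real p ^ k * (s - t) = real q ^ k * of_int a" "\<not> int N dvd a"
    using rational_level[OF st(1-3)] by blast
  have "real_of_int (int N * (int p ^ k * int N * z)) = of_int (int q ^ k * a)"
    using ka(1) unfolding d by (simp add: mult_ac)
  then have "int N * (int p ^ k * int N * z) = int q ^ k * a" by (simp only: of_int_eq_iff)
  then have "int N dvd int q ^ k * a" by (metis dvd_triv_left)
  moreover have "coprime (int N) (int q ^ k)" using cop by simp
  ultimately show False using ka(2) by (simp add: coprime_dvd_mult_right_iff)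
qed

text \<open>Let the prime \<open>r\<close> divide both \<open>N\<close> and \<open>q\<close>. The
  factor of level 1 belonging to \<open>r\<close> supplies a difference with
  \<open>N * p * (s - t) = q * b\<close> and \<open>b\<close> prime to \<open>r\<close>;
  divisibility by \<open>q ^ 2\<close> would make \<open>q\<close>, hence \<open>r\<close>, divide
  \<open>b\<close>. So the deep alternative fails for \<open>j = 1\<close>.\<close>

lemma shallow_differences:
  assumes "s \<in> \<Lambda>" "t \<in> \<Lambda>"
  obtains y :: int where "real N * real p * (s - t) = of_int y"
proof -
  obtain r where r: "prime r" "r dvd N" "r dvd q"
    using not_coprime_N_q by (metis coprime_iff_gcd_eq_1 gcd_dvd1 gcd_dvd2 prime_factor_nat dvd_trans)
  have "\<not> (\<forall>s\<in>\<Lambda>. \<forall>t\<in>\<Lambda>. s - t \<in> deep (Suc 1))"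
  proof
    assume deep: "\<forall>s\<in>\<Lambda>. \<forall>t\<in>\<Lambda>. s - t \<in> deep (Suc 1)"
    have fac: "N = (N div r) * r * 1" using r by simp
    obtain s t b where st: "s \<in> \<Lambda>" "t \<in> \<Lambda>" and b: "real ((N div r) * r) * real p ^ 1 * (s - t) = real q ^ 1 * of_int b"
      "\<not> int r dvd b"
      by (rule essential_prime_level[OF _ fac]) (use r prime_ge_2_nat in auto)
    have b1: "real N * real p * (s - t) = real q * of_int b" using b(1) r by simp
    have "s - t \<in> deep (Suc 1)" using deep st by blast
    then obtain K and y :: int where y: "real N * real p ^ K * (s - t) = real q ^ Suc 1 * of_int y"
      unfolding deep_def mem_Collect_eq by (elim exE)
    have "real p ^ K * (real N * real p * (s - t)) = real p * (real N * real p ^ K * (s - t))"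
      by (simp add: mult_ac)
    then have "real q * of_int (int p ^ K * b) = real q * of_int (int q * (int p * y))"
      unfolding b1 y by (simp add: mult_ac)
    then have "real_of_int (int p ^ K * b) = of_int (int q * (int p * y))" using pq by (simp only: mult_cancel_left) simp
    then have "int p ^ K * b = int q * (int p * y)" by (simp only: of_int_eq_iff)
    then have "int q dvd int p ^ K * b" by simp
    moreover have "coprime (int q) (int p ^ K)" using pq(1) by (simp add: coprime_commute)
    ultimately have "int q dvd b" by (simp only: coprime_dvd_mult_right_iff)
    then show False using b(2) r(3) by (meson dvd_trans int_dvd_int_iff)
  qed
  then have "s - t \<in> shallow 1" using shallow_or_deep[of 1] assms by blast
  then show ?thesis using that unfolding shallow_def by auto
qed

text \<open>Level 2 gives \<open>p * y = q ^ 2 * b\<close> with \<open>b\<close> prime to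
  \<open>r\<close>. A prime \<open>r\<close> dividing \<open>p\<close> is prime to \<open>q\<close>
  and would divide \<open>b\<close>.\<close>

lemma prime_factor_N_not_dvd_p:
  assumes r: "prime r" "r dvd N"
  shows "\<not> r dvd p"
proof
  assume rp: "r dvd p"
  have fac: "N = (N div r) * r * 1" using r by simp
  obtain s t b where st: "s \<in> \<Lambda>" "t \<in> \<Lambda>" and b: "real ((N div r) * r) * real p ^ 2 * (s - t) = real q ^ 2 * of_int b"
    "\<not> int r dvd b"
    by (rule essential_prime_level[OF _ fac, of 2]) (use r prime_ge_2_nat in auto)
  obtain y :: int where y: "real N * real p * (s - t) = of_int y" using shallow_differences[OF st] .
  have "real p * (real N * real p * (s - t)) = real q ^ 2 * of_int b"
    using b(1) r by (simp add: power2_eq_square mult_ac)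
  then have "real_of_int (int p * y) = of_int (int q ^ 2 * b)" unfolding y by simp
  then have "int p * y = int q ^ 2 * b" by (simp only: of_int_eq_iff)
  then have "int r dvd int q ^ 2 * b" using rp by (metis dvd_mult2 int_dvd_int_iff)
  moreover have "coprime r q" using pq(1) rp by (metis coprime_divisors dvd_refl)
  then have "coprime (int r) (int q ^ 2)" by simp
  ultimately show False using b(2) by (simp add: coprime_dvd_mult_right_iff)
qed

lemma N_dvd_q: "N dvd q"
proof (rule multiplicity_le_imp_dvd)
  show "N \<noteq> 0" using N by simp
  fix r :: nat
  assume r: "prime r"
  show "multiplicity r N \<le> multiplicity r q"
  proof (rule ccontr)
    assume neg: "\<not> ?thesis"
    define e V where "e = multiplicity r N" and "V = multiplicity r q"
    have Ve: "V < e" using neg by (simp add: e_def V_def)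
    have ru: "\<not> is_unit r" using r not_prime_unit by blast
    obtain N' where N': "N = r ^ e * N'" "\<not> r dvd N'"
      unfolding e_def by (rule multiplicity_decompose'[of N r]) (use N ru in auto)
    obtain q' where q': "q = r ^ V * q'" "\<not> r dvd q'"
      unfolding V_def by (rule multiplicity_decompose'[of q r]) (use pq ru in auto)
    have "r dvd N" using N' Ve by (cases e) auto
    then have rp: "\<not> r dvd p" using prime_factor_N_not_dvd_p r by blast
    \<comment> \<open>The exponent is such that \<open>B\<close> and the power \<open>r ^ V\<close>
      in \<open>q\<close> together give \<open>r ^ (e - 1)\<close>, one factor short of the power of
      \<open>r\<close> in \<open>N\<close>; hence \<open>c\<close> is not divisible by
      \<open>N\<close>.\<close>
    define B where "B = r ^ (e - 1 - V)"
    have re: "r ^ e = r ^ V * r * B" "r ^ (e - 1) = r ^ V * B"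
      using Ve by (simp_all add: B_def flip: power_add power_Suc2 power_Suc)
    have fac: "N = (N' * r ^ V) * r * B" unfolding N' re by (simp add: mult_ac)
    obtain s t b where st: "s \<in> \<Lambda>" "t \<in> \<Lambda>" "s \<noteq> t"
      and b: "real (N' * r ^ V * r) * real p ^ 2 * (s - t) = real q ^ 2 * of_int b" "\<not> int r dvd b"
      and nz: "\<And>j. 1 \<le> j \<Longrightarrow> j < 2 \<Longrightarrow> mask N (\<rho> ^ j * (s - t)) \<noteq> 0"
      by (rule essential_prime_level[OF _ fac, of 2]) (use prime_ge_2_nat[OF r] in auto)
    obtain y :: int where y: "real N * real p * (s - t) = of_int y" using shallow_differences[OF st(1,2)] .
    have "real p * (real N * real p * (s - t)) = real B * (real (N' * r ^ V * r) * real p ^ 2 * (s - t))"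
      by (subst fac) (simp add: power2_eq_square mult_ac)
    then have "real_of_int (int p * y) = of_int (int q ^ 2 * int B * b)"
      unfolding y b(1) by (simp add: mult_ac)
    then have "int p * y = (int q ^ 2 * int B) * b" by (simp only: of_int_eq_iff)
    then have "int p dvd (int q ^ 2 * int B) * b" by (metis dvd_triv_left)
    moreover have "coprime (int p) (int q ^ 2 * int B)"
    proof -
      have "coprime p r" using rp r by (metis coprime_commute prime_imp_coprime)
      then show ?thesis using pq(1) by (simp add: B_def)
    qed
    ultimately have "int p dvd b" by (simp only: coprime_dvd_mult_right_iff)
    then obtain b' where b': "b = int p * b'" by blast
    define c where "c = int r ^ (e - 1) * (int q' * b')"
    have "real N * (real p * (s - t)) * real p = real q * of_int (c * int p)"
    proof -
      have "real N * (real p * (s - t)) * real p = real B * (real (N' * r ^ V * r) * real p ^ 2 * (s - t))"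
        by (subst fac) (simp add: power2_eq_square mult_ac)
      also have "\<dots> = real q * of_int (int B * int q * b)" unfolding b(1) by (simp add: power2_eq_square mult_ac)
      also have "int B * int q * b = c * int p"
      proof -
        have "int r ^ (e - 1) = int r ^ V * int B" using re(2) by (metis of_nat_mult of_nat_power)
        moreover have "int q = int r ^ V * int q'" using q'(1) by (metis of_nat_mult of_nat_power)
        ultimately show ?thesis unfolding c_def b' by (simp add: mult_ac)
      qed
      finally show ?thesis .
    qed
    then have "real N * (real p * (s - t)) = real q * of_int c" using pq by (simp add: mult_ac)
    then have "real N * (\<rho> ^ 1 * (s - t)) = of_int c"
      using pq by (simp add: rho_eq field_simps)
    moreover have "\<not> int N dvd c"
    proof
      assume "int N dvd c"
      then have "int r ^ e dvd c" using N'(1) by (metis dvd_trans dvd_triv_left of_nat_mult of_nat_power)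
      moreover have "int r ^ e = int r ^ (e - 1) * int r" using Ve by (simp flip: power_Suc2)
      ultimately have "int r dvd int q' * b'" unfolding c_def using r by (simp add: prime_gt_0_nat)
      then have "int r dvd int q' \<or> int r dvd b'" using r by (simp add: prime_dvd_mult_iff)
      then show False using q'(2) b(2) b' by auto
    qed
    ultimately have "mask N (\<rho> ^ 1 * (s - t)) = 0" using N mask_eq_0_iff[of N] by blast
    then show False using nz[of 1] by simp
  qed
qed

end

section \<open>Logarithmic decay of the transform\<close>

lemma power_bracket:
  fixes b y :: real
  assumes "b > 1" "y \<ge> 1"
  obtains n where "b ^ n \<le> y" "y < b ^ Suc n"
proof -
  define n where "n = (LEAST n. y < b ^ n)"
  have "\<exists>n. y < b ^ n" using assms(1) by (rule real_arch_pow)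
  then have n: "y < b ^ n" unfolding n_def by (rule LeastI_ex)
  then have "n \<noteq> 0" using assms by (cases n) auto
  then obtain m where m: "n = Suc m" using not0_implies_Suc by blast
  then have "\<not> y < b ^ m" using not_less_Least[of m "\<lambda>n. y < b ^ n"] unfolding n_def by simp
  then show ?thesis using that[of m] n m by simp
qed

lemma abs_cos_pi_le:
  assumes d: "0 \<le> d" "d \<le> 1 / 2" and far: "d \<le> \<bar>y - of_int (round y)\<bar>"
  shows "\<bar>cos (pi * y)\<bar> \<le> cos (pi * d)"
proof -
  define f where "f = \<bar>y - of_int (round y)\<bar>"
  have f: "d \<le> f" "f \<le> 1 / 2" using far of_int_round_abs_le[of y] by (simp_all add: f_def abs_minus_commute)
  have "\<bar>cos (pi * y)\<bar> = \<bar>cos (pi * (y - of_int (round y)))\<bar>"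
  proof -
    have "cos (pi * (y - of_int (round y))) = cos (pi * y) * cos (pi * of_int (round y))
       + sin (pi * y) * sin (pi * of_int (round y))"
      by (simp add: right_diff_distrib cos_diff)
    moreover have "sin (pi * of_int (round y)) = 0" by (simp add: sin_zero_iff_int2 mult.commute)
    moreover from this have "\<bar>cos (pi * of_int (round y))\<bar> = 1"
      using sin_zero_abs_cos_one by blast
    ultimately show ?thesis by (simp add: abs_mult)
  qed
  also have "\<dots> = \<bar>cos (pi * f)\<bar>"
  proof -
    have "pi * f = \<bar>pi * (y - of_int (round y))\<bar>" by (simp only: f_def abs_mult abs_of_pos[OF pi_gt_zero])
    then show ?thesis by (simp only: cos_abs_real)
  qed
  also have "\<dots> = cos (pi * f)"
  proof (intro abs_of_nonneg cos_ge_zero)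
    have "0 \<le> pi * f" using f d by simp
    then show "- (pi / 2) \<le> pi * f" using pi_gt_zero by linarith
  qed (use f in simp)
  also have "\<dots> \<le> cos (pi * d)"
    using f d by (intro cos_monotone_0_pi_le mult_left_mono) auto
  finally show ?thesis .
qed

locale rational_bernoulli = bernoulli +
  fixes p q :: nat
  assumes pq: "coprime p q" "p \<ge> 2" and rho_eq: "\<rho> = real p / real q"
begin

lemma q_pos: "q > 0"
  using rho rho_eq by (intro Nat.gr0I) auto

lemma p_less_q: "p < q"
  using rho rho_eq q_pos by (simp add: divide_simps)

text \<open>An argument of size \<open>q ^ n\<close> is scaled by \<open>\<rho> ^ n\<close> to size
  \<open>p ^ n\<close>, its \<kappa>-th power. One round of the decay estimate thus maps
  \<open>\<bar>x\<bar>\<close> to about \<open>\<bar>x\<bar> powr \<kappa>\<close>, and the number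
  of rounds is a double logarithm.\<close>

definition \<kappa> :: real where "\<kappa> = log q p"

lemma kappa: "0 < \<kappa>" "\<kappa> < 1"
  using pq p_less_q by (simp_all add: \<kappa>_def)

lemma p_power: "real p ^ n = (real q ^ n) powr \<kappa>"
proof -
  have "real p = real q powr \<kappa>" using pq p_less_q by (simp add: \<kappa>_def)
  then show ?thesis using q_pos by (simp add: powr_power powr_powr mult.commute flip: powr_realpow)
qed

text \<open>Chosen so that \<open>(p + q) * \<delta> = 1 / 2\<close>: if two successive arguments
  are within \<delta> of integers \<open>n j\<close> and \<open>n (Suc j)\<close>, then the integer
  \<open>q * n (Suc j) - p * n j\<close> has modulus below 1.\<close>

definition \<delta> :: real where "\<delta> = 1 / (2 * (real p + real q))"

definition \<eta> :: real where "\<eta> = (real N - 2 + 2 * cos (pi * \<delta>)) / real N"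

lemma delta: "0 < \<delta>" "\<delta> < 1 / 2"
  using pq p_less_q by (simp_all add: \<delta>_def divide_simps)

lemma eta: "0 < \<eta>" "\<eta> < 1"
proof -
  have "cos (pi * \<delta>) > 0" using delta by (intro cos_gt_zero) (auto simp: field_simps)
  moreover have "cos (pi * \<delta>) < 1"
    using delta cos_monotone_0_pi[of 0 "pi * \<delta>"] by auto
  ultimately show "0 < \<eta>" "\<eta> < 1" using N by (simp_all add: \<eta>_def divide_simps)
qed

lemma norm_mask_le_eta:
  assumes "\<delta> \<le> \<bar>y - of_int (round y)\<bar>"
  shows "norm (mask N y) \<le> \<eta>"
proof -
  have "norm (mask N y) \<le> (real N - 2 + 2 * \<bar>cos (pi * y)\<bar>) / real N"
    using N by (intro norm_mask_le) simp
  also have "\<dots> \<le> \<eta>"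
    unfolding \<eta>_def using abs_cos_pi_le[of \<delta> y] assms delta by (intro divide_right_mono) auto
  finally show ?thesis .
qed

text \<open>If \<open>\<rho>\<^sup>j x\<close> is close to an integer for \<open>1 \<le> j \<le> J + 1\<close>, then these integers form a geometric
  progression of ratio \<open>p / q\<close>, so the first one is divisible by \<open>q\<^sup>J\<close>.\<close>

lemma far_from_integers:
  assumes x: "1 \<le> \<bar>\<rho> * x\<bar>" and J: "2 * \<bar>x\<bar> < real q ^ J"
  obtains j where "1 \<le> j" "j \<le> Suc J" "\<delta> \<le> \<bar>\<rho> ^ j * x - of_int (round (\<rho> ^ j * x))\<bar>"
proof (rule ccontr)
  assume nt: "\<not> thesis"
  define n where "n j = round (\<rho> ^ j * x)" for j
  have close: "\<bar>\<rho> ^ j * x - of_int (n j)\<bar> < \<delta>" if "1 \<le> j" "j \<le> Suc J" for j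
    using nt \<open>\<And>j. \<lbrakk>1 \<le> j; j \<le> Suc J; \<delta> \<le> \<bar>\<rho> ^ j * x - of_int (round (\<rho> ^ j * x))\<bar>\<rbrakk> \<Longrightarrow> thesis\<close>[OF that]
    unfolding n_def by force
  have step: "int q * n (Suc j) = int p * n j" if j: "1 \<le> j" "j \<le> J" for j
  proof -
    have "real q * (\<rho> ^ Suc j * x) = real p * (\<rho> ^ j * x)"
      using q_pos by (simp add: rho_eq)
    then have "of_int (int q * n (Suc j) - int p * n j)
        = real p * (\<rho> ^ j * x - of_int (n j)) - real q * (\<rho> ^ Suc j * x - of_int (n (Suc j)))"
      by (simp only: right_diff_distrib of_int_diff of_int_mult of_int_of_nat_eq)
    then have "\<bar>of_int (int q * n (Suc j) - int p * n j)\<bar>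
        \<le> real p * \<bar>\<rho> ^ j * x - of_int (n j)\<bar> + real q * \<bar>\<rho> ^ Suc j * x - of_int (n (Suc j))\<bar>"
      using abs_triangle_ineq4[of "real p * (\<rho> ^ j * x - of_int (n j))" "real q * (\<rho> ^ Suc j * x - of_int (n (Suc j)))"]
      by (simp only: abs_mult abs_of_nat)
    also have "\<dots> \<le> real p * \<delta> + real q * \<delta>"
      using close[of j] close[of "Suc j"] j by (intro add_mono mult_left_mono) auto
    also have "\<dots> = 1 / 2" using pq by (simp add: \<delta>_def divide_simps)
    finally have "\<bar>real_of_int (int q * n (Suc j) - int p * n j)\<bar> < 1" by simp
    then have "\<bar>int q * n (Suc j) - int p * n j\<bar> < 1" by linarith
    then show ?thesis by simp
  qed
  have "int q ^ i * n (Suc i) = int p ^ i * n 1" if "i \<le> J" for i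
    using that
  proof (induction i)
    case (Suc i)
    then have "int q ^ Suc i * n (Suc (Suc i)) = int q ^ i * (int q * n (Suc (Suc i)))" by simp
    also have "\<dots> = int p * (int q ^ i * n (Suc i))" using step[of "Suc i"] Suc.prems by simp
    also have "\<dots> = int p ^ Suc i * n 1" using Suc by simp
    finally show ?case .
  qed simp
  then have "int q ^ J dvd int p ^ J * n 1" by (metis dvd_triv_left order_refl)
  moreover have "coprime (int q ^ J) (int p ^ J)" using pq(1) by (simp add: coprime_commute)
  ultimately have dv: "int q ^ J dvd n 1" by (simp only: coprime_dvd_mult_right_iff)
  have c1: "\<bar>\<rho> * x - of_int (n 1)\<bar> < 1" using close[of 1] delta by simp
  have "n 1 \<noteq> 0"
  proof
    assume "n 1 = 0"
    then show False using c1 x by simp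
  qed
  then have "\<bar>int q ^ J\<bar> \<le> \<bar>n 1\<bar>" using dv by (rule dvd_imp_le_int)
  then have "real_of_int \<bar>int q ^ J\<bar> \<le> real_of_int \<bar>n 1\<bar>" by (simp only: of_int_le_iff)
  then have "real q ^ J \<le> \<bar>real_of_int (n 1)\<bar>" by simp
  also have "\<dots> \<le> \<bar>\<rho> * x\<bar> + 1" using c1 by linarith
  also have "\<dots> \<le> 2 * \<bar>\<rho> * x\<bar>" using x by simp
  also have "\<dots> \<le> 2 * \<bar>x\<bar>" using rho by (simp add: abs_mult mult_left_le_one_le)
  finally show False using J by simp
qed

text \<open>One of the first \<open>J + 2\<close> arguments is far from the integers and contributes
  a factor \<eta>, where \<open>q ^ J\<close> is comparable to \<open>\<bar>x\<bar>\<close>. The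
  argument left over is at least \<open>\<rho> ^ (J + 2) * \<bar>x\<bar>\<close>, which is of the
  order of \<open>\<bar>x\<bar> powr \<kappa>\<close>.\<close>

lemma decay_step:
  assumes x: "real q \<le> \<bar>x\<bar>"
  obtains y where "norm (F x) \<le> \<eta> * norm (F y)" "\<bar>x\<bar> powr \<kappa> / (2 * real q ^ 2) \<le> \<bar>y\<bar>"
proof -
  have q: "real q > 1" using pq p_less_q by simp
  have "real p \<le> \<rho> * \<bar>x\<bar> \<and> 1 \<le> real p"
    using x q pq mult_left_mono[OF x, of \<rho>] rho by (simp add: rho_eq)
  then have x1: "1 \<le> \<bar>\<rho> * x\<bar>" using rho by (simp add: abs_mult)
  obtain J where J: "real q ^ J \<le> 2 * \<bar>x\<bar>" "2 * \<bar>x\<bar> < real q ^ Suc J"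
    by (rule power_bracket[of "real q" "2 * \<bar>x\<bar>"]) (use q x in auto)
  obtain j where j: "1 \<le> j" "j \<le> Suc (Suc J)" "\<delta> \<le> \<bar>\<rho> ^ j * x - of_int (round (\<rho> ^ j * x))\<bar>"
    using far_from_integers[OF x1 J(2)] by blast
  have "norm (P j x) \<le> \<eta>"
  proof -
    have "P j x = P (j - 1) x * mask N (\<rho> ^ j * x)" using P_Suc[of "j - 1" x] j(1) by simp
    then have "norm (P j x) = norm (P (j - 1) x) * norm (mask N (\<rho> ^ j * x))" by (simp only: norm_mult)
    also have "\<dots> \<le> 1 * \<eta>" using norm_P_le_1 norm_mask_le_eta[OF j(3)] by (intro mult_mono) auto
    finally have "norm (P j x) \<le> 1 * \<eta>" .
    then show ?thesis by simp
  qed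
  then have 1: "norm (F x) \<le> \<eta> * norm (F (\<rho> ^ j * x))"
    by (subst F_eq_P[of x j]) (simp add: norm_mult mult_right_mono)
  have "\<bar>x\<bar> powr \<kappa> \<le> (real q ^ (J + 2)) powr \<kappa>"
  proof (rule powr_mono2)
    have "real q ^ Suc J \<le> real q ^ (J + 2)" using q by (intro power_increasing) auto
    then show "\<bar>x\<bar> \<le> real q ^ (J + 2)" using J(2) by linarith
  qed (use kappa in auto)
  also have "\<dots> = real p ^ (J + 2)" by (simp only: p_power)
  finally have pp: "\<bar>x\<bar> powr \<kappa> \<le> real p ^ (J + 2)" .
  have "\<bar>x\<bar> powr \<kappa> / (2 * real q ^ 2) \<le> real p ^ (J + 2) / (2 * real q ^ 2)"
    using pp by (rule divide_right_mono) simp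
  also have "\<dots> = (real p ^ (J + 2) / real q ^ (J + 2)) * (real q ^ J / 2)"
    using q by (simp add: power_add field_simps power2_eq_square)
  also have "\<dots> \<le> (real p ^ (J + 2) / real q ^ (J + 2)) * \<bar>x\<bar>"
    using J(1) by (intro mult_left_mono) auto
  also have "\<dots> = \<rho> ^ (J + 2) * \<bar>x\<bar>" by (simp add: rho_eq power_divide)
  also have "\<dots> \<le> \<rho> ^ j * \<bar>x\<bar>"
    using rho j(2) by (intro mult_right_mono power_decreasing) auto
  also have "\<dots> = \<bar>\<rho> ^ j * x\<bar>" using rho by (simp add: abs_mult)
  finally show ?thesis using 1 that by blast
qed

text \<open>Half of the exponent \<kappa> is given up to absorb the constant of
  \<open>decay_step\<close>: \<open>A\<close> is such that
  \<open>exp A powr (\<kappa> / 2) = 2 * q ^ 2\<close>. A round then multiplies the logarithm of the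
  argument by at least \<open>\<kappa> / 2 = 1 / B\<close>.\<close>

lemma decay_iterated:
  obtains A B where "A > 0" "B > 1" "\<And>n x. exp (A * B ^ n) \<le> \<bar>x\<bar> \<Longrightarrow> norm (F x) \<le> \<eta> ^ n"
proof -
  have q: "real q > 1" using pq p_less_q by simp
  define A where "A = ln (2 * real q ^ 2) * (2 / \<kappa>)"
  define B where "B = 2 / \<kappa>"
  have B: "B > 1" using kappa by (simp add: B_def divide_simps)
  have lq: "ln (2 * real q ^ 2) \<ge> ln (real q)" "ln (real q) > 0"
  proof -
    have "real q * 1 \<le> real q * (2 * real q)" using q by (intro mult_left_mono) auto
    then show "ln (2 * real q ^ 2) \<ge> ln (real q)" using q by (intro ln_mono) (auto simp: power2_eq_square)
  qed (use q in simp)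
  have A: "A \<ge> ln (real q)"
  proof -
    have "ln (real q) * 1 \<le> ln (2 * real q ^ 2) * B" using lq B by (intro mult_mono) auto
    then show ?thesis by (simp add: A_def B_def)
  qed
  have A0: "A > 0" using A lq by linarith
  have "norm (F x) \<le> \<eta> ^ n" if "exp (A * B ^ n) \<le> \<bar>x\<bar>" for n x
    using that
  proof (induction n arbitrary: x)
    case 0
    then show ?case by (simp add: norm_ft_le_1)
  next
    case (Suc n)
    have B1: "B ^ Suc n \<ge> 1" using B by (intro one_le_power) simp
    have "exp A \<le> exp (A * B ^ Suc n)" using A0 B1 by simp
    then have xA: "exp A \<le> \<bar>x\<bar>" using Suc.prems by linarith
    then have x0: "\<bar>x\<bar> > 0" using exp_gt_zero[of A] by linarith
    have "real q \<le> exp A" using A q by (metis exp_le_cancel_iff exp_ln less_trans zero_less_one)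
    then have "real q \<le> \<bar>x\<bar>" using xA by linarith
    then obtain y where y: "norm (F x) \<le> \<eta> * norm (F y)" "\<bar>x\<bar> powr \<kappa> / (2 * real q ^ 2) \<le> \<bar>y\<bar>"
      by (rule decay_step)
    have "2 * real q ^ 2 = exp A powr (\<kappa> / 2)"
      using kappa q by (simp add: A_def powr_def)
    also have "\<dots> \<le> \<bar>x\<bar> powr (\<kappa> / 2)" using xA kappa by (intro powr_mono2) auto
    finally have h: "2 * real q ^ 2 \<le> \<bar>x\<bar> powr (\<kappa> / 2)" .
    have "exp (A * B ^ n) = exp (A * B ^ Suc n) powr (\<kappa> / 2)"
      using kappa by (simp add: powr_def B_def)
    also have "\<dots> \<le> \<bar>x\<bar> powr (\<kappa> / 2)" using Suc.prems kappa by (intro powr_mono2) auto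
    also have "\<dots> = \<bar>x\<bar> powr (\<kappa> / 2) * (2 * real q ^ 2) / (2 * real q ^ 2)" using q by simp
    also have "\<dots> \<le> \<bar>x\<bar> powr (\<kappa> / 2) * \<bar>x\<bar> powr (\<kappa> / 2) / (2 * real q ^ 2)"
      using h by (intro divide_right_mono mult_left_mono) auto
    also have "\<dots> = \<bar>x\<bar> powr \<kappa> / (2 * real q ^ 2)" by (simp flip: powr_add)
    finally have "exp (A * B ^ n) \<le> \<bar>y\<bar>" using y(2) by linarith
    then have "norm (F y) \<le> \<eta> ^ n" by (rule Suc.IH)
    then have "\<eta> * norm (F y) \<le> \<eta> * \<eta> ^ n" using eta by (intro mult_left_mono) auto
    then show ?case using y(1) by simp
  qed
  with A0 B show ?thesis by (rule that)
qed

text \<open>With \<open>A * B ^ n\<close> comparable to \<open>u\<close>, the number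
  \<open>\<eta> ^ n\<close> is a fixed negative power of \<open>B ^ n\<close>, hence up to a
  constant of \<open>u\<close>; \<open>C\<close> pays for rounding \<open>n\<close> to an
  integer.\<close>

lemma logarithmic_decay:
  obtains A C \<gamma> where "A > 0" "C > 0" "\<gamma> > 0"
    "\<And>x u. A \<le> u \<Longrightarrow> exp u \<le> \<bar>x\<bar> \<Longrightarrow> (norm (F x))\<^sup>2 \<le> C * u powr (- \<gamma>)"
proof -
  obtain A B where AB: "A > 0" "B > 1" and dec: "\<And>n x. exp (A * B ^ n) \<le> \<bar>x\<bar> \<Longrightarrow> norm (F x) \<le> \<eta> ^ n"
    by (rule decay_iterated) blast
  define \<beta> where "\<beta> = - log B \<eta>"
  have \<beta>: "\<beta> > 0" using eta AB by (simp add: \<beta>_def)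
  have \<eta>B: "\<eta> = B powr (- \<beta>)" using AB eta by (simp add: \<beta>_def)
  define C where "C = (A * B) powr (2 * \<beta>)"
  have "(norm (F x))\<^sup>2 \<le> C * u powr (- (2 * \<beta>))" if u: "A \<le> u" "exp u \<le> \<bar>x\<bar>" for x u
  proof -
    have u0: "u > 0" using u AB by simp
    obtain n where n: "B ^ n \<le> u / A" "u / A < B ^ Suc n"
      by (rule power_bracket[of B "u / A"]) (use AB u in auto)
    have "A * B ^ n \<le> u" using n(1) AB by (simp add: field_simps)
    then have "exp (A * B ^ n) \<le> \<bar>x\<bar>" using u(2) by (meson exp_le_cancel_iff order_trans)
    then have "norm (F x) \<le> \<eta> ^ n" by (rule dec)
    then have "(norm (F x))\<^sup>2 \<le> (\<eta> ^ n)\<^sup>2" by (intro power_mono) auto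
    also have "\<dots> = (B ^ n) powr (- (2 * \<beta>))"
    proof -
      have "(\<eta> ^ n)\<^sup>2 = \<eta> ^ (n * 2)" by (simp only: power_mult)
      also have "\<dots> = \<eta> powr (real n * 2)" using eta powr_realpow[of \<eta> "n * 2"] by simp
      also have "\<dots> = (B powr real n) powr (- (2 * \<beta>))" unfolding \<eta>B by (simp add: powr_powr mult_ac)
      finally show ?thesis using AB by (simp add: powr_realpow)
    qed
    also have "\<dots> \<le> (u / (A * B)) powr (- (2 * \<beta>))"
    proof (rule powr_mono2')
      show "u / (A * B) \<le> B ^ n" using n(2) AB by (simp add: field_simps)
      show "0 < u / (A * B)" using u0 AB by simp
    qed (use \<beta> in simp)
    also have "\<dots> = C * u powr (- (2 * \<beta>))"
      using u0 AB by (simp add: C_def powr_divide powr_minus divide_simps)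
    finally show ?thesis .
  qed
  moreover have "C > 0" "2 * \<beta> > 0" using AB \<beta> by (auto simp: C_def)
  ultimately show ?thesis using that AB(1) by blast
qed

end

section \<open>Failure of completeness for p greater than 1\<close>

context rational_spectrum
begin

text \<open>The integer \<open>N * p * (s - t)\<close> is divisible by \<open>q ^ k\<close> for the
  level \<open>k\<close> of the difference, so a small difference has a level at most
  \<open>n\<close>.\<close>

lemma P_difference_eq_0:
  assumes st: "s \<in> \<Lambda>" "t \<in> \<Lambda>" "s \<noteq> t" and near: "real N * real p * \<bar>s - t\<bar> < real q ^ Suc n"
  shows "P n (s - t) = 0"
proof -
  obtain k and a :: int where k: "k \<ge> 1" and ka: "real N * real p ^ k * (s - t) = real q ^ k * of_int a" "\<not> int N dvd a"
    by (rule rational_level[OF st])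
  obtain y :: int where y: "real N * real p * (s - t) = of_int y" by (rule shallow_differences[OF st(1,2)])
  have "real p ^ (k - 1) * (real N * real p * (s - t)) = real N * real p ^ k * (s - t)"
    using k by (cases k) (auto simp: mult_ac)
  then have "real_of_int (int p ^ (k - 1) * y) = of_int (int q ^ k * a)" unfolding y ka(1) by simp
  then have "int p ^ (k - 1) * y = int q ^ k * a" by (simp only: of_int_eq_iff)
  then have "int q ^ k dvd int p ^ (k - 1) * y" by simp
  moreover have "coprime (int q ^ k) (int p ^ (k - 1))" using pq(1) by (simp add: coprime_commute)
  ultimately have dv: "int q ^ k dvd y" by (simp only: coprime_dvd_mult_right_iff)
  have "y \<noteq> 0" using y st(3) N pq by auto
  then have "\<bar>int q ^ k\<bar> \<le> \<bar>y\<bar>" using dv by (rule dvd_imp_le_int)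
  then have "real_of_int \<bar>int q ^ k\<bar> \<le> real_of_int \<bar>y\<bar>" by (simp only: of_int_le_iff)
  then have "real q ^ k \<le> \<bar>real_of_int y\<bar>" by simp
  also have "\<dots> = real N * real p * \<bar>s - t\<bar>" unfolding y[symmetric] by (simp add: abs_mult)
  finally have "real q ^ k < real q ^ Suc n" using near by simp
  then have "k < Suc n" using p_less_q pq by (intro power_less_imp_less_exp[of "real q"]) auto
  moreover have "mask N (\<rho> ^ k * (s - t)) = 0"
  proof -
    have "real N * (\<rho> ^ k * (s - t)) = of_int a"
      using ka(1) pq by (simp add: rho_eq power_divide field_simps)
    then show ?thesis using ka(2) N mask_eq_0_iff[of N] by blast
  qed
  ultimately show ?thesis unfolding P_def using k by (intro prod_zero) auto
qed

lemma finite_spectrum_ball: "finite {s \<in> \<Lambda>. \<bar>s\<bar> \<le> R}"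
proof (cases "{s \<in> \<Lambda>. \<bar>s\<bar> \<le> R} = {}")
  case False
  then obtain s0 where s0: "s0 \<in> \<Lambda>" "\<bar>s0\<bar> \<le> R" by blast
  define B where "B = real N * real p * (2 * R)"
  define g where "g s = real N * real p * (s - s0)" for s
  have "g s \<in> of_int ` {- \<lceil>B\<rceil>..\<lceil>B\<rceil>}" if s: "s \<in> \<Lambda>" "\<bar>s\<bar> \<le> R" for s
  proof -
    obtain y :: int where y: "g s = of_int y" unfolding g_def by (rule shallow_differences[OF s(1) s0(1)])
    have "\<bar>g s\<bar> \<le> B"
      unfolding g_def B_def abs_mult using s s0 by (intro mult_mono) auto
    then have "- \<lceil>B\<rceil> \<le> y" "y \<le> \<lceil>B\<rceil>" unfolding y by linarith+
    then show ?thesis using y by auto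
  qed
  then have "g ` {s \<in> \<Lambda>. \<bar>s\<bar> \<le> R} \<subseteq> of_int ` {- \<lceil>B\<rceil>..\<lceil>B\<rceil>}" by blast
  then have "finite (g ` {s \<in> \<Lambda>. \<bar>s\<bar> \<le> R})" by (rule finite_subset) simp
  moreover have "inj_on g {s \<in> \<Lambda>. \<bar>s\<bar> \<le> R}" using N pq by (auto simp: inj_on_def g_def)
  ultimately show ?thesis by (rule finite_imageD)
next
  case True
  then show ?thesis by (simp only: finite.emptyI)
qed

lemma P_bessel:
  assumes S: "finite S" "S \<subseteq> \<Lambda>" and R: "\<And>s. s \<in> S \<Longrightarrow> \<bar>s\<bar> \<le> R" and n: "2 * real N * real p * R < real q ^ Suc n"
  shows "(\<Sum>s\<in>S. (norm (P n (x + s)))\<^sup>2) \<le> 1"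
proof (rule bessel[OF fourier_transform_P S(1)])
  fix s t assume st: "s \<in> S" "t \<in> S" "s \<noteq> t"
  have "\<bar>s - t\<bar> \<le> 2 * R" using R[OF st(1)] R[OF st(2)] by linarith
  then have "real N * real p * \<bar>s - t\<bar> \<le> real N * real p * (2 * R)" by (intro mult_left_mono) auto
  also have "\<dots> < real q ^ Suc n" using n by (simp add: mult_ac)
  finally show "P n (s - t) = 0" using st S by (intro P_difference_eq_0) auto
qed

end

text \<open>A product of factors \<open>1 - \<epsilon> i\<close> is at least 1 minus the sum of the
  \<open>\<epsilon> i\<close>. The bound \<open>e1\<close> keeps the factors nonnegative, as
  multiplying the induction hypothesis requires.\<close>

lemma defect_persists:
  fixes D :: "nat \<Rightarrow> real"
  assumes D: "0 < D m" and step: "\<And>i. i \<ge> m \<Longrightarrow> (1 - \<epsilon> i) * D i \<le> D (Suc i)"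
    and eps: "\<And>i. i \<ge> m \<Longrightarrow> 0 \<le> \<epsilon> i" and sum: "\<And>n. (\<Sum>j<n. \<epsilon> (m + j)) \<le> 1 / 2"
  shows "D m / 2 \<le> D (m + n)"
proof -
  have e1: "\<epsilon> (m + n) \<le> 1" for n
  proof -
    have "\<epsilon> (m + n) \<le> (\<Sum>j<Suc n. \<epsilon> (m + j))" using eps by (simp add: sum_nonneg)
    then show ?thesis using sum[of "Suc n"] by simp
  qed
  have low: "D m * (1 - (\<Sum>j<n. \<epsilon> (m + j))) \<le> D (m + n)" for n
  proof (induction n)
    case (Suc n)
    let ?S = "\<Sum>j<n. \<epsilon> (m + j)"
    have "0 \<le> \<epsilon> (m + n) * ?S" using eps by (simp add: sum_nonneg)
    then have "1 - (?S + \<epsilon> (m + n)) \<le> (1 - \<epsilon> (m + n)) * (1 - ?S)" by (simp add: algebra_simps)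
    then have "D m * (1 - (?S + \<epsilon> (m + n))) \<le> D m * ((1 - \<epsilon> (m + n)) * (1 - ?S))"
      using D by (intro mult_left_mono) auto
    also have "\<dots> = (1 - \<epsilon> (m + n)) * (D m * (1 - ?S))" by simp
    also have "\<dots> \<le> (1 - \<epsilon> (m + n)) * D (m + n)" using Suc e1 by (intro mult_left_mono) auto
    also have "\<dots> \<le> D (m + Suc n)" using step[of "m + n"] by simp
    finally show ?case by simp
  qed simp
  have "D m * (1 / 2) \<le> D m * (1 - (\<Sum>j<n. \<epsilon> (m + j)))"
    using D sum[of n] by (intro mult_left_mono) auto
  then show ?thesis using low[of n] by simp
qed

text \<open>Let \<open>D i\<close> be the part of Parseval's sum not yet captured by the frequencies of modulus at most
  \<open>R i = exp (\<tau> ^ i)\<close>. Bessel's inequality for \<open>P (m (Suc i))\<close>, where \<open>q ^ m (Suc i)\<close> is comparable to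
  \<open>R (Suc i)\<close>, and the decay of the remaining factor of \<open>F\<close> show that the next shell captures only a
  fraction \<open>\<epsilon> i\<close> of \<open>D i\<close>. As \<open>\<epsilon>\<close> is summable, a positive part is never captured.\<close>

lemma (in rational_spectrum) p_eq_1: "p = 1"
proof (rule ccontr)
  assume "p \<noteq> 1"
  then interpret rational_bernoulli \<rho> N p q
    by unfold_locales (use pq rho_eq in auto)
  have q: "real q > 1" using p_less_q pq by simp
  obtain A C \<gamma> where AC: "A > 0" "C > 0" "\<gamma> > 0"
    and decay: "\<And>x u. A \<le> u \<Longrightarrow> exp u \<le> \<bar>x\<bar> \<Longrightarrow> (norm (F x))\<^sup>2 \<le> C * u powr (- \<gamma>)"
    by (rule logarithmic_decay) blast
  \<comment> \<open>Any value strictly between 1 and \<open>1 / (1 - \<kappa>)\<close> would serve.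
    After \<open>m (Suc i)\<close> factors an argument of size \<open>R i\<close> is of the order
    \<open>R i * R (Suc i) powr (\<kappa> - 1) = exp (c * \<tau> ^ i)\<close>, which is still
    large.\<close>
  define \<tau> where "\<tau> = 2 / (2 - \<kappa>)"
  define c where "c = \<kappa> / (2 - \<kappa>)"
  have tau: "\<tau> > 1" "c > 0" "1 - (1 - \<kappa>) * \<tau> = c"
    using kappa by (simp_all add: \<tau>_def c_def divide_simps)
  define R where "R i = exp (\<tau> ^ i)" for i :: nat
  have R2: "R i > 2" for i
  proof -
    have 1: "1 \<le> \<tau> ^ i" using tau by (intro one_le_power) simp
    then have "1 + \<tau> ^ i + (\<tau> ^ i)\<^sup>2 / 2 \<le> R i" unfolding R_def by (intro exp_lower_Taylor_quadratic) simp
    moreover have "(\<tau> ^ i)\<^sup>2 > 0" using tau by simp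
    ultimately show ?thesis using 1 by linarith
  qed
  define NP where "NP = real N * real p"
  have NP: "NP \<ge> 1" using N pq mult_mono[of 1 "real N" 1 "real p"] by (simp add: NP_def)
  have "\<exists>m. real q ^ m \<le> 2 * NP * R i \<and> 2 * NP * R i < real q ^ Suc m" for i
  proof -
    have "1 * 1 \<le> (2 * NP) * R i" using NP R2[of i] by (intro mult_mono) auto
    then have "1 \<le> 2 * NP * R i" by simp
    then obtain m where "real q ^ m \<le> 2 * NP * R i" "2 * NP * R i < real q ^ Suc m"
      by (rule power_bracket[OF q])
    then show ?thesis by blast
  qed
  then obtain m where m: "\<And>i. real q ^ m i \<le> 2 * NP * R i" "\<And>i. 2 * NP * R i < real q ^ Suc (m i)"
    by metis
  define c0 where "c0 = (2 * NP / real q) powr \<kappa> / (4 * NP)"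
  have c0: "c0 > 0" using NP q by (simp add: c0_def)
  have tail: "c0 * exp (c * \<tau> ^ i) \<le> \<bar>\<rho> ^ m (Suc i) * (\<xi> + s)\<bar>"
    if \<xi>: "0 \<le> \<xi>" "\<xi> \<le> 1" and s: "R i < \<bar>s\<bar>" for \<xi> s i
  proof -
    define r where "r = R (Suc i)"
    have r: "r > 2" by (simp add: r_def R2)
    have "c0 * exp (c * \<tau> ^ i) = c0 * (r powr \<kappa> / r * R i)"
    proof -
      have e: "r powr \<kappa> / r = exp (\<kappa> * \<tau> ^ Suc i - \<tau> ^ Suc i)"
        by (simp add: r_def R_def powr_def exp_diff)
      have "c * \<tau> ^ i = (\<kappa> * \<tau> ^ Suc i - \<tau> ^ Suc i) + \<tau> ^ i"
        unfolding tau(3)[symmetric] by (simp add: algebra_simps)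
      then show ?thesis unfolding e by (simp only: R_def exp_add)
    qed
    also have "\<dots> = (2 * NP * r / real q) powr \<kappa> / (2 * NP * r) * (R i / 2)"
    proof -
      have "(2 * NP * r / real q) powr \<kappa> = (2 * NP / real q) powr \<kappa> * r powr \<kappa>"
        using NP q r by (subst powr_mult[symmetric]) auto
      then show ?thesis using NP r by (simp add: c0_def)
    qed
    also have "\<dots> \<le> real p ^ m (Suc i) / real q ^ m (Suc i) * (R i / 2)"
    proof (rule mult_right_mono[OF frac_le])
      show "(2 * NP * r / real q) powr \<kappa> \<le> real p ^ m (Suc i)"
        unfolding p_power using m(2)[of "Suc i"] q kappa NP r
        by (intro powr_mono2) (auto simp: r_def divide_simps mult_ac)
      show "real q ^ m (Suc i) \<le> 2 * NP * r" using m(1)[of "Suc i"] by (simp add: r_def)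
    qed (use q R2[of i] in auto)
    also have "\<dots> = \<rho> ^ m (Suc i) * (R i / 2)" by (simp add: rho_eq power_divide)
    also have "\<dots> \<le> \<rho> ^ m (Suc i) * \<bar>\<xi> + s\<bar>"
    proof (rule mult_left_mono)
      show "R i / 2 \<le> \<bar>\<xi> + s\<bar>" using \<xi> s R2[of i] by linarith
    qed (use rho in simp)
    also have "\<dots> = \<bar>\<rho> ^ m (Suc i) * (\<xi> + s)\<bar>" using rho by (simp add: abs_mult)
    finally show ?thesis .
  qed
  \<comment> \<open>Replacing \<open>c\<close> by \<open>c / 2\<close> absorbs the constant
    \<open>c0\<close> for large \<open>i\<close>. As \<open>\<tau> ^ i\<close> is the logarithm of
    the radius, the decay yields a geometric sequence.\<close>
  define \<epsilon> where "\<epsilon> i = C * (c / 2 * \<tau> ^ i) powr (- \<gamma>)" for i :: nat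
  have eps0: "0 \<le> \<epsilon> i" for i using AC by (simp add: \<epsilon>_def)
  have eps_geo: "\<epsilon> i = C * (c / 2) powr (- \<gamma>) * (\<tau> powr (- \<gamma>)) ^ i" for i
  proof -
    have "(c / 2 * \<tau> ^ i) powr (- \<gamma>) = (c / 2) powr (- \<gamma>) * (\<tau> ^ i) powr (- \<gamma>)"
      using tau by (subst powr_mult) auto
    also have "(\<tau> ^ i) powr (- \<gamma>) = (\<tau> powr (- \<gamma>)) ^ i"
      using tau by (simp add: powr_powr mult.commute flip: powr_realpow)
    finally show ?thesis by (simp add: \<epsilon>_def)
  qed
  have "\<tau> powr (- \<gamma>) < 1" using tau AC by (simp add: powr_less_one)
  then have summ: "summable \<epsilon>"
    unfolding eps_geo[abs_def] by (intro summable_mult summable_geometric) simp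
  have tau_lim: "LIM i sequentially. \<tau> ^ i :> at_top"
    using tau(1) by (intro filterlim_at_infinity_imp_filterlim_at_top filterlim_realpow_sequentially_gt1 always_eventually) auto
  then have "LIM i sequentially. c / 2 * \<tau> ^ i :> at_top"
    using tau by (intro filterlim_tendsto_pos_mult_at_top[OF tendsto_const]) auto
  then have "eventually (\<lambda>i. max A (- ln c0) \<le> c / 2 * \<tau> ^ i) sequentially"
    by (simp add: filterlim_at_top)
  moreover have "(\<lambda>i. \<Sum>j. \<epsilon> (j + i)) \<longlonglongrightarrow> 0" by (rule suminf_exist_split2[OF summ])
  then have "eventually (\<lambda>i. (\<Sum>j. \<epsilon> (j + i)) < 1 / 2) sequentially"
    by (rule order_tendstoD) simp
  ultimately have "eventually (\<lambda>i. max A (- ln c0) \<le> c / 2 * \<tau> ^ i \<and> (\<Sum>j. \<epsilon> (j + i)) < 1 / 2) sequentially"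
    by (rule eventually_conj)
  then obtain k where k: "max A (- ln c0) \<le> c / 2 * \<tau> ^ k" "(\<Sum>j. \<epsilon> (j + k)) < 1 / 2"
    by (auto simp: eventually_sequentially)
  have tail_small: "(norm (F (\<rho> ^ m (Suc i) * (\<xi> + s))))\<^sup>2 \<le> \<epsilon> i"
    if "0 \<le> \<xi>" "\<xi> \<le> 1" "R i < \<bar>s\<bar>" "i \<ge> k" for \<xi> s i
  proof -
    have "\<tau> ^ k \<le> \<tau> ^ i" using tau that by (intro power_increasing) auto
    then have "c / 2 * \<tau> ^ k \<le> c / 2 * \<tau> ^ i" using tau by (intro mult_left_mono) auto
    then have u: "A \<le> c / 2 * \<tau> ^ i" "- ln c0 \<le> c / 2 * \<tau> ^ i" using k(1) by auto
    have "exp (c / 2 * \<tau> ^ i) \<le> exp (ln c0 + c * \<tau> ^ i)" using u(2) by simp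
    also have "\<dots> = c0 * exp (c * \<tau> ^ i)" using c0 by (simp add: exp_add)
    also have "\<dots> \<le> \<bar>\<rho> ^ m (Suc i) * (\<xi> + s)\<bar>" using tail that by blast
    finally show ?thesis unfolding \<epsilon>_def by (rule decay[OF u(1)])
  qed
  define S where "S i = {s \<in> \<Lambda>. \<bar>s\<bar> \<le> R i}" for i
  have S: "finite (S i)" "S i \<subseteq> \<Lambda>" for i using finite_spectrum_ball by (auto simp: S_def)
  obtain l where l: "l \<in> \<Lambda>" "l \<notin> S k" using S infinite_spectrum by (metis finite_subset subsetI)
  \<comment> \<open>The zeros of \<open>F\<close> are rational, so an irrational point of
    \<open>[l, l + 1]\<close> is not one. The frequency \<open>l\<close> outside \<open>S k\<close>
    then makes \<open>D k\<close> positive.\<close>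
  obtain \<xi> where \<xi>: "0 \<le> \<xi>" "\<xi> \<le> 1" "F (\<xi> + l) \<noteq> 0"
  proof -
    have "uncountable {l..l + 1}" by (simp add: uncountable_closed_interval)
    then obtain x where x: "x \<in> {l..l + 1}" "x \<notin> \<rat>"
      using countable_rat countable_subset by (metis subsetI)
    have "F x \<noteq> 0"
    proof
      assume "F x = 0"
      then obtain j where "mask N (\<rho> ^ j * x) = 0" using F_eq_0_iff by blast
      then obtain a :: int where "real N * (\<rho> ^ j * x) = of_int a" using mask_eq_0_iff[of N] N by auto
      then have "x = of_int a * real q ^ j / (real N * real p ^ j)"
        using N pq q by (simp add: rho_eq power_divide field_simps)
      then show False using x(2) by simp
    qed
    then show ?thesis using that[of "x - l"] x(1) by simp
  qed
  define D where "D i = 1 - (\<Sum>s\<in>S i. (norm (F (\<xi> + s)))\<^sup>2)" for i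
  have "0 < D k"
  proof -
    have "(\<Sum>s\<in>insert l (S k). (norm (F (\<xi> + s)))\<^sup>2) \<le> 1"
      using S l by (intro bessel_ft spectrum_orthogonal[OF spectrum]) auto
    then have "(norm (F (\<xi> + l)))\<^sup>2 \<le> D k" using S l by (simp add: D_def)
    moreover have "0 < (norm (F (\<xi> + l)))\<^sup>2" using \<xi> by simp
    ultimately show ?thesis by linarith
  qed
  moreover have "(1 - \<epsilon> i) * D i \<le> D (Suc i)" if i: "i \<ge> k" for i
  proof -
    let ?P = "\<lambda>s. (norm (P (m (Suc i)) (\<xi> + s)))\<^sup>2" and ?F = "\<lambda>s. (norm (F (\<xi> + s)))\<^sup>2"
    let ?T = "\<lambda>s. (norm (F (\<rho> ^ m (Suc i) * (\<xi> + s))))\<^sup>2"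
    have FP: "?F s = ?P s * ?T s" for s
      by (subst F_eq_P[of _ "m (Suc i)"]) (simp add: norm_mult power_mult_distrib)
    have sub: "S i \<subseteq> S (Suc i)"
    proof -
      have "\<tau> ^ i \<le> \<tau> ^ Suc i" using tau by (intro power_increasing) auto
      then have "R i \<le> R (Suc i)" by (simp add: R_def)
      then show ?thesis by (auto simp: S_def)
    qed
    have "(\<Sum>s\<in>S (Suc i) - S i. ?F s) \<le> (\<Sum>s\<in>S (Suc i) - S i. ?P s * \<epsilon> i)"
    proof (rule sum_mono)
      fix s assume "s \<in> S (Suc i) - S i"
      then have "?T s \<le> \<epsilon> i" using \<xi> i by (intro tail_small) (auto simp: S_def)
      then show "?F s \<le> ?P s * \<epsilon> i" unfolding FP by (intro mult_left_mono) auto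
    qed
    also have "\<dots> = \<epsilon> i * (\<Sum>s\<in>S (Suc i) - S i. ?P s)" by (simp add: sum_distrib_left mult.commute)
    also have "(\<Sum>s\<in>S (Suc i) - S i. ?P s) = (\<Sum>s\<in>S (Suc i). ?P s) - (\<Sum>s\<in>S i. ?P s)"
      by (rule sum_diff[OF S(1) sub])
    \<comment> \<open>On \<open>S i\<close> the finite product dominates \<open>F\<close>, so
      Bessel's bound 1 on \<open>S (Suc i)\<close> leaves at most \<open>D i\<close> for the new
      shell.\<close>
    also have "\<epsilon> i * \<dots> \<le> \<epsilon> i * D i"
    proof (intro mult_left_mono)
      have "(\<Sum>s\<in>S (Suc i). ?P s) \<le> 1"
        using m(2)[of "Suc i"] S by (intro P_bessel[where R = "R (Suc i)"]) (auto simp: S_def NP_def mult_ac)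
      moreover have "(\<Sum>s\<in>S i. ?F s) \<le> (\<Sum>s\<in>S i. ?P s)"
        unfolding FP by (intro sum_mono mult_right_le_one_le) (auto simp: norm_ft_le_1 power_le_one)
      ultimately show "(\<Sum>s\<in>S (Suc i). ?P s) - (\<Sum>s\<in>S i. ?P s) \<le> D i" by (simp add: D_def)
    qed (rule eps0)
    finally have "(\<Sum>s\<in>S (Suc i) - S i. ?F s) \<le> \<epsilon> i * D i" .
    moreover have "(\<Sum>s\<in>S (Suc i) - S i. ?F s) = D i - D (Suc i)"
      using sum_diff[OF S(1) sub, of ?F] by (simp add: D_def)
    ultimately show ?thesis by (simp add: algebra_simps)
  qed
  moreover have "(\<Sum>j<n. \<epsilon> (k + j)) \<le> 1 / 2" for n
  proof -
    have "(\<Sum>j<n. \<epsilon> (j + k)) \<le> (\<Sum>j. \<epsilon> (j + k))"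
      using summ eps0 by (intro sum_le_suminf) (auto simp: summable_iff_shift)
    then show ?thesis using k(2) by (simp add: add.commute)
  qed
  ultimately have low: "D k / 2 \<le> D (k + n)" for n
    using eps0 by (intro defect_persists[where \<epsilon> = \<epsilon>]) auto
  have "D k / 2 > 0" using \<open>0 < D k\<close> by simp
  then obtain T where T: "finite T" "T \<subseteq> \<Lambda>" "(\<Sum>s\<in>T. (norm (F (\<xi> + s)))\<^sup>2) > 1 - D k / 2"
    by (rule spectrum_parseval[OF spectrum])
  obtain B where B: "\<And>s. s \<in> T \<Longrightarrow> \<bar>s\<bar> \<le> B"
    using T(1) by (metis abs_le_iff finite_imp_bounded bounded_real)
  have "eventually (\<lambda>i. B \<le> \<tau> ^ i) sequentially" using tau_lim by (simp add: filterlim_at_top)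
  then obtain n where n: "\<And>i. i \<ge> n \<Longrightarrow> B \<le> \<tau> ^ i" by (auto simp: eventually_sequentially)
  have "T \<subseteq> S (k + n)"
  proof
    fix s assume s: "s \<in> T"
    have "\<bar>s\<bar> \<le> \<tau> ^ (k + n)" using B[OF s] n[of "k + n"] by simp
    also have "\<dots> \<le> R (k + n)" unfolding R_def using exp_ge_add_one_self[of "\<tau> ^ (k + n)"] by linarith
    finally show "s \<in> S (k + n)" using s T(2) by (auto simp: S_def)
  qed
  then have "(\<Sum>s\<in>T. (norm (F (\<xi> + s)))\<^sup>2) \<le> 1 - D (k + n)"
    unfolding D_def using S by (simp add: sum_mono2)
  then show False using T(3) low[of n] by linarith
qed

lemma (in bernoulli_spectrum) integral_inverse_ratio: "\<exists>q::nat. q > 1 \<and> N dvd q \<and> \<rho> = 1 / real q"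
proof -
  obtain q p :: nat where pq: "p \<noteq> 0" "\<bar>1 / \<rho>\<bar> = real q / real p" "coprime q p"
    using theta_rational by (rule Rats_abs_nat_div_natE)
  have "q > 0" using pq rho by (intro Nat.gr0I) auto
  then interpret rational_spectrum \<rho> N \<Lambda> p q
    by unfold_locales (use pq rho in \<open>auto simp: field_simps coprime_commute\<close>)
  show ?thesis using N_dvd_q p_eq_1 p_less_q rho_eq by auto
qed

section \<open>Density of the exponentials\<close>

context real_distribution
begin

text \<open>The square of the seminorm: \<open>norm_add_sq_le\<close> replaces Minkowski's
  inequality, and its factor 2 explains the bounds \<open>\<epsilon> / 4\<close> below.\<close>

definition sqn :: "(real \<Rightarrow> complex) \<Rightarrow> real" where
  "sqn f = (\<integral>x. (norm (f x))\<^sup>2 \<partial>M)"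

lemma L2_spaceD [dest]:
  assumes "f \<in> L2_space M"
  shows "f \<in> borel_measurable M" "integrable M (\<lambda>x. (norm (f x))\<^sup>2)"
  using assms by (auto simp: L2_space_def)

lemma norm_add_sq_le: "(norm (a + b :: complex))\<^sup>2 \<le> 2 * (norm a)\<^sup>2 + 2 * (norm b)\<^sup>2"
proof -
  have "(norm (a + b))\<^sup>2 \<le> (norm a + norm b)\<^sup>2" by (intro power_mono norm_triangle_ineq) simp
  also have "\<dots> \<le> 2 * (norm a)\<^sup>2 + 2 * (norm b)\<^sup>2"
    using zero_le_power2[of "norm a - norm b"] unfolding power2_diff power2_sum by linarith
  finally show ?thesis .
qed

lemma L2_space_dominated:
  assumes "f \<in> borel_measurable M" "integrable M w" "\<And>x. (norm (f x))\<^sup>2 \<le> w x"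
  shows "f \<in> L2_space M"
proof -
  have "integrable M (\<lambda>x. (norm (f x))\<^sup>2)"
    using assms(2) by (rule Bochner_Integration.integrable_bound)
      (use assms(1,3) in \<open>auto intro!: always_eventually order_trans[OF assms(3) abs_ge_self]\<close>)
  then show ?thesis using assms(1) by (simp add: L2_space_def)
qed

lemma L2_space_add:
  assumes f: "f \<in> L2_space M" and g: "g \<in> L2_space M"
  shows "(\<lambda>x. f x + g x) \<in> L2_space M" "sqn (\<lambda>x. f x + g x) \<le> 2 * sqn f + 2 * sqn g"
proof -
  note fg = L2_spaceD[OF f] L2_spaceD[OF g]
  have int: "integrable M (\<lambda>x. 2 * (norm (f x))\<^sup>2 + 2 * (norm (g x))\<^sup>2)" using fg by simp
  show L: "(\<lambda>x. f x + g x) \<in> L2_space M"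
    by (rule L2_space_dominated[OF _ int norm_add_sq_le]) (use fg in simp)
  have "sqn (\<lambda>x. f x + g x) \<le> (\<integral>x. 2 * (norm (f x))\<^sup>2 + 2 * (norm (g x))\<^sup>2 \<partial>M)"
    unfolding sqn_def using L int by (intro integral_mono norm_add_sq_le) auto
  then show "sqn (\<lambda>x. f x + g x) \<le> 2 * sqn f + 2 * sqn g" using fg by (simp add: sqn_def)
qed

lemma L2_space_cmult:
  assumes "f \<in> L2_space M"
  shows "(\<lambda>x. c * f x) \<in> L2_space M" "sqn (\<lambda>x. c * f x) = (norm c)\<^sup>2 * sqn f"
  using L2_spaceD[OF assms] by (auto simp: L2_space_def sqn_def norm_mult power_mult_distrib)

lemma L2_space_diff:
  assumes f: "f \<in> L2_space M" and g: "g \<in> L2_space M"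
  shows "(\<lambda>x. f x - g x) \<in> L2_space M"
  using L2_space_add(1)[OF f L2_space_cmult(1)[OF g, of "-1"]] by simp

lemma L2_space_bounded:
  assumes "f \<in> borel_measurable M" "\<And>x. norm (f x) \<le> B"
  shows "f \<in> L2_space M"
  using assms(1) by (rule L2_space_dominated[where w = "\<lambda>_. B\<^sup>2"]) (auto intro!: power_mono assms)

lemma sqn_bound:
  assumes f: "f \<in> L2_space M" and B: "B \<ge> 0" "AE x in M. norm (f x) \<le> B"
  shows "sqn f \<le> B\<^sup>2"
proof -
  have "sqn f \<le> (\<integral>x. B\<^sup>2 \<partial>M)"
    unfolding sqn_def using L2_spaceD[OF f] B by (intro integral_mono_AE) (auto intro: power_mono)
  also have "\<dots> = B\<^sup>2" using prob_space by (simp del: space_eq_univ)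
  finally show ?thesis .
qed

definition approximable :: "(real \<Rightarrow> complex) set \<Rightarrow> (real \<Rightarrow> complex) \<Rightarrow> bool" where
  "approximable T f \<longleftrightarrow> f \<in> L2_space M \<and> (\<forall>\<epsilon>>0. \<exists>h\<in>T. sqn (\<lambda>x. f x - h x) < \<epsilon>)"

lemma approximable_closed:
  assumes f: "f \<in> L2_space M" and T: "T \<subseteq> L2_space M"
    and appr: "\<And>\<epsilon>. \<epsilon> > 0 \<Longrightarrow> \<exists>g. approximable T g \<and> sqn (\<lambda>x. f x - g x) < \<epsilon>"
  shows "approximable T f"
  unfolding approximable_def
proof (intro conjI allI impI)
  fix \<epsilon> :: real assume "\<epsilon> > 0"
  then obtain g where g: "approximable T g" "sqn (\<lambda>x. f x - g x) < \<epsilon> / 4" using appr[of "\<epsilon> / 4"] by auto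
  then obtain h where h: "h \<in> T" "sqn (\<lambda>x. g x - h x) < \<epsilon> / 4"
    using \<open>\<epsilon> > 0\<close> by (auto simp: approximable_def dest!: spec[of _ "\<epsilon> / 4"])
  have "sqn (\<lambda>x. (f x - g x) + (g x - h x)) \<le> 2 * sqn (\<lambda>x. f x - g x) + 2 * sqn (\<lambda>x. g x - h x)"
    using f g h T by (intro L2_space_add L2_space_diff) (auto simp: approximable_def)
  then have "sqn (\<lambda>x. f x - h x) < \<epsilon>" using g h by simp
  then show "\<exists>h\<in>T. sqn (\<lambda>x. f x - h x) < \<epsilon>" using h by blast
qed (rule f)

lemma approximable_limit:
  assumes T: "T \<subseteq> L2_space M" and f: "f \<in> borel_measurable M" and g: "\<And>n. approximable T (g n)"
    and lim: "\<And>x. (\<lambda>n. g n x) \<longlonglongrightarrow> f x"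
    and w: "integrable M w" "\<And>n x. (norm (f x - g n x))\<^sup>2 \<le> w x"
  shows "approximable T f"
proof -
  have gL: "g n \<in> L2_space M" for n using g by (auto simp: approximable_def)
  have gm [measurable]: "g n \<in> borel_measurable M" for n using gL by blast
  note f [measurable]
  have d: "(\<lambda>x. f x - g n x) \<in> L2_space M" for n
    by (rule L2_space_dominated[OF _ w(1) w(2)]) measurable
  have fL: "f \<in> L2_space M" using L2_space_add(1)[OF d[of 0] gL[of 0]] by simp
  have "(\<lambda>n. \<integral>x. (norm (f x - g n x))\<^sup>2 \<partial>M) \<longlonglongrightarrow> (\<integral>x. 0 \<partial>M)"
  proof (rule integral_dominated_convergence[where w = w])
    have "(\<lambda>n. (norm (f x - g n x))\<^sup>2) \<longlonglongrightarrow> (norm (f x - f x))\<^sup>2" for x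
      by (intro tendsto_intros lim)
    then show "AE x in M. (\<lambda>n. (norm (f x - g n x))\<^sup>2) \<longlonglongrightarrow> 0" by simp
  qed (use w in auto)
  then have lim0: "(\<lambda>n. sqn (\<lambda>x. f x - g n x)) \<longlonglongrightarrow> 0" by (simp add: sqn_def)
  show ?thesis
  proof (rule approximable_closed[OF fL T])
    fix \<epsilon> :: real assume "\<epsilon> > 0"
    then have "eventually (\<lambda>n. sqn (\<lambda>x. f x - g n x) < \<epsilon>) sequentially"
      using lim0 by (rule order_tendstoD(2)[rotated])
    then obtain n where "sqn (\<lambda>x. f x - g n x) < \<epsilon>" by (auto simp: eventually_sequentially)
    then show "\<exists>g. approximable T g \<and> sqn (\<lambda>x. f x - g x) < \<epsilon>" using g by blast
  qed
qed

lemma approximable_add: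
  assumes T: "T \<subseteq> L2_space M" "\<And>h h'. h \<in> T \<Longrightarrow> h' \<in> T \<Longrightarrow> (\<lambda>x. h x + h' x) \<in> T"
    and f: "approximable T f" and g: "approximable T g"
  shows "approximable T (\<lambda>x. f x + g x)"
  unfolding approximable_def
proof (intro conjI allI impI)
  have fL: "f \<in> L2_space M" "g \<in> L2_space M" using f g by (auto simp: approximable_def)
  then show "(\<lambda>x. f x + g x) \<in> L2_space M" by (rule L2_space_add)
  fix \<epsilon> :: real assume e: "\<epsilon> > 0"
  obtain h where h: "h \<in> T" "sqn (\<lambda>x. f x - h x) < \<epsilon> / 4"
    using f e by (auto simp: approximable_def dest!: spec[of _ "\<epsilon> / 4"])
  obtain k where k: "k \<in> T" "sqn (\<lambda>x. g x - k x) < \<epsilon> / 4"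
    using g e by (auto simp: approximable_def dest!: spec[of _ "\<epsilon> / 4"])
  have "sqn (\<lambda>x. (f x - h x) + (g x - k x)) \<le> 2 * sqn (\<lambda>x. f x - h x) + 2 * sqn (\<lambda>x. g x - k x)"
    using fL h k T by (intro L2_space_add L2_space_diff) auto
  then have "sqn (\<lambda>x. (f x + g x) - (h x + k x)) < \<epsilon>" using h k by (simp add: algebra_simps)
  then show "\<exists>h\<in>T. sqn (\<lambda>x. f x + g x - h x) < \<epsilon>" using T(2)[OF h(1) k(1)] by (rule bexI)
qed

lemma approximable_cmult:
  assumes T: "T \<subseteq> L2_space M" "\<And>h c. h \<in> T \<Longrightarrow> (\<lambda>x. c * h x) \<in> T" and f: "approximable T f"
  shows "approximable T (\<lambda>x. c * f x)"
  unfolding approximable_def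
proof (intro conjI allI impI)
  have fL: "f \<in> L2_space M" using f by (auto simp: approximable_def)
  then show "(\<lambda>x. c * f x) \<in> L2_space M" by (rule L2_space_cmult)
  fix \<epsilon> :: real assume e: "\<epsilon> > 0"
  have c: "(norm c)\<^sup>2 + 1 > 0" by (simp add: add_nonneg_pos)
  then obtain h where h: "h \<in> T" "sqn (\<lambda>x. f x - h x) < \<epsilon> / ((norm c)\<^sup>2 + 1)"
    using f e by (auto simp: approximable_def dest!: spec[of _ "\<epsilon> / ((norm c)\<^sup>2 + 1)"])
  have s0: "0 \<le> sqn (\<lambda>x. f x - h x)" by (simp add: sqn_def)
  have "sqn (\<lambda>x. c * (f x - h x)) = (norm c)\<^sup>2 * sqn (\<lambda>x. f x - h x)"
    using fL h T by (intro L2_space_cmult L2_space_diff) auto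
  also have "\<dots> \<le> ((norm c)\<^sup>2 + 1) * sqn (\<lambda>x. f x - h x)" using s0 by (intro mult_right_mono) auto
  also have "\<dots> < \<epsilon>" using h(2) c by (simp add: field_simps)
  finally have "sqn (\<lambda>x. c * f x - c * h x) < \<epsilon>" by (simp add: right_diff_distrib)
  then show "\<exists>h\<in>T. sqn (\<lambda>x. c * f x - h x) < \<epsilon>" using T(2)[OF h(1), of c] by (rule bexI)
qed

end

inductive trig_poly :: "(real \<Rightarrow> complex) \<Rightarrow> bool" where
  base: "trig_poly (\<lambda>t. c * cis (a * t))"
| add: "trig_poly f \<Longrightarrow> trig_poly g \<Longrightarrow> trig_poly (\<lambda>t. f t + g t)"

lemma trig_poly_mult:
  assumes "trig_poly f" "trig_poly g"
  shows "trig_poly (\<lambda>t. f t * g t)"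
  using assms
proof (induction f rule: trig_poly.induct)
  case (base c a)
  from base show ?case
  proof (induction g rule: trig_poly.induct)
    case (base d b)
    have "(\<lambda>t. c * cis (a * t) * (d * cis (b * t))) = (\<lambda>t. (c * d) * cis ((a + b) * t))"
      by (rule ext) (simp add: distrib_right flip: cis_mult)
    then show ?case by (simp only: trig_poly.base)
  qed (simp add: distrib_left trig_poly.add)
qed (simp add: distrib_right trig_poly.add)

lemma trig_poly_const: "trig_poly (\<lambda>t. c)"
  using trig_poly.base[of c 0] by simp

text \<open>The real Stone-Weierstrass theorem, for the algebra of continuous real functions that
  are trigonometric polynomials as complex functions. Arbitrary real frequencies are allowed, so no
  periodicity restricts the interval.\<close>

lemma trig_poly_dense:
  fixes f :: "real \<Rightarrow> real"
  assumes f: "continuous_on {-L..L} f" and e: "\<epsilon> > 0" and L: "L > 0"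
  obtains g where "trig_poly g" "\<And>t. \<bar>t\<bar> \<le> L \<Longrightarrow> norm (of_real (f t) - g t) < \<epsilon>"
proof -
  have "\<exists>g. (trig_poly (\<lambda>t. of_real (g t)) \<and> continuous_on {-L..L} g) \<and> (\<forall>t\<in>{-L..L}. \<bar>f t - g t\<bar> < \<epsilon>)"
  proof (rule Stone_Weierstrass_HOL[where P = "\<lambda>g. trig_poly (\<lambda>t. of_real (g t)) \<and> continuous_on {-L..L} g"])
    fix x y :: real assume xy: "x \<in> {-L..L} \<and> y \<in> {-L..L} \<and> x \<noteq> y"
    \<comment> \<open>The frequency is so low that \<open>a * t\<close> stays in
      \<open>[-1, 1]\<close>, where the sine is injective; one function thus separates all
      points.\<close>
    define a where "a = 1 / L"
    have "trig_poly (\<lambda>t. (- \<i> / 2) * cis (a * t) + (\<i> / 2) * cis ((- a) * t))"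
      by (intro trig_poly.intros)
    also have "(\<lambda>t. (- \<i> / 2) * cis (a * t) + (\<i> / 2) * cis ((- a) * t)) = (\<lambda>t. of_real (sin (a * t)))"
      by (rule ext) (simp add: complex_eq_iff)
    finally have "trig_poly (\<lambda>t. of_real (sin (a * t)))" .
    moreover have "sin (a * x) \<noteq> sin (a * y)"
    proof
      assume eq: "sin (a * x) = sin (a * y)"
      have "\<bar>a * x\<bar> \<le> 1" "\<bar>a * y\<bar> \<le> 1" using xy L by (auto simp: a_def abs_if divide_simps)
      moreover have "1 \<le> pi / 2" using pi_ge_two by simp
      ultimately have "- (pi / 2) \<le> a * x" "a * x \<le> pi / 2" "- (pi / 2) \<le> a * y" "a * y \<le> pi / 2" by linarith+
      then have "a * x = a * y" using eq sin_inj_pi by blast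
      then show False using xy L by (simp add: a_def)
    qed
    ultimately show "\<exists>f. (trig_poly (\<lambda>t. of_real (f t)) \<and> continuous_on {-L..L} f) \<and> f x \<noteq> f y"
      by (intro exI[of _ "\<lambda>t. sin (a * t)"]) (auto intro!: continuous_intros)
  qed (auto intro!: trig_poly_const trig_poly.add trig_poly_mult continuous_intros f e)
  then obtain g where g: "trig_poly (\<lambda>t. complex_of_real (g t))" "\<forall>t\<in>{-L..L}. \<bar>f t - g t\<bar> < \<epsilon>" by blast
  show ?thesis
  proof (rule that[OF g(1)])
    fix t :: real assume "\<bar>t\<bar> \<le> L"
    then have "t \<in> {-L..L}" by (simp add: abs_le_iff)
    then have "\<bar>f t - g t\<bar> < \<epsilon>" using g(2) by blast
    then show "norm (of_real (f t) - complex_of_real (g t)) < \<epsilon>"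
      by (simp only: norm_of_real flip: of_real_diff)
  qed
qed

context real_distribution
begin

lemma trig_poly_L2: "trig_poly f \<Longrightarrow> f \<in> L2_space M"
proof (induction rule: trig_poly.induct)
  case (base c a)
  show ?case by (rule L2_space_bounded[of _ "norm c"]) (auto simp: norm_mult)
qed (rule L2_space_add)

text \<open>The closure of \<open>T\<close> contains the trigonometric polynomials, then the bounded
  continuous functions because the measure lives on \<open>[-L, L]\<close>, the indicators of
  half-lines as limits of ramps, those of all Borel sets by a pi-lambda argument, and finally all
  limits of simple functions.\<close>

lemma approximable_all:
  assumes bdd: "AE x in M. \<bar>x\<bar> \<le> L" "L > 0"
    and T: "T \<subseteq> L2_space M" "\<And>h h'. h \<in> T \<Longrightarrow> h' \<in> T \<Longrightarrow> (\<lambda>x. h x + h' x) \<in> T"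
      "\<And>h c. h \<in> T \<Longrightarrow> (\<lambda>x. c * h x) \<in> T"
    and exps: "\<And>a. approximable T (\<lambda>x. cis (a * x))"
    and f: "f \<in> L2_space M"
  shows "approximable T f"
proof -
  have trig: "approximable T g" if "trig_poly g" for g
    using that
  proof (induction rule: trig_poly.induct)
    case (base c a)
    show ?case by (rule approximable_cmult[OF T(1,3) exps])
  next
    case (add f g)
    then show ?case by (intro approximable_add[OF T(1,2)])
  qed
  have cont: "approximable T (\<lambda>x. of_real (g x))" if g: "continuous_on UNIV g" "\<And>x. \<bar>g x\<bar> \<le> 1" for g :: "real \<Rightarrow> real"
  proof (rule approximable_closed[OF _ T(1)])
    have [measurable]: "g \<in> borel_measurable M"
      using borel_measurable_continuous_onI[OF g(1)] by simp
    show gL: "(\<lambda>x. complex_of_real (g x)) \<in> L2_space M"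
      by (rule L2_space_bounded[of _ 1]) (use g in auto)
    fix \<epsilon> :: real assume e: "\<epsilon> > 0"
    define d where "d = sqrt (\<epsilon> / 2)"
    have d: "d > 0" "d\<^sup>2 = \<epsilon> / 2" using e by (simp_all add: d_def)
    obtain h where h: "trig_poly h" "\<And>t. \<bar>t\<bar> \<le> L \<Longrightarrow> norm (of_real (g t) - h t) < d"
      using trig_poly_dense[of L g d] continuous_on_subset[OF g(1)] d bdd(2) by blast
    have "sqn (\<lambda>x. of_real (g x) - h x) \<le> d\<^sup>2"
    proof (rule sqn_bound)
      show "(\<lambda>x. of_real (g x) - h x) \<in> L2_space M" by (rule L2_space_diff[OF gL trig_poly_L2[OF h(1)]])
      show "AE x in M. norm (of_real (g x) - h x) \<le> d"
        using bdd(1) by eventually_elim (use h(2) in \<open>auto intro: less_imp_le\<close>)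
    qed (use d in simp)
    then show "\<exists>h. approximable T h \<and> sqn (\<lambda>x. of_real (g x) - h x) < \<epsilon>"
      using trig[OF h(1)] d e by (intro exI[of _ h]) auto
  qed
  have one: "approximable T (\<lambda>x. 1)" using exps[of 0] by simp
  have ind: "approximable T (indicator A)" if A: "A \<in> sets borel" for A
  proof -
    have "Int_stable (range atMost :: real set set)"
      by (auto simp: Int_stable_def)
    moreover have "(range atMost :: real set set) \<subseteq> Pow UNIV" by simp
    moreover have "A \<in> sigma_sets UNIV (range atMost)"
      using A by (simp add: borel_eq_atMost)
    ultimately show ?thesis
    proof (induction rule: sigma_sets_induct_disjoint)
      case (basic A)
      then obtain a where A: "A = {..a}" by auto
      \<comment> \<open>A ramp equal to 1 up to \<open>a\<close> and decreasing to 0 within distance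
        \<open>1 / n\<close>, constantly 1 for \<open>n = 0\<close>.\<close>
      define g where "g n x = max 0 (min 1 (1 - real n * (x - a)))" for n x
      have g01: "0 \<le> g n x" "g n x \<le> 1" for n x by (auto simp: g_def)
      show ?case
      proof (rule approximable_limit[OF T(1), where g = "\<lambda>n x. of_real (g n x)" and w = "\<lambda>_. 4"])
        show "indicator A \<in> borel_measurable M" by (simp add: A)
        show "approximable T (\<lambda>x. complex_of_real (g n x))" for n
        proof (rule cont)
          show "continuous_on UNIV (g n)" unfolding g_def by (intro continuous_intros)
        qed (use g01[of n] in auto)
        show "(\<lambda>n. complex_of_real (g n x)) \<longlonglongrightarrow> indicator A x" for x
        proof (cases "x \<le> a")
          case True
          then have "real n * (x - a) \<le> 0" for n by (intro mult_nonneg_nonpos) auto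
          then have "g n x = 1" for n by (auto simp: g_def min_def max_def)
          then show ?thesis using True by (simp add: A)
        next
          case False
          obtain m where m: "1 / (x - a) < real m" using reals_Archimedean2 by blast
          have "g n x = 0" if "n \<ge> m" for n
          proof -
            have "1 / (x - a) \<le> real n" using m that by simp
            then have "1 \<le> real n * (x - a)" using False by (simp add: field_simps)
            then show ?thesis by (auto simp: g_def)
          qed
          then have "eventually (\<lambda>n. complex_of_real (g n x) = 0) sequentially"
            by (auto simp: eventually_sequentially)
          then show ?thesis using False by (simp add: A tendsto_eventually)
        qed
        show "(norm (indicator A x - complex_of_real (g n x)))\<^sup>2 \<le> 4" for n x
        proof -
          have "norm (indicator A x - complex_of_real (g n x)) \<le> norm (indicator A x :: complex) + norm (complex_of_real (g n x))"
            by (rule norm_triangle_ineq4)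
          also have "\<dots> \<le> 2" using g01[of n x] by (auto simp: indicator_def)
          finally show ?thesis using power_mono[of _ 2 2] by fastforce
        qed
      qed simp
    next
      case empty
      show ?case using approximable_cmult[OF T(1,3) one, of 0] by simp
    next
      case (compl A)
      have "(\<lambda>x. 1 + (-1) * indicator A x) = (indicator (UNIV - A) :: real \<Rightarrow> complex)"
        by (auto simp: indicator_def)
      moreover have "approximable T (\<lambda>x. 1 + (-1) * indicator A x)"
        by (rule approximable_add[OF T(1,2) one approximable_cmult[OF T(1,3) compl(2)]])
      ultimately show ?case by (simp only:)
    next
      case (union A)
      have mA [measurable]: "A i \<in> sets borel" for i using union(2) by (auto simp: borel_eq_atMost)
      have sum_eq: "(\<Sum>i<n. indicator (A i) x) = (indicator (\<Union>i<n. A i) x :: complex)" for n x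
        using union(1) by (intro indicator_UN_disjoint[symmetric]) (auto simp: disjoint_family_on_def)
      show ?case
      proof (rule approximable_limit[OF T(1), where g = "\<lambda>n x. \<Sum>i<n. indicator (A i) x" and w = "\<lambda>_. 4"])
        show "indicator (\<Union>i. A i) \<in> borel_measurable M" by simp
        show "approximable T (\<lambda>x. \<Sum>i<n. indicator (A i) x)" for n
        proof (induction n)
          case 0
          show ?case using approximable_cmult[OF T(1,3) one, of 0] by simp
        next
          case (Suc n)
          have "approximable T (\<lambda>x. (\<Sum>i<n. indicator (A i) x) + indicator (A n) x)"
            by (rule approximable_add[OF T(1,2) Suc union(3)])
          then show ?case by (simp only: sum.lessThan_Suc)
        qed
        show "(\<lambda>n. \<Sum>i<n. indicator (A i) x :: complex) \<longlonglongrightarrow> indicator (\<Union>i. A i) x" for x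
        proof (cases "x \<in> (\<Union>i. A i)")
          case True
          then obtain j where "x \<in> A j" by blast
          then have "eventually (\<lambda>n. (\<Sum>i<n. indicator (A i) x :: complex) = 1) sequentially"
            unfolding sum_eq eventually_sequentially by (intro exI[of _ "Suc j"]) (auto simp: indicator_def)
          then show ?thesis using True by (simp add: tendsto_eventually)
        next
          case False
          then show ?thesis by simp
        qed
        show "(norm (indicator (\<Union>i. A i) x - (\<Sum>i<n. indicator (A i) x) :: complex))\<^sup>2 \<le> 4" for n x
          unfolding sum_eq by (auto simp: indicator_def)
      qed simp
    qed
  qed
  note fm = L2_spaceD[OF f]
  obtain s where s: "\<And>i. simple_function M (s i)" "\<And>x. x \<in> space M \<Longrightarrow> (\<lambda>i. s i x) \<longlonglongrightarrow> f x"
    "\<And>i x. x \<in> space M \<Longrightarrow> dist (s i x) 0 \<le> 2 * dist (f x) 0"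
    using borel_measurable_implies_sequence_metric[OF fm(1), of 0] by blast
  show ?thesis
  proof (rule approximable_limit[OF T(1) fm(1), where g = s and w = "\<lambda>x. 9 * (norm (f x))\<^sup>2"])
    show "(\<lambda>n. s n x) \<longlonglongrightarrow> f x" for x using s(2) by simp
    show "integrable M (\<lambda>x. 9 * (norm (f x))\<^sup>2)" using fm by simp
    show "(norm (f x - s n x))\<^sup>2 \<le> 9 * (norm (f x))\<^sup>2" for n x
    proof -
      have "norm (f x - s n x) \<le> norm (f x) + norm (s n x)" by (rule norm_triangle_ineq4)
      also have "\<dots> \<le> 3 * norm (f x)" using s(3)[of x n] by simp
      finally have "(norm (f x - s n x))\<^sup>2 \<le> (3 * norm (f x))\<^sup>2" by (intro power_mono) auto
      then show ?thesis by (simp add: power_mult_distrib)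
    qed
    show "approximable T (s n)" for n
    proof -
      have fin: "finite (range (s n))" and meas: "s n -` {y} \<in> sets borel" for y
        using s(1)[of n] simple_functionD(2)[OF s(1), of n "{y}"] by (auto simp: simple_function_def)
      have "approximable T (\<lambda>x. \<Sum>y\<in>Y. y * indicator (s n -` {y}) x)" if "finite Y" for Y
        using that
      proof (induction Y)
        case empty
        show ?case using approximable_cmult[OF T(1,3) one, of 0] by simp
      next
        case (insert y Y)
        have "approximable T (\<lambda>x. y * indicator (s n -` {y}) x + (\<Sum>y\<in>Y. y * indicator (s n -` {y}) x))"
          by (rule approximable_add[OF T(1,2) approximable_cmult[OF T(1,3) ind[OF meas]] insert.IH])
        then show ?case by (simp only: sum.insert[OF insert.hyps])
      qed
      from this[OF fin] show ?thesis
      proof (rule back_subst[of "approximable T"])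
        show "(\<lambda>x. \<Sum>y\<in>range (s n). y * indicator (s n -` {y}) x) = s n"
        proof
          fix x
          have "(\<Sum>y\<in>range (s n). y * indicator (s n -` {y}) x) = (\<Sum>y\<in>range (s n). if y = s n x then y else 0)"
            by (intro sum.cong) (auto simp: indicator_def)
          also have "\<dots> = s n x" using fin by simp
          finally show "(\<Sum>y\<in>range (s n). y * indicator (s n -` {y}) x) = s n x" .
        qed
      qed
    qed
  qed
qed

text \<open>Parseval's identity is needed for exponentials only: it puts each of them into the
  closure of the span \<open>T\<close>, and boundedness of the measure does the rest.\<close>

lemma is_spectrumI:
  assumes bdd: "AE x in M. \<bar>x\<bar> \<le> L" "L > 0" and \<Lambda>: "countable \<Lambda>"
    and orth: "\<And>s t. s \<in> \<Lambda> \<Longrightarrow> t \<in> \<Lambda> \<Longrightarrow> s \<noteq> t \<Longrightarrow> ft M (s - t) = 0"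
    and complete: "\<And>x \<epsilon>. \<epsilon> > 0 \<Longrightarrow> \<exists>S\<subseteq>\<Lambda>. finite S \<and> (\<Sum>s\<in>S. (norm (ft M (x + s)))\<^sup>2) > 1 - \<epsilon>"
  shows "is_spectrum M \<Lambda>"
proof -
  define e where "e l x = cis (2 * pi * (- l) * x)" for l x :: real
  define T where "T = {\<lambda>x. \<Sum>i\<in>F. c i * e i x | F c. finite F \<and> F \<subseteq> \<Lambda>}"
  have eL: "e l \<in> L2_space M" for l unfolding e_def by (rule L2_space_bounded[of _ 1]) auto
  have TI: "(\<lambda>x. \<Sum>i\<in>F. c i * e i x) \<in> T" if "finite F" "F \<subseteq> \<Lambda>" for F c
    using that unfolding T_def by blast
  have TE: thesis if "h \<in> T" "\<And>F c. finite F \<Longrightarrow> F \<subseteq> \<Lambda> \<Longrightarrow> h = (\<lambda>x. \<Sum>i\<in>F. c i * e i x) \<Longrightarrow> thesis" for h thesis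
    using that unfolding T_def by blast
  have TL: "T \<subseteq> L2_space M"
  proof
    fix h assume "h \<in> T"
    then obtain F c where F: "finite F" "F \<subseteq> \<Lambda>" "h = (\<lambda>x. \<Sum>i\<in>F. c i * e i x)" by (rule TE)
    have "(\<lambda>x. \<Sum>i\<in>F. c i * e i x) \<in> L2_space M" using F(1)
    proof induction
      case empty
      show ?case by (rule L2_space_bounded[of _ 0]) auto
    next
      case (insert i F)
      then show ?case using L2_space_add(1)[OF L2_space_cmult(1)[OF eL[of i], of "c i"] insert.IH] by simp
    qed
    then show "h \<in> L2_space M" using F by simp
  qed
  have Tadd: "(\<lambda>x. h x + h' x) \<in> T" if h: "h \<in> T" and h': "h' \<in> T" for h h'
  proof -
    obtain F c where F: "finite F" "F \<subseteq> \<Lambda>" "h = (\<lambda>x. \<Sum>i\<in>F. c i * e i x)" using h by (rule TE)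
    obtain G d where G: "finite G" "G \<subseteq> \<Lambda>" "h' = (\<lambda>x. \<Sum>i\<in>G. d i * e i x)" using h' by (rule TE)
    define b where "b i = (if i \<in> F then c i else 0) + (if i \<in> G then d i else 0)" for i
    have "(\<lambda>x. h x + h' x) = (\<lambda>x. \<Sum>i\<in>F \<union> G. b i * e i x)"
    proof
      fix x
      have "h x = (\<Sum>i\<in>F \<union> G. (if i \<in> F then c i else 0) * e i x)"
        unfolding F(3) using F(1) G(1) by (intro sum.mono_neutral_cong_left) auto
      moreover have "h' x = (\<Sum>i\<in>F \<union> G. (if i \<in> G then d i else 0) * e i x)"
        unfolding G(3) using F(1) G(1) by (intro sum.mono_neutral_cong_left) auto
      ultimately show "h x + h' x = (\<Sum>i\<in>F \<union> G. b i * e i x)"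
        by (simp add: b_def distrib_right sum.distrib)
    qed
    then show ?thesis using TI[of "F \<union> G" b] F G by simp
  qed
  have Tmult: "(\<lambda>x. c * h x) \<in> T" if h: "h \<in> T" for h c
  proof -
    obtain F d where F: "finite F" "F \<subseteq> \<Lambda>" "h = (\<lambda>x. \<Sum>i\<in>F. d i * e i x)" using h by (rule TE)
    then have "(\<lambda>x. c * h x) = (\<lambda>x. \<Sum>i\<in>F. (c * d i) * e i x)" by (simp add: sum_distrib_left mult.assoc)
    then show ?thesis using TI[of F "\<lambda>i. c * d i"] F by simp
  qed
  have exps: "approximable T (\<lambda>t. cis (a * t))" for a
    unfolding approximable_def
  proof (intro conjI allI impI)
    show "(\<lambda>t. cis (a * t)) \<in> L2_space M" by (rule L2_space_bounded[of _ 1]) auto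
    fix \<epsilon> :: real assume "\<epsilon> > 0"
    define x where "x = a / (2 * pi)"
    have a: "a = 2 * pi * x" by (simp add: x_def)
    obtain S where S: "S \<subseteq> \<Lambda>" "finite S" "(\<Sum>s\<in>S. (norm (ft M (x + s)))\<^sup>2) > 1 - \<epsilon>"
      using complete[OF \<open>\<epsilon> > 0\<close>] by blast
    define S' where "S' = uminus ` S"
    have orth': "ft M (s - t) = 0" if "s \<in> S'" "t \<in> S'" "s \<noteq> t" for s t
    proof -
      obtain u v where "s = - u" "t = - v" "u \<in> S" "v \<in> S" using \<open>s \<in> S'\<close> \<open>t \<in> S'\<close> by (auto simp: S'_def)
      then show ?thesis using orth[of v u] S \<open>s \<noteq> t\<close> by auto
    qed
    define h where "h t = (\<Sum>i\<in>S. ft M (x + i) * e i t)" for t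
    have hT: "h \<in> T" using TI[OF S(2,1)] unfolding h_def[abs_def] .
    have h_eq: "h t = (\<Sum>s\<in>S'. ft M (x - s) * cis (2 * pi * s * t))" for t
      unfolding h_def S'_def e_def by (subst sum.reindex) auto
    have "sqn (\<lambda>t. cis (a * t) - h t) = 1 - (\<Sum>s\<in>S'. (norm (ft M (x - s)))\<^sup>2)"
      unfolding sqn_def a h_eq using S(2) orth'
      by (subst integral_norm_diff_sq) (auto simp: S'_def)
    also have "(\<Sum>s\<in>S'. (norm (ft M (x - s)))\<^sup>2) = (\<Sum>s\<in>S. (norm (ft M (x + s)))\<^sup>2)"
      unfolding S'_def by (subst sum.reindex) auto
    finally have "sqn (\<lambda>t. cis (a * t) - h t) < \<epsilon>" using S(3) by simp
    then show "\<exists>h\<in>T. sqn (\<lambda>t. cis (a * t) - h t) < \<epsilon>" using hT by blast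
  qed
  have "orthogonal_basis_L2 M \<Lambda> e"
    unfolding orthogonal_basis_L2_def
  proof (intro conjI ballI allI impI)
    fix i assume "i \<in> \<Lambda>"
    show "e i \<in> L2_space M" by (rule eL)
    show "L2_norm M (e i) \<noteq> 0"
      using prob_space by (simp add: L2_norm_def e_def del: space_eq_univ)
  next
    fix i j assume ij: "i \<in> \<Lambda>" "j \<in> \<Lambda>" "i \<noteq> j"
    have "e i x * cnj (e j x) = cis (2 * pi * (j - i) * x)" for x
      by (simp add: e_def cis_cnj cis_mult algebra_simps)
    then show "L2_inner M (e i) (e j) = 0"
      using orth[of j i] ij by (simp add: L2_inner_def ft_eq)
  next
    fix f and \<epsilon> :: real assume f: "f \<in> L2_space M" and "\<epsilon> > 0"
    have "approximable T f" by (rule approximable_all[OF bdd TL Tadd Tmult exps f])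
    moreover have "\<epsilon>\<^sup>2 > 0" using \<open>\<epsilon> > 0\<close> by simp
    ultimately obtain h where h: "h \<in> T" "sqn (\<lambda>x. f x - h x) < \<epsilon>\<^sup>2" unfolding approximable_def by blast
    obtain F c where F: "finite F" "F \<subseteq> \<Lambda>" "h = (\<lambda>x. \<Sum>i\<in>F. c i * e i x)" using h(1) by (rule TE)
    have "L2_norm M (\<lambda>x. f x - h x) < \<epsilon>"
      using h(2) \<open>\<epsilon> > 0\<close> by (simp add: L2_norm_def sqn_def real_less_lsqrt)
    then show "\<exists>F c. finite F \<and> F \<subseteq> \<Lambda> \<and> L2_norm M (\<lambda>x. f x - (\<Sum>i\<in>F. c i * e i x)) < \<epsilon>"
      using F by blast
  qed
  then show ?thesis unfolding is_spectrum_iff e_def[abs_def] using \<Lambda> by blast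
qed

end

section \<open>The spectrum for integral inverse ratios\<close>

context bernoulli
begin

text \<open>As \<open>L = \<rho> * (L + N)\<close>, a point beyond \<open>L + h\<close> comes under
  every digit map from a point beyond \<open>L + h / \<rho>\<close>. Iterating, the mass beyond
  \<open>L + 1\<close> is bounded by masses that tend to 0.\<close>

lemma self_similar_bound:
  fixes L :: real
  defines "L \<equiv> real N * \<rho> / (1 - \<rho>)"
  shows "AE x in mu \<rho> N. \<bar>x\<bar> \<le> L + 1"
proof -
  define A where "A h = {x::real. \<bar>x\<bar> > L + h}" for h
  have [measurable]: "A h \<in> sets borel" for h unfolding A_def by measurable
  have L: "L / \<rho> - real N = L" using rho by (simp add: L_def field_simps)
  have step: "prob (A h) \<le> prob (A (h / \<rho>))" for h
  proof -
    have "prob (A h) = 1 / real N * (\<Sum>j<N. prob {x. \<rho> * (x + real j) \<in> A h})"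
      using self_similar_mu[OF rho N] unfolding self_similar_def digit_image_eq[OF rho(1)] by simp
    also have "\<dots> \<le> 1 / real N * (\<Sum>j<N. prob (A (h / \<rho>)))"
    proof (intro mult_left_mono sum_mono finite_measure_mono)
      fix j assume j: "j \<in> {..<N}"
      show "{x. \<rho> * (x + real j) \<in> A h} \<subseteq> A (h / \<rho>)"
      proof
        fix x assume "x \<in> {x. \<rho> * (x + real j) \<in> A h}"
        then have "L + h < \<rho> * \<bar>x + real j\<bar>" using rho by (simp add: A_def abs_mult)
        then have "L / \<rho> + h / \<rho> < \<bar>x + real j\<bar>" using rho by (simp add: field_simps)
        also have "\<bar>x + real j\<bar> \<le> \<bar>x\<bar> + real N" using j by simp
        finally show "x \<in> A (h / \<rho>)" using L by (simp add: A_def)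
      qed
    qed simp_all
    also have "\<dots> = prob (A (h / \<rho>))" using N by simp
    finally show ?thesis .
  qed
  have le: "prob (A 1) \<le> prob (A ((1 / \<rho>) ^ n))" for n
  proof (induction n)
    case (Suc n)
    then show ?case using step[of "(1 / \<rho>) ^ n"] by (simp add: field_simps)
  qed simp
  have "(\<lambda>n. prob (A ((1 / \<rho>) ^ n))) \<longlonglongrightarrow> prob (\<Inter>n. A ((1 / \<rho>) ^ n))"
  proof (rule finite_Lim_measure_decseq)
    show "decseq (\<lambda>n. A ((1 / \<rho>) ^ n))"
    proof (rule decseq_SucI)
      fix n
      have "(1 / \<rho>) ^ n \<le> (1 / \<rho>) ^ Suc n" using rho by (intro power_increasing) auto
      then show "A ((1 / \<rho>) ^ Suc n) \<subseteq> A ((1 / \<rho>) ^ n)" by (auto simp: A_def)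
    qed
  qed auto
  moreover have "(\<Inter>n. A ((1 / \<rho>) ^ n)) = {}"
  proof (rule ccontr)
    assume "\<not> ?thesis"
    then obtain x where x: "x \<in> A ((1 / \<rho>) ^ n)" for n by blast
    obtain n where "\<bar>x\<bar> < (1 / \<rho>) ^ n" using real_arch_pow[of "1 / \<rho>" "\<bar>x\<bar>"] rho by auto
    moreover have "L \<ge> 0" using rho by (simp add: L_def)
    ultimately show False using x[of n] by (simp add: A_def)
  qed
  ultimately have "prob (A 1) \<le> 0" using le by (intro LIMSEQ_le_const[of _ 0]) auto
  then have "prob (A 1) = 0" by (simp add: measure_le_0_iff)
  then have "AE x in mu \<rho> N. x \<notin> A 1"
    by (intro AE_not_in) (simp add: null_sets_def emeasure_eq_measure)
  then show ?thesis by eventually_elim (simp add: A_def)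
qed

lemma compact_support: "compact (measure_support (mu \<rho> N))"
proof -
  let ?M = "mu \<rho> N"
  define L where "L = real N * \<rho> / (1 - \<rho>) + 1"
  have "closed (measure_support ?M)"
    unfolding closed_def
  proof (subst open_subopen, rule ballI)
    fix x assume "x \<in> - measure_support ?M"
    then obtain U where U: "open U" "x \<in> U" "\<not> emeasure ?M U > 0" by (auto simp: measure_support_def)
    then have "U \<subseteq> - measure_support ?M" by (auto simp: measure_support_def)
    then show "\<exists>T. open T \<and> x \<in> T \<and> T \<subseteq> - measure_support ?M" using U by blast
  qed
  moreover have "measure_support ?M \<subseteq> {-L..L}"
  proof
    fix x assume x: "x \<in> measure_support ?M"
    have "AE y in ?M. y \<notin> {y. \<bar>y\<bar> > L}" using self_similar_bound unfolding L_def by eventually_elim simp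
    moreover have m: "{y. \<bar>y\<bar> > L} \<in> sets borel" by measurable
    ultimately have "emeasure ?M {y. \<bar>y\<bar> > L} = 0"
      by (subst (asm) AE_iff_measurable[OF _ refl]) (auto simp: Collect_neg_eq)
    moreover have "open {y. \<bar>y\<bar> > L}" by (intro open_Collect_less continuous_intros)
    ultimately have "\<not> \<bar>x\<bar> > L" using x by (auto simp: measure_support_def)
    then show "x \<in> {-L..L}" by (simp add: abs_le_iff not_less)
  qed
  ultimately show ?thesis by (metis bounded_closed_interval bounded_subset compact_eq_bounded_closed)
qed

end

locale integral_bernoulli = bernoulli +
  fixes q :: nat
  assumes q: "q > 1" "N dvd q" and rho_eq: "\<rho> = 1 / real q"
begin

text \<open>Adding a multiple \<open>weight n * a\<close> changes the arguments of the masks of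
  levels up to \<open>n\<close> by integers only, as \<open>N\<close> divides \<open>q\<close>, and
  moves that of level \<open>Suc n\<close> by \<open>a / N\<close> up to sign.\<close>

definition weight :: "nat \<Rightarrow> real" where
  "weight n = (- real q) ^ n * real (q div N)"

text \<open>Alternating signs keep the normalised frequencies \<open>\<rho>\<^sup>n s\<close> away from \<open>\<plusminus>1\<close>, also when \<open>q = N\<close>.\<close>

fun freqs :: "nat \<Rightarrow> real set" where
  "freqs 0 = {0}"
| "freqs (Suc n) = (\<lambda>(s, a). s + weight n * real a) ` (freqs n \<times> {..<N})"

lemma weight_scaled: "\<rho> ^ Suc n * (weight n * x) = (-1) ^ n * (x / real N)"
proof -
  have "real (q div N) = real q / real N" using q(2) by (rule real_of_nat_div)
  moreover have "(- real q) ^ n = (-1) ^ n * real q ^ n" by (rule power_minus)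
  ultimately show ?thesis using q(1) N by (simp add: weight_def rho_eq power_divide)
qed

lemma P_add_weight: "P n (x + weight n * of_int a) = P n x"
  unfolding P_def
proof (rule prod.cong[OF refl])
  fix j assume j: "j \<in> {1..n}"
  have "\<rho> ^ j * weight n = of_int ((-1) ^ n * int q ^ (n - j) * int (q div N))"
  proof -
    have "real q ^ n = real q ^ (n - j) * real q ^ j" using j by (simp flip: power_add)
    moreover have "(- real q) ^ n = (-1) ^ n * real q ^ n" by (rule power_minus)
    ultimately show ?thesis using q(1) by (simp add: weight_def rho_eq power_divide)
  qed
  then have "\<rho> ^ j * (x + weight n * of_int a) = \<rho> ^ j * x + of_int ((-1) ^ n * int q ^ (n - j) * int (q div N) * a)"
    by (simp add: distrib_left mult.assoc[symmetric])
  then show "mask N (\<rho> ^ j * (x + weight n * of_int a)) = mask N (\<rho> ^ j * x)"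
    by (simp only: mask_add_int)
qed

lemma finite_freqs: "finite (freqs n)"
  by (induction n) auto

lemma weight_nonzero: "weight n \<noteq> 0"
  using weight_scaled[of n 1] N by auto

text \<open>Multiples of \<open>weight n\<close> are periods of \<open>P n\<close>, so distinct
  earlier parts are settled by induction; if they agree, the mask of level \<open>Suc n\<close>
  vanishes on the difference.\<close>

lemma freqs_orthogonal: "s \<in> freqs n \<Longrightarrow> u \<in> freqs n \<Longrightarrow> s \<noteq> u \<Longrightarrow> P n (s - u) = 0"
proof (induction n arbitrary: s u)
  case (Suc n)
  obtain s' a where s: "s' \<in> freqs n" "a < N" "s = s' + weight n * real a" using Suc.prems(1) by auto
  obtain u' b where u: "u' \<in> freqs n" "b < N" "u = u' + weight n * real b" using Suc.prems(2) by auto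
  have d: "s - u = (s' - u') + weight n * of_int (int a - int b)" unfolding s u by (simp add: algebra_simps)
  show ?case
  proof (cases "s' = u'")
    case False
    then have "P n (s - u) = 0" unfolding d P_add_weight using Suc.IH s u by blast
    then show ?thesis by (simp add: P_Suc)
  next
    case True
    then have ab: "a \<noteq> b" using Suc.prems(3) s u by auto
    define c where "c = (-1) ^ n * (int a - int b)"
    have "s - u = weight n * of_int (int a - int b)" using d True by simp
    then have "\<rho> ^ Suc n * (s - u) = (-1) ^ n * (of_int (int a - int b) / real N)"
      by (simp only: weight_scaled)
    then have "real N * (\<rho> ^ Suc n * (s - u)) = of_int c" using N by (simp add: c_def)
    moreover have "\<not> int N dvd c"
    proof -
      have "\<bar>c\<bar> = \<bar>int a - int b\<bar>" by (simp add: c_def abs_mult)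
      then have "c \<noteq> 0" "\<bar>c\<bar> < int N" using ab s(2) u(2) by auto
      then show ?thesis using dvd_imp_le_int[of c "int N"] by auto
    qed
    ultimately have "mask N (\<rho> ^ Suc n * (s - u)) = 0" using N mask_eq_0_iff[of N] by blast
    then show ?thesis by (simp add: P_Suc)
  qed
qed simp

text \<open>If two sums agree, then \<open>s - u\<close> is a period of \<open>P n\<close>, so
  \<open>P n (s - u) = P n 0 = 1\<close>, and orthogonality forces \<open>s = u\<close>.\<close>

lemma freqs_inj: "inj_on (\<lambda>(s, a). s + weight n * real a) (freqs n \<times> {..<N})"
proof (rule inj_onI, clarify)
  fix s a u b assume su: "s \<in> freqs n" "u \<in> freqs n" and eq: "s + weight n * real a = u + weight n * real b"
  have "s - u = 0 + weight n * of_int (int b - int a)" using eq by (simp add: algebra_simps)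
  then have "P n (s - u) = P n 0" by (simp only: P_add_weight)
  also have "\<dots> = 1" using N by (simp add: P_def)
  finally have "s = u" using freqs_orthogonal[OF su] by force
  then show "s = u \<and> a = b" using eq weight_nonzero by auto
qed

text \<open>A new digit \<open>a\<close> affects only the mask of level \<open>Suc n\<close>, and
  summing its squares over \<open>a\<close> gives 1.\<close>

lemma sum_P_freqs: "(\<Sum>s\<in>freqs n. (norm (P n (x + s)))\<^sup>2) = 1"
proof (induction n)
  case (Suc n)
  have split: "P (Suc n) (x + (s + weight n * real a))
      = P n (x + s) * mask N (\<rho> ^ Suc n * (x + s) + (-1) ^ n * real a / real N)" for s a
  proof -
    have "P n (x + (s + weight n * real a)) = P n (x + s)"
      using P_add_weight[of n "x + s" "int a"] by (simp add: add.assoc)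
    moreover have "\<rho> ^ Suc n * (x + (s + weight n * real a)) = \<rho> ^ Suc n * (x + s) + \<rho> ^ Suc n * (weight n * real a)"
      by (simp add: algebra_simps)
    then have "\<rho> ^ Suc n * (x + (s + weight n * real a)) = \<rho> ^ Suc n * (x + s) + (-1) ^ n * real a / real N"
      unfolding weight_scaled by simp
    ultimately show ?thesis by (simp only: P_Suc)
  qed
  have "(\<Sum>s\<in>freqs (Suc n). (norm (P (Suc n) (x + s)))\<^sup>2)
      = (\<Sum>(s, a)\<in>freqs n \<times> {..<N}. (norm (P (Suc n) (x + (s + weight n * real a))))\<^sup>2)"
    by (simp only: freqs.simps sum.reindex[OF freqs_inj]) (simp add: case_prod_beta)
  also have "\<dots> = (\<Sum>s\<in>freqs n. \<Sum>a<N. (norm (P (Suc n) (x + (s + weight n * real a))))\<^sup>2)"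
    by (simp add: sum.cartesian_product)
  also have "\<dots> = (\<Sum>s\<in>freqs n. (norm (P n (x + s)))\<^sup>2 *
      (\<Sum>a<N. (norm (mask N (\<rho> ^ Suc n * (x + s) + (-1) ^ n * real a / real N)))\<^sup>2))"
    unfolding split norm_mult power_mult_distrib sum_distrib_left ..
  also have "\<dots> = (\<Sum>s\<in>freqs n. (norm (P n (x + s)))\<^sup>2)"
  proof (intro sum.cong refl)
    fix s
    have "(-1) ^ n = (1::real) \<or> (-1) ^ n = (-1::real)" by (cases "even n") auto
    then show "(norm (P n (x + s)))\<^sup>2 *
      (\<Sum>a<N. (norm (mask N (\<rho> ^ Suc n * (x + s) + (-1) ^ n * real a / real N)))\<^sup>2) = (norm (P n (x + s)))\<^sup>2"
      using N by (subst sum_norm_mask_sq) auto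
  qed
  also have "\<dots> = 1" by (rule Suc)
  finally show ?case .
qed simp

lemma freqs_mono: "m \<le> n \<Longrightarrow> freqs m \<subseteq> freqs n"
proof (induction rule: dec_induct)
  case (step n)
  have "freqs n \<subseteq> freqs (Suc n)"
  proof
    fix s assume "s \<in> freqs n"
    then show "s \<in> freqs (Suc n)" using N by (auto intro!: image_eqI[of _ _ "(s, 0)"])
  qed
  then show ?case using step by blast
qed simp

text \<open>With its sign \<open>(-1) ^ n\<close>, the normalised frequency obeys
  \<open>w \<mapsto> - \<rho> * w - a / N\<close>, where
  \<open>0 \<le> a / N \<le> 1 - \<rho>\<close>. The asymmetric interval from
  \<open>- 1 / (1 + \<rho>)\<close> to \<open>\<rho> / (1 + \<rho>)\<close> is invariant under these
  maps.\<close>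

lemma freqs_bound:
  assumes "s \<in> freqs n"
  shows "\<bar>\<rho> ^ n * s\<bar> \<le> 1 / (1 + \<rho>)"
proof -
  have "- (1 / (1 + \<rho>)) \<le> (-1) ^ n * (\<rho> ^ n * s) \<and> (-1) ^ n * (\<rho> ^ n * s) \<le> \<rho> / (1 + \<rho>)"
    using assms
  proof (induction n arbitrary: s)
    case (Suc n)
    then obtain u a where s: "u \<in> freqs n" "a < N" "s = u + weight n * real a" by auto
    define w where "w = (-1) ^ n * (\<rho> ^ n * u)"
    have w: "- (1 / (1 + \<rho>)) \<le> w" "w \<le> \<rho> / (1 + \<rho>)" using Suc.IH[OF s(1)] by (auto simp: w_def)
    have "\<rho> ^ Suc n * s = \<rho> ^ Suc n * u + (-1) ^ n * (real a / real N)"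
      unfolding s(3) distrib_left weight_scaled ..
    then have eq: "(-1) ^ Suc n * (\<rho> ^ Suc n * s) = - (\<rho> * w) - real a / real N"
      by (simp add: w_def algebra_simps flip: power_mult_distrib)
    have "real N \<le> real q" using q by (auto intro: dvd_imp_le)
    then have "1 / real q \<le> 1 / real N" using N by (intro divide_left_mono) auto
    moreover have "real a / real N \<le> (real N - 1) / real N" using s(2) by (intro divide_right_mono) auto
    then have "real a / real N \<le> 1 - 1 / real N" using N by (simp add: diff_divide_distrib)
    ultimately have "real a / real N \<le> 1 - \<rho>" unfolding rho_eq by linarith
    moreover have "0 \<le> real a / real N" by simp
    moreover have "\<rho> * w \<le> \<rho> * (\<rho> / (1 + \<rho>))" using w rho by (intro mult_left_mono) auto
    moreover have "\<rho> * - (1 / (1 + \<rho>)) \<le> \<rho> * w" using w rho by (intro mult_left_mono) auto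
    then have "- (\<rho> / (1 + \<rho>)) \<le> \<rho> * w" by simp
    moreover have "\<rho> * (\<rho> / (1 + \<rho>)) + (1 - \<rho>) = 1 / (1 + \<rho>)" using rho by (simp add: field_simps)
    ultimately show ?case unfolding eq by (intro conjI) linarith+
  qed (use rho in auto)
  moreover have "\<rho> / (1 + \<rho>) \<le> 1 / (1 + \<rho>)" using rho by (intro divide_right_mono) auto
  ultimately have "\<bar>(-1) ^ n * (\<rho> ^ n * s)\<bar> \<le> 1 / (1 + \<rho>)" by (simp only: abs_le_iff) linarith
  then show ?thesis by (simp add: abs_mult)
qed

text \<open>A zero of level \<open>k\<close> has modulus at least \<open>q ^ k / N\<close>, hence at
  least 1.\<close>

lemma F_nonzero:
  assumes "\<bar>x\<bar> < 1"
  shows "F x \<noteq> 0"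
proof
  assume "F x = 0"
  then obtain k where k: "k \<ge> 1" "mask N (\<rho> ^ k * x) = 0" using F_eq_0_iff by blast
  then obtain a :: int where a: "real N * (\<rho> ^ k * x) = of_int a" "\<not> int N dvd a"
    using mask_eq_0_iff[of N] N by auto
  then have "a \<noteq> 0" by auto
  then have "1 \<le> \<bar>of_int a :: real\<bar>" by linarith
  also have "\<dots> = real N * \<rho> ^ k * \<bar>x\<bar>" using rho by (simp add: a(1)[symmetric] abs_mult)
  also have "\<dots> \<le> real N * \<rho> * \<bar>x\<bar>"
    using rho k(1) power_decreasing[of 1 k \<rho>] by (intro mult_right_mono mult_left_mono) auto
  also have "\<dots> \<le> 1 * \<bar>x\<bar>"
  proof (rule mult_right_mono)
    have "real N \<le> real q" using q by (auto intro: dvd_imp_le)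
    then show "real N * \<rho> \<le> 1" using q(1) by (simp add: rho_eq)
  qed simp
  finally show False using assms by simp
qed

text \<open>Dominated convergence by hand: on \<open>freqs n\<close> the squares of
  \<open>P n\<close> are bounded by \<open>a s / c\<close> with \<open>c\<close> independent of
  \<open>n\<close>, and the sums of \<open>a\<close> are at most 1 by Bessel.\<close>

lemma freqs_complete:
  assumes e: "\<epsilon> > 0"
  shows "\<exists>S\<subseteq>(\<Union>n. freqs n). finite S \<and> (\<Sum>s\<in>S. (norm (F (x + s)))\<^sup>2) > 1 - \<epsilon>"
proof -
  define b where "b = 1 / (1 + \<rho>)"
  \<comment> \<open>Midway between the bound \<open>b\<close> for normalised frequencies and 1: the
    slack \<open>r - b\<close> accommodates the shift by \<open>x\<close>, and \<open>F\<close> is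
    bounded away from 0 on the compact interval \<open>[-r, r]\<close>.\<close>
  define r where "r = (1 + b) / 2"
  have b: "0 < b" "b < 1" using rho by (simp_all add: b_def)
  then have r: "b < r" "r < 1" "0 < r" by (simp_all add: r_def)
  obtain y where y: "\<bar>y\<bar> \<le> r" and ymin: "\<And>z. \<bar>z\<bar> \<le> r \<Longrightarrow> norm (F y) \<le> norm (F z)"
  proof -
    have "continuous_on {-r..r} (\<lambda>z. norm (F z))"
      by (intro continuous_on_norm continuous_at_imp_continuous_on ballI isCont_ft)
    then obtain y where "y \<in> {-r..r}" "\<forall>z\<in>{-r..r}. norm (F y) \<le> norm (F z)"
      using continuous_attains_inf[of "{-r..r}" "\<lambda>z. norm (F z)"] r by auto
    then show ?thesis using that[of y] by (auto simp: abs_le_iff)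
  qed
  define c where "c = (norm (F y))\<^sup>2"
  have c: "c > 0" using F_nonzero[of y] y r by (simp add: c_def)
  have "(\<lambda>n. \<rho> ^ n * \<bar>x\<bar>) \<longlonglongrightarrow> 0 * \<bar>x\<bar>" using rho by (intro tendsto_intros LIMSEQ_power_zero) auto
  then have "eventually (\<lambda>n. \<rho> ^ n * \<bar>x\<bar> < r - b) sequentially" by (rule order_tendstoD) (use r in simp)
  then obtain n0 where n0: "\<And>n. n \<ge> n0 \<Longrightarrow> \<rho> ^ n * \<bar>x\<bar> < r - b" by (auto simp: eventually_sequentially)
  define a where "a s = (norm (F (x + s)))\<^sup>2" for s
  define Q where "Q n = (\<Sum>s\<in>freqs n. a s)" for n
  have orthF: "F (s - u) = 0" if "s \<in> freqs n" "u \<in> freqs n" "s \<noteq> u" for s u n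
    using freqs_orthogonal[OF that] F_eq_P[of "s - u" n] by simp
  have Q1: "Q n \<le> 1" for n
    unfolding Q_def a_def using finite_freqs orthF by (intro bessel_ft) auto
  have Qinc: "Q m \<le> Q n" if "m \<le> n" for m n
    unfolding Q_def a_def using that freqs_mono finite_freqs by (intro sum_mono2) auto
  then have "incseq Q" by (simp add: incseq_def)
  then obtain l where l: "Q \<longlonglongrightarrow> l" "\<And>n. Q n \<le> l"
    using incseq_convergent[of Q 1] Q1 by auto
  have dom: "(norm (P n (x + s)))\<^sup>2 \<le> a s / c" if s: "s \<in> freqs n" and n: "n \<ge> n0" for s n
  proof -
    have "\<bar>\<rho> ^ n * (x + s)\<bar> \<le> \<rho> ^ n * \<bar>x\<bar> + \<bar>\<rho> ^ n * s\<bar>"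
      using abs_triangle_ineq[of "\<rho> ^ n * x" "\<rho> ^ n * s"] rho by (simp add: distrib_left abs_mult)
    also have "\<dots> \<le> r" using n0[OF n] freqs_bound[OF s] by (simp add: b_def)
    finally have "norm (F y) \<le> norm (F (\<rho> ^ n * (x + s)))" by (rule ymin)
    then have "c \<le> (norm (F (\<rho> ^ n * (x + s))))\<^sup>2" unfolding c_def by (intro power_mono) auto
    then have "(norm (P n (x + s)))\<^sup>2 * c \<le> (norm (P n (x + s)))\<^sup>2 * (norm (F (\<rho> ^ n * (x + s))))\<^sup>2"
      by (intro mult_left_mono) auto
    also have "\<dots> = a s" unfolding a_def by (subst F_eq_P[of "x + s" n]) (simp add: norm_mult power_mult_distrib)
    finally show ?thesis using c by (simp add: field_simps)
  qed
  have P_lim: "(\<lambda>n. (norm (P n z))\<^sup>2) \<longlonglongrightarrow> (norm (F z))\<^sup>2" for z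
  proof -
    have "eventually (\<lambda>n. F (\<rho> ^ n * z) \<noteq> 0) sequentially"
      using tendsto_imp_eventually_ne[OF F_tendsto_1[of z], of 0] by simp
    then have "eventually (\<lambda>n. F z / F (\<rho> ^ n * z) = P n z) sequentially"
      by eventually_elim (use F_eq_P[of z] in \<open>simp add: field_simps\<close>)
    moreover have "(\<lambda>n. F z / F (\<rho> ^ n * z)) \<longlonglongrightarrow> F z / 1" by (intro tendsto_divide tendsto_const F_tendsto_1) simp
    ultimately have "(\<lambda>n. P n z) \<longlonglongrightarrow> F z / 1" by (rule Lim_transform_eventually[rotated])
    then show ?thesis by (intro tendsto_intros) simp
  qed
  \<comment> \<open>For fixed \<open>m\<close>, the sum over \<open>freqs m\<close> converges as
    \<open>n\<close> grows, and the rest is at most the tail \<open>(l - Q m) / c\<close>;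
    afterwards \<open>m\<close> tends to infinity and the tail disappears.\<close>
  have fixed: "1 \<le> Q m + (l - Q m) / c" if m: "m \<ge> n0" for m
  proof (rule LIMSEQ_le_const)
    show "(\<lambda>n. (\<Sum>s\<in>freqs m. (norm (P n (x + s)))\<^sup>2) + (l - Q m) / c) \<longlonglongrightarrow> Q m + (l - Q m) / c"
      unfolding Q_def a_def by (intro tendsto_intros P_lim)
    have "1 \<le> (\<Sum>s\<in>freqs m. (norm (P n (x + s)))\<^sup>2) + (l - Q m) / c" if n: "n \<ge> m" for n
    proof -
      have "1 = (\<Sum>s\<in>freqs n. (norm (P n (x + s)))\<^sup>2)" by (simp add: sum_P_freqs)
      also have "\<dots> = (\<Sum>s\<in>freqs m. (norm (P n (x + s)))\<^sup>2) + (\<Sum>s\<in>freqs n - freqs m. (norm (P n (x + s)))\<^sup>2)"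
        using sum.subset_diff[OF freqs_mono[OF n] finite_freqs] by (simp add: add.commute)
      also have "(\<Sum>s\<in>freqs n - freqs m. (norm (P n (x + s)))\<^sup>2) \<le> (\<Sum>s\<in>freqs n - freqs m. a s / c)"
        using dom n m by (intro sum_mono) auto
      also have "\<dots> = (Q n - Q m) / c"
        unfolding Q_def using sum_diff[OF finite_freqs freqs_mono[OF n], of a] by (simp flip: sum_divide_distrib)
      also have "\<dots> \<le> (l - Q m) / c" using l(2) c by (intro divide_right_mono) auto
      finally show ?thesis by simp
    qed
    then show "\<exists>k. \<forall>n\<ge>k. 1 \<le> (\<Sum>s\<in>freqs m. (norm (P n (x + s)))\<^sup>2) + (l - Q m) / c" by blast
  qed
  have "1 \<le> l + (l - l) / c"
  proof (rule LIMSEQ_le_const)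
    show "(\<lambda>m. Q m + (l - Q m) / c) \<longlonglongrightarrow> l + (l - l) / c" by (intro tendsto_intros l(1)) (use c in simp)
    show "\<exists>k. \<forall>m\<ge>k. 1 \<le> Q m + (l - Q m) / c" using fixed by blast
  qed
  then have "1 - \<epsilon> < l" using e by simp
  then have "eventually (\<lambda>n. 1 - \<epsilon> < Q n) sequentially" using l(1) by (rule order_tendstoD(1)[rotated])
  then obtain n where "1 - \<epsilon> < Q n" by (auto simp: eventually_sequentially)
  then show ?thesis unfolding Q_def a_def using finite_freqs by (intro exI[of _ "freqs n"]) auto
qed

lemma spectral: "spectral_measure (mu \<rho> N)"
proof -
  define \<Lambda> where "\<Lambda> = (\<Union>n. freqs n)"
  have "is_spectrum (mu \<rho> N) \<Lambda>"
  proof (rule is_spectrumI[OF self_similar_bound])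
    show "0 < real N * \<rho> / (1 - \<rho>) + 1" using rho by (intro add_nonneg_pos) auto
    show "countable \<Lambda>" unfolding \<Lambda>_def by (intro countable_UN countable_finite[OF finite_freqs]) auto
    show "F (s - t) = 0" if st: "s \<in> \<Lambda>" "t \<in> \<Lambda>" "s \<noteq> t" for s t
    proof -
      obtain m n where "s \<in> freqs m" "t \<in> freqs n" using st by (auto simp: \<Lambda>_def)
      then have "s \<in> freqs (max m n)" "t \<in> freqs (max m n)"
        using freqs_mono[of m "max m n"] freqs_mono[of n "max m n"] by auto
      then have "P (max m n) (s - t) = 0" using st(3) by (rule freqs_orthogonal)
      then show ?thesis using F_eq_P[of "s - t" "max m n"] by simp
    qed
    show "\<exists>S\<subseteq>\<Lambda>. finite S \<and> 1 - \<epsilon> < (\<Sum>s\<in>S. (norm (F (x + s)))\<^sup>2)" if "\<epsilon> > 0" for x \<epsilon>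
      unfolding \<Lambda>_def by (rule freqs_complete[OF that])
  qed
  then show ?thesis
    unfolding spectral_measure_def using prob_space_mu sets_mu rho N compact_support by blast
qed

end

theorem theorem1p1:
  fixes \<rho> :: real and N :: nat
  assumes "0 < \<rho>" and "\<rho> < 1" and "N > 1"
  shows "spectral_measure (mu \<rho> N) \<longleftrightarrow> (\<exists>q::nat. q > 1 \<and> N dvd q \<and> \<rho> = 1 / real q)"
proof
  assume "spectral_measure (mu \<rho> N)"
  then obtain \<Lambda> where "is_spectrum (mu \<rho> N) \<Lambda>" unfolding spectral_measure_def by blast
  then interpret bernoulli_spectrum \<rho> N \<Lambda> by unfold_locales (use assms in auto)
  show "\<exists>q::nat. q > 1 \<and> N dvd q \<and> \<rho> = 1 / real q" by (rule integral_inverse_ratio)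
next
  assume "\<exists>q::nat. q > 1 \<and> N dvd q \<and> \<rho> = 1 / real q"
  then obtain q :: nat where "q > 1" "N dvd q" "\<rho> = 1 / real q" by blast
  then interpret integral_bernoulli \<rho> N q by unfold_locales (use assms in auto)
  show "spectral_measure (mu \<rho> N)" by (rule spectral)
qed

end
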